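(* Let $m,n\ge2$ be integers with $mn\ge 6$ such that all the reflections $\phi_i$ described in the context are realized by affine automorphisms of $S_{m,n}$ and of $S_{n,m}$. If $w$ is a non-periodic cutting sequence of a bi-infinite linear trajectory on $S_{m,n}$ in direction $\theta\in[0,2\pi]$, then $$\theta=[b_0;a_1,b_1,a_2,b_2,\dots]_{m,n},$$ where $0\le b_0\le 2n-1$ is such that $\theta\in\Sigma_{b_0}^{m,n}$ and the two sequences $(a_k)_{k\ge1}\in\{1,\dots,m-1\}^{\mathbb N}$ and $(b_k)_{k\ge1}\in\{1,\dots,n-1\}^{\mathbb N}$ are a pair of sequences of admissible sectors associated to $w$.
   Context: **Surface.** For $a,b\ge 0$ let $P_n(a,b)$ be the equiangular polygon whose edges, indexed by $i\in\mathbb Z/2n$ and traversed counterclockwise, have edge vectors $a(\cos\frac{i\pi}{n},\sin\frac{i\pi}{n})$ for $i$ even and $b(\cos\frac{i\pi}{n},\sin\frac{i\pi}{n})$ for $i$ odd (edges of length $0$ are omitted; for $n=2$ this may degenerate to a two-sided segment). For $0\le k\le m-1$ put $P(k)=P_n(\sin\frac{k\pi}{m},\sin\frac{(k+1)\pi}{m})$ if $n$ is odd or $k$ is even, and $P(k)=P_n(\sin\frac{(k+1)\pi}{m},\sin\frac{k\pi}{m})$ if $n$ is even and $k$ is odd. The right edges of $P(k)$ are those of odd index in the first case and those of even index in the second case. The Bouw–Möller surface $S_{m,n}$ is obtained from $P(0),\dots,P(m-1)$ by gluing, for $0\le k\le m-2$, each right edge of $P(k)$, of index $e$, by translation to the edge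 of $P(k+1)$ of index $e+n$ mod $2n$. The glued edges are labeled by $L_{m,n}=\{1,\dots,n(m-1)\}$: for $1\le r\le m-1$, $1\le s\le n$, the label $(r-1)n+s$ is given to the right edge of $P(r-1)$ of index $e(s)$ mod $2n$, where, if right edges of $P(r-1)$ have odd index, $e(s)=s$ for $s$ odd and $e(s)=1-s$ for $s$ even; if they have even index, $e(s)=s$ for $s$ even and $e(s)=1-s$ for $s$ odd. A bi-infinite linear trajectory is a straight line with constant direction on the surface, defined for all times and never hitting a vertex; its cutting sequence is the bi-infinite sequence of labels of edges crossed (origin arbitrary). $S_{n,m}$, $L_{n,m}$ are defined by exchanging $m$ and $n$. **Transition diagrams.** $\Sigma_i^{m,n}=[i\pi/n,(i+1)\pi/n]$, $0\le i\le 2n-1$. $T_i^{m,n}$ is the directed graph on $L_{m,n}$ with an arrow $p\to q$ iff some trajectory on $S_{m,n}$ with direction in $\Sigma_i^{m,n}$ crosses edge $p$ and then, next, edge $q$. A word is admissible in $T_i^{m,n}$ if it is a path in it. **Derivation.** Explicitly, $T_0^{m,n}$ has vertices at positions $(r,c)$, $1\le r\le m-1$, $1\le c\le n$, the vertex at $(r,c)$ being the label $(r-1)n+c$ if $r$ is odd and $rn+1-c$ if $r$ is even; it has arrows in both directions between $(r,c)$ and $(r,c+1)$, and vertical arrows $(r,c)\to(r+1,c)$ for $c$ odd, $(r+1,c)\to(r,c)$ for $c$ even. The derivation diagram $D_0^{m,n}$ is $T_0^{m,n}$ with horizontal arrows labeled by $L_{n,m}$ (vertical arrows unlabeled): for $c$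 odd, $(r,c+1)\to(r,c)$ has label $(c-1)m+r$ and $(r,c)\to(r,c+1)$ has label $(c-1)m+r+1$; for $c$ even, $(r,c)\to(r,c+1)$ has label $cm-r+1$ and $(r,c+1)\to(r,c)$ has label $cm-r$. For $w$ admissible in $T_0^{m,n}$, $\mathbf D_{m,n}w\in L_{n,m}^{\mathbb Z}$ is the sequence of arrow labels read along the path $w$ in $D_0^{m,n}$. **Normalization.** For $0\le i\le 2n-1$, $\phi_i^{m,n}$ is the reflection of the plane across the line of angle $(i+1)\pi/(2n)$; it maps $\Sigma_i^{m,n}$ onto $\Sigma_0^{m,n}$. It is a standing convention that it is realized by an affine automorphism of $S_{m,n}$ obtained by reflecting each polygon (each reflected $P(k)$ being carried to $P(k)$, or each to $P(m-1-k)$); $\pi_i^{m,n}$ is the induced permutation of $L_{m,n}$. If $w$ is admissible in $T_i^{m,n}$, $\mathbf N_{m,n}w=\pi_i^{m,n}w$, which is admissible in $T_0^{m,n}$. **Sequences of admissible sectors.** For the cutting sequence $w$ of a trajectory in direction $\theta\in\Sigma_{b_0}^{m,n}$, put $w^1=\mathbf D_{m,n}(\pi_{b_0}^{m,n}w)$, and then $w^{k+1}=\mathbf D_{n,m}(\mathbf N_{n,m}w^k)$ for $k$ odd, $w^{k+1}=\mathbf D_{m,n}(\mathbf N_{m,n}w^k)$ for even $k\ge2$. The pair $(a_k),(b_k)$ of sequences of admissible sectors is such that $w^{2k-1}$ is admissible in $T_{a_k}^{n,m}$, $1\le a_k\le m-1$, and $w^{2k}$ is admissible in $T_{b_k}^{m,n}$,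 $1\le b_k\le n-1$, for all $k\ge1$ (it exists, and is unique for non-periodic $w$). **Farey map and continued fraction.** Let $\gamma_{m,n}=\begin{pmatrix}-\sqrt{\sin\frac{\pi}{n}/\sin\frac{\pi}{m}} & \dfrac{\cos\frac{\pi}{m}+\cos\frac{\pi}{n}}{\sqrt{\sin\frac{\pi}{m}\sin\frac{\pi}{n}}}\\ 0&\sqrt{\sin\frac{\pi}{m}/\sin\frac{\pi}{n}}\end{pmatrix}$, acting on directions; it maps $\Sigma_0^{m,n}$ onto $[\pi/m,\pi]=\bigcup_{j=1}^{m-1}\Sigma_j^{n,m}$. Define $F_{m,n}:\Sigma_0^{m,n}\to\Sigma_0^{n,m}$ by $F_{m,n}(\theta)=\phi_j^{n,m}\gamma_{m,n}[\theta]$ if $\gamma_{m,n}[\theta]\in\Sigma_j^{n,m}$, $1\le j\le m-1$, and $\mathcal F_{m,n}=F_{n,m}\circ F_{m,n}$. For $1\le i\le m-1$, $1\le j\le n-1$ let $\Sigma(i,j)=\{\theta\in\Sigma_0^{m,n}:\gamma_{m,n}[\theta]\in\Sigma_i^{n,m},\ \gamma_{n,m}[\phi_i^{n,m}\gamma_{m,n}[\theta]]\in\Sigma_j^{m,n}\}$ and let $\mathcal F_{i,j}=\phi_j^{m,n}\gamma_{n,m}\phi_i^{n,m}\gamma_{m,n}:\Sigma(i,j)\to\Sigma_0^{m,n}$ be the corresponding branch of $\mathcal F_{m,n}$, a monotone bijection. For sequences $(a_k),(b_k)$ with $a_k\in\{1,\dots,m-1\}$, $b_k\in\{1,\dots,n-1\}$,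 the intersection $\bigcap_{k\ge1}\mathcal F_{a_1,b_1}^{-1}\mathcal F_{a_2,b_2}^{-1}\cdots\mathcal F_{a_k,b_k}^{-1}(\Sigma_0^{m,n})$ is a single point, denoted $[a_1,b_1,a_2,b_2,\dots]_{m,n}$. For $0\le b_0\le 2n-1$, $[b_0;a_1,b_1,a_2,b_2,\dots]_{m,n}:=(\phi_{b_0}^{m,n})^{-1}\big[[a_1,b_1,a_2,b_2,\dots]_{m,n}\big]$, which lies in $\Sigma_{b_0}^{m,n}$. *)

theory Defs
  imports "HOL-Analysis.Analysis"
begin

text \<open>
  Every notion depends on an ordered pair \<open>m n\<close>; the objects of the dual surface \<open>S\<^sub>n\<^sub>,\<^sub>m\<close> are
  obtained by exchanging the two arguments. The plane is the type \<^typ>\<open>complex\<close>. Edge indices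
  modulo \<open>2 n\<close> are represented by \<open>{..<2 * n}\<close>, polygons by their index \<open>k < m\<close>.
\<close>

definition eqpoly_edge :: "nat \<Rightarrow> real \<Rightarrow> real \<Rightarrow> nat \<Rightarrow> complex" where
  "eqpoly_edge n a b i = (if even i then a else b) *\<^sub>R cis (real i * pi / real n)"

definition edge_vec :: "nat \<Rightarrow> nat \<Rightarrow> nat \<Rightarrow> nat \<Rightarrow> complex" where
  "edge_vec m n k =
     (let s = sin (real k * pi / real m); t = sin (real (k + 1) * pi / real m)
      in if odd n \<or> even k then eqpoly_edge n s t else eqpoly_edge n t s)"

text \<open>
  \<open>P(k)\<close> is placed with its vertex number 0 at the origin; its edge \<open>e\<close> runs from vertex \<open>e\<close> to
  vertex \<open>e + 1\<close>, and vertex \<open>2 n\<close> is again the origin. An omitted edge is one with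
  \<open>edge_vec m n k e = 0\<close>; its open segment below is empty, so nothing ever crosses it.
\<close>

definition vertex :: "nat \<Rightarrow> nat \<Rightarrow> nat \<Rightarrow> nat \<Rightarrow> complex" where
  "vertex m n k e = (\<Sum>i<e. edge_vec m n k i)"

definition polygon :: "nat \<Rightarrow> nat \<Rightarrow> nat \<Rightarrow> complex set" where
  "polygon m n k = convex hull (vertex m n k ` {..<2 * n})"

definition edge_interior :: "nat \<Rightarrow> nat \<Rightarrow> nat \<Rightarrow> nat \<Rightarrow> complex set" where
  "edge_interior m n k e = open_segment (vertex m n k e) (vertex m n k (Suc e))"

definition right_edge :: "nat \<Rightarrow> nat \<Rightarrow> nat \<Rightarrow> bool" where
  "right_edge n k e \<longleftrightarrow> (if odd n \<or> even k then odd e else even e)"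

inductive glued :: "nat \<Rightarrow> nat \<Rightarrow> nat \<times> nat \<Rightarrow> nat \<times> nat \<Rightarrow> bool" for m n where
  forward: "\<lbrakk>k + 1 < m; e < 2 * n; right_edge n k e\<rbrakk>
    \<Longrightarrow> glued m n (k, e) (k + 1, (e + n) mod (2 * n))"
| backward: "\<lbrakk>k + 1 < m; e < 2 * n; right_edge n k e\<rbrakk>
    \<Longrightarrow> glued m n (k + 1, (e + n) mod (2 * n)) (k, e)"

text \<open>
  \<open>glue_map m n (k, e) (k', e')\<close> is the translation taking edge \<open>e\<close> of \<open>P(k)\<close> to edge \<open>e'\<close> of
  \<open>P(k')\<close>. Glued edges have opposite edge vectors, so the start of one goes to the end of the other.
\<close>

fun glue_map :: "nat \<Rightarrow> nat \<Rightarrow> nat \<times> nat \<Rightarrow> nat \<times> nat \<Rightarrow> complex \<Rightarrow> complex" where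
  "glue_map m n (k, e) (k', e') z = z - vertex m n k e + vertex m n k' (Suc e')"

definition labels :: "nat \<Rightarrow> nat \<Rightarrow> nat set" where
  "labels m n = {1..n * (m - 1)}"

text \<open>The index \<open>e(s)\<close>; \<open>2 n + 1 - s\<close> represents \<open>1 - s\<close> modulo \<open>2 n\<close>.\<close>

definition label_index :: "nat \<Rightarrow> nat \<Rightarrow> nat \<Rightarrow> nat" where
  "label_index n r s = (if right_edge n (r - 1) s then s else (2 * n + 1 - s) mod (2 * n))"

text \<open>\<open>edge_label m n x l\<close>: the polygon edge \<open>x = (k, e)\<close> carries the label \<open>l\<close>.\<close>

inductive edge_label :: "nat \<Rightarrow> nat \<Rightarrow> nat \<times> nat \<Rightarrow> nat \<Rightarrow> bool" for m n where
  right: "\<lbrakk>1 \<le> r; r \<le> m - 1; 1 \<le> s; s \<le> n\<rbrakk>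
    \<Longrightarrow> edge_label m n (r - 1, label_index n r s) ((r - 1) * n + s)"
| across: "\<lbrakk>edge_label m n x l; glued m n x y\<rbrakk> \<Longrightarrow> edge_label m n y l"

text \<open>
  A trajectory is described by its edge crossings: at time \<open>\<tau> j\<close> it enters \<open>P(k j)\<close> at the point
  \<open>p j\<close> of the edge \<open>e j\<close>, moves in direction \<open>\<theta>\<close>, and at time \<open>\<tau> (j + 1)\<close> leaves \<open>P(k j)\<close> through the
  edge \<open>f j\<close>. Edges are traversed counterclockwise, so the sign of \<open>Im (cnj v * cis \<theta>)\<close>, the
  cross product of the edge vector \<open>v\<close> and the direction, tells whether the edge is crossed inwards.
  Crossing times may coincide because a two-sided segment (which occurs for \<open>n = 2\<close>) is crossed in
  zero time. The last two conditions say that the trajectory is defined for all times.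
\<close>

definition linear_trajectory ::
  "nat \<Rightarrow> nat \<Rightarrow> real \<Rightarrow> (int \<Rightarrow> nat) \<Rightarrow> (int \<Rightarrow> nat) \<Rightarrow> (int \<Rightarrow> nat) \<Rightarrow> (int \<Rightarrow> complex) \<Rightarrow>
    (int \<Rightarrow> real) \<Rightarrow> bool" where
  "linear_trajectory m n \<theta> k e f p \<tau> \<longleftrightarrow>
     (\<forall>j. k j < m \<and> e j < 2 * n \<and> f j < 2 * n \<and>
          p j \<in> edge_interior m n (k j) (e j) \<and>
          Im (cnj (edge_vec m n (k j) (e j)) * cis \<theta>) > 0 \<and>
          \<tau> j \<le> \<tau> (j + 1) \<and>
          (let q = p j + (\<tau> (j + 1) - \<tau> j) *\<^sub>R cis \<theta> in
             q \<in> edge_interior m n (k j) (f j) \<and>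
             Im (cnj (edge_vec m n (k j) (f j)) * cis \<theta>) < 0 \<and>
             glued m n (k j, f j) (k (j + 1), e (j + 1)) \<and>
             p (j + 1) = glue_map m n (k j, f j) (k (j + 1), e (j + 1)) q)) \<and>
     filterlim \<tau> at_top at_top \<and> filterlim \<tau> at_bot at_bot"

definition cutting_sequence :: "nat \<Rightarrow> nat \<Rightarrow> real \<Rightarrow> (int \<Rightarrow> nat) \<Rightarrow> bool" where
  "cutting_sequence m n \<theta> w \<longleftrightarrow>
     (\<exists>k e f p \<tau>. linear_trajectory m n \<theta> k e f p \<tau> \<and> (\<forall>j. edge_label m n (k j, e j) (w j)))"

definition periodic_word :: "(int \<Rightarrow> nat) \<Rightarrow> bool" where
  "periodic_word w \<longleftrightarrow> (\<exists>t>0. \<forall>j. w (j + t) = w j)"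

definition sector :: "nat \<Rightarrow> nat \<Rightarrow> real set" where
  "sector n i = {real i * pi / real n .. real (i + 1) * pi / real n}"

definition transition :: "nat \<Rightarrow> nat \<Rightarrow> nat \<Rightarrow> nat \<Rightarrow> nat \<Rightarrow> bool" where
  "transition m n i x y \<longleftrightarrow>
     (\<exists>\<theta> u j. \<theta> \<in> sector n i \<and> cutting_sequence m n \<theta> u \<and> u j = x \<and> u (j + 1) = y)"

definition admissible :: "nat \<Rightarrow> nat \<Rightarrow> nat \<Rightarrow> (int \<Rightarrow> nat) \<Rightarrow> bool" where
  "admissible m n i w \<longleftrightarrow> (\<forall>j. transition m n i (w j) (w (j + 1)))"

definition diagram_vertex :: "nat \<Rightarrow> nat \<Rightarrow> nat \<Rightarrow> nat" where
  "diagram_vertex n r c = (if odd r then (r - 1) * n + c else r * n + 1 - c)"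

text \<open>\<open>arrow_label m n x y l\<close>: \<open>x \<rightarrow> y\<close> is a horizontal arrow of the derivation diagram, labeled \<open>l\<close>.\<close>

inductive arrow_label :: "nat \<Rightarrow> nat \<Rightarrow> nat \<Rightarrow> nat \<Rightarrow> nat \<Rightarrow> bool" for m n where
  odd_left: "\<lbrakk>1 \<le> r; r \<le> m - 1; 1 \<le> c; c < n; odd c\<rbrakk> \<Longrightarrow>
    arrow_label m n (diagram_vertex n r (c + 1)) (diagram_vertex n r c) ((c - 1) * m + r)"
| odd_right: "\<lbrakk>1 \<le> r; r \<le> m - 1; 1 \<le> c; c < n; odd c\<rbrakk> \<Longrightarrow>
    arrow_label m n (diagram_vertex n r c) (diagram_vertex n r (c + 1)) ((c - 1) * m + r + 1)"
| even_right: "\<lbrakk>1 \<le> r; r \<le> m - 1; 1 \<le> c; c < n; even c\<rbrakk> \<Longrightarrow>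
    arrow_label m n (diagram_vertex n r c) (diagram_vertex n r (c + 1)) (c * m - r + 1)"
| even_left: "\<lbrakk>1 \<le> r; r \<le> m - 1; 1 \<le> c; c < n; even c\<rbrakk> \<Longrightarrow>
    arrow_label m n (diagram_vertex n r (c + 1)) (diagram_vertex n r c) (c * m - r)"

text \<open>
  \<open>is_derivative m n w u\<close>: \<open>u\<close> is the derived sequence of \<open>w\<close>. The strictly increasing \<open>h\<close> enumerates
  the positions of \<open>w\<close> at which a labeled arrow is followed (unlabeled arrows contribute nothing).
  This is a relation because the origin of a bi-infinite sequence is arbitrary: \<open>u\<close> is determined
  up to a shift.
\<close>

definition is_derivative :: "nat \<Rightarrow> nat \<Rightarrow> (int \<Rightarrow> nat) \<Rightarrow> (int \<Rightarrow> nat) \<Rightarrow> bool" where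
  "is_derivative m n w u \<longleftrightarrow>
     (\<exists>h :: int \<Rightarrow> int. strict_mono h \<and>
        range h = {j. \<exists>l. arrow_label m n (w j) (w (j + 1)) l} \<and>
        (\<forall>i. arrow_label m n (w (h i)) (w (h i + 1)) (u i)))"

definition line_reflection :: "real \<Rightarrow> complex \<Rightarrow> complex" where
  "line_reflection \<alpha> z = cis (2 * \<alpha>) * cnj z"

definition phi :: "nat \<Rightarrow> nat \<Rightarrow> complex \<Rightarrow> complex" where
  "phi n i = line_reflection (real (i + 1) * pi / (2 * real n))"

text \<open>
  \<open>reflection_automorphism m n i \<sigma> c \<epsilon>\<close>: the maps \<open>z \<mapsto> phi n i z + c k\<close> carry each \<open>P(k)\<close> to
  \<open>P(\<sigma> k)\<close>, edge \<open>e\<close> to edge \<open>\<epsilon> (k, e)\<close>, and respect the gluings. A reflection reverses the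
  counterclockwise orientation of edges, hence the exchange of start and end; it is stated on
  oriented edges because the two sides of a two-sided segment coincide as point sets.
\<close>

definition reflection_automorphism ::
  "nat \<Rightarrow> nat \<Rightarrow> nat \<Rightarrow> (nat \<Rightarrow> nat) \<Rightarrow> (nat \<Rightarrow> complex) \<Rightarrow> (nat \<times> nat \<Rightarrow> nat) \<Rightarrow> bool" where
  "reflection_automorphism m n i \<sigma> c \<epsilon> \<longleftrightarrow>
     (\<sigma> = (\<lambda>k. k) \<or> \<sigma> = (\<lambda>k. m - 1 - k)) \<and>
     (\<forall>k<m. (\<lambda>z. phi n i z + c k) ` polygon m n k = polygon m n (\<sigma> k)) \<and>
     (\<forall>k<m. \<forall>e<2 * n. edge_vec m n k e \<noteq> 0 \<longrightarrow>
        \<epsilon> (k, e) < 2 * n \<and>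
        vertex m n (\<sigma> k) (\<epsilon> (k, e)) = phi n i (vertex m n k (Suc e)) + c k \<and>
        vertex m n (\<sigma> k) (Suc (\<epsilon> (k, e))) = phi n i (vertex m n k e) + c k) \<and>
     (\<forall>k e k' e'. glued m n (k, e) (k', e') \<longrightarrow>
        glued m n (\<sigma> k, \<epsilon> (k, e)) (\<sigma> k', \<epsilon> (k', e')))"

definition reflections_realized :: "nat \<Rightarrow> nat \<Rightarrow> bool" where
  "reflections_realized m n \<longleftrightarrow> (\<forall>i<2 * n. \<exists>\<sigma> c \<epsilon>. reflection_automorphism m n i \<sigma> c \<epsilon>)"

definition induced_permutation :: "nat \<Rightarrow> nat \<Rightarrow> nat \<Rightarrow> (nat \<Rightarrow> nat) \<Rightarrow> bool" where
  "induced_permutation m n i g \<longleftrightarrow>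
     g permutes labels m n \<and>
     (\<exists>\<sigma> c \<epsilon>. reflection_automorphism m n i \<sigma> c \<epsilon> \<and>
        (\<forall>k e l. edge_label m n (k, e) l \<longrightarrow> edge_label m n (\<sigma> k, \<epsilon> (k, e)) (g l)))"

definition sector_perm :: "nat \<Rightarrow> nat \<Rightarrow> nat \<Rightarrow> nat \<Rightarrow> nat" where
  "sector_perm m n i = (SOME g. induced_permutation m n i g)"

text \<open>
  \<open>admissible_sectors m n b0 w a b\<close>: \<open>(a, b)\<close> is a pair of sequences of admissible sectors of \<open>w\<close>
  (values at index 0 are irrelevant). Here \<open>W k\<close> is the \<open>k\<close>-th derived word, and it is normalized
  with the sector in which it is recorded as being admissible.
\<close>

definition admissible_sectors ::
  "nat \<Rightarrow> nat \<Rightarrow> nat \<Rightarrow> (int \<Rightarrow> nat) \<Rightarrow> (nat \<Rightarrow> nat) \<Rightarrow> (nat \<Rightarrow> nat) \<Rightarrow> bool" where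
  "admissible_sectors m n b0 w a b \<longleftrightarrow>
     (\<forall>k\<ge>1. a k \<in> {1..m - 1} \<and> b k \<in> {1..n - 1}) \<and>
     (\<exists>W :: nat \<Rightarrow> int \<Rightarrow> nat.
        is_derivative m n (sector_perm m n b0 \<circ> w) (W 1) \<and>
        (\<forall>k\<ge>1. admissible n m (a k) (W (2 * k - 1)) \<and>
               is_derivative n m (sector_perm n m (a k) \<circ> W (2 * k - 1)) (W (2 * k)) \<and>
               admissible m n (b k) (W (2 * k)) \<and>
               is_derivative m n (sector_perm m n (b k) \<circ> W (2 * k)) (W (2 * k + 1))))"

definition gamma_matrix :: "nat \<Rightarrow> nat \<Rightarrow> real ^ 2 ^ 2" where
  "gamma_matrix m n =
     (let s = sin (pi / real m); t = sin (pi / real n) in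
      vector [vector [- sqrt (t / s), (cos (pi / real m) + cos (pi / real n)) / sqrt (s * t)],
              vector [0, sqrt (s / t)]])"

text \<open>Action of a matrix on directions, represented by angles in \<open>[0, 2 \<pi>)\<close>.\<close>

definition dir_action :: "real ^ 2 ^ 2 \<Rightarrow> real \<Rightarrow> real" where
  "dir_action M \<theta> =
     (let v = M *v vector [cos \<theta>, sin \<theta>] in Arg2pi (Complex (v $ 1) (v $ 2)))"

text \<open>
  Action of \<open>phi n i\<close> on directions, as the lift to angles that maps the interval \<open>sector n i\<close> onto
  \<open>sector n 0\<close>; see the two lemmas. It is an involution.
\<close>

definition phi_dir :: "nat \<Rightarrow> nat \<Rightarrow> real \<Rightarrow> real" where
  "phi_dir n i \<theta> = real (i + 1) * pi / real n - \<theta>"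

lemma phi_cis: "n > 0 \<Longrightarrow> phi n i (cis \<theta>) = cis (phi_dir n i \<theta>)"
  by (simp add: phi_def line_reflection_def phi_dir_def cis_cnj cis_mult)

lemma phi_dir_sector: "n > 0 \<Longrightarrow> phi_dir n i ` sector n i = sector n 0"
  unfolding phi_dir_def [abs_def] sector_def
  by (simp add: image_diff_atLeastAtMost diff_divide_distrib [symmetric] algebra_simps)

definition branch_domain :: "nat \<Rightarrow> nat \<Rightarrow> nat \<Rightarrow> nat \<Rightarrow> real set" where
  "branch_domain m n i j =
     {\<theta> \<in> sector n 0.
        dir_action (gamma_matrix m n) \<theta> \<in> sector m i \<and>
        dir_action (gamma_matrix n m) (phi_dir m i (dir_action (gamma_matrix m n) \<theta>)) \<in> sector n j}"

definition farey_branch :: "nat \<Rightarrow> nat \<Rightarrow> nat \<Rightarrow> nat \<Rightarrow> real \<Rightarrow> real" where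
  "farey_branch m n i j \<theta> =
     phi_dir n j
       (dir_action (gamma_matrix n m) (phi_dir m i (dir_action (gamma_matrix m n) \<theta>)))"

definition branch_preimage :: "nat \<Rightarrow> nat \<Rightarrow> nat \<Rightarrow> nat \<Rightarrow> real set \<Rightarrow> real set" where
  "branch_preimage m n i j A = {\<theta> \<in> branch_domain m n i j. farey_branch m n i j \<theta> \<in> A}"

text \<open>The preimage of \<open>sector n 0\<close> under the first \<open>k\<close> branches, with the first branch outermost.\<close>

definition cf_cylinder ::
  "nat \<Rightarrow> nat \<Rightarrow> (nat \<Rightarrow> nat) \<Rightarrow> (nat \<Rightarrow> nat) \<Rightarrow> nat \<Rightarrow> real set" where
  "cf_cylinder m n a b k =
     foldr (\<lambda>j. branch_preimage m n (a j) (b j)) [1..<k + 1] (sector n 0)"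

definition cf_tail :: "nat \<Rightarrow> nat \<Rightarrow> (nat \<Rightarrow> nat) \<Rightarrow> (nat \<Rightarrow> nat) \<Rightarrow> real" where
  "cf_tail m n a b = the_elem (\<Inter>k\<in>{1..}. cf_cylinder m n a b k)"

definition cf_value :: "nat \<Rightarrow> nat \<Rightarrow> nat \<Rightarrow> (nat \<Rightarrow> nat) \<Rightarrow> (nat \<Rightarrow> nat) \<Rightarrow> real" where
  "cf_value m n b0 a b = inv_into (sector n b0) (phi_dir n b0) (cf_tail m n a b)"

end

theory Submission
  imports Defs "HOL-Number_Theory.Cong"
begin

text \<open>
  Instead of carrying a trajectory from \<open>S\<^sub>m\<^sub>,\<^sub>n\<close> to \<open>S\<^sub>n\<^sub>,\<^sub>m\<close> by an affine map, only its displacements are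
  followed. Join the midpoints of the successively crossed edges and develop this broken line in the
  plane: it stays at bounded distance from a line of direction \<open>\<theta>\<close>, and its steps depend only on the
  labels and on the sides from which the edges are crossed. For a word and its derived word, the
  matrix \<open>\<gamma>\<^sub>m\<^sub>,\<^sub>n\<close> carries one broken line to the other up to a bounded error, so the derived word
  has direction \<open>\<gamma>\<^sub>m\<^sub>,\<^sub>n[\<theta>]\<close>. The steps of a word admissible in \<open>T\<^sub>i\<close> lie in the cone over \<open>\<Sigma>\<^sub>i\<close>, so an
  admissible sector of a derived word contains its direction. Hence the reflected direction of \<open>\<theta>\<close>
  lies in every cylinder of the continued fraction, and these cylinders shrink to a point.
\<close>

section \<open>Trigonometry of the polygons\<close>

text \<open>Displacements up to a bounded error suffice because only an asymptotic question is ever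
  put to a word: if all steps of a broken line lie in a closed half-plane, so does its direction.
  Hence no derived word has to be exhibited as a cutting sequence on the other surface. The error is
  bounded for an exact reason: \<open>scaled_gamma\<close> takes the midpoint of an edge in column
  \<open>d + 1\<close> to the midpoint of a diagonal of the dual polygon \<open>P(d)\<close>, and
  the developed center of that polygon stays put until a labeled arrow is followed. The obstacle is
  that a label names two glued sides and forgets which of them is entered. What excludes the
  reversed reading is that the direction of a derived word lies in [\<pi>/m, \<pi>]. The branches do
  not contract uniformly: for \<open>i = j = 1\<close> the matrix of the inverse branch is unipotent
  and fixes an end of the sector. So the cylinders are estimated through determinant 1 and linearly
  growing column sums, which gives a rate of order 1/k. For m = n = 2 all these matrices would be
  the identity; this is where \<open>m * n \<ge> 6\<close> enters.\<close>

text \<open>Throughout, the Boolean \<open>R\<close> selects the right (\<open>True\<close>) or left edges of \<open>P(k)\<close>.\<close>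

definition side_len :: "nat \<Rightarrow> nat \<Rightarrow> bool \<Rightarrow> real" where
  "side_len m k R = sin (real (if R then k + 1 else k) * pi / real m)"

text \<open>The formula is forced by the requirement that each edge ends where the next one starts,
  see \<open>corner_step\<close>.\<close>

definition apothem :: "nat \<Rightarrow> nat \<Rightarrow> nat \<Rightarrow> bool \<Rightarrow> real" where
  "apothem m n k R =
     (side_len m k R * cos (pi / real n) + side_len m k (\<not> R)) / (2 * sin (pi / real n))"

text \<open>
  The vector from the center of \<open>P(k)\<close> to the midpoint of its edge in column \<open>d + 1\<close> of the grid
  underlying \<open>T\<^sub>0\<close>; that edge has index \<open>d + 1\<close> or \<open>- d\<close>, shifted by \<open>n\<close> if \<open>k\<close> is odd.
\<close>

definition spoke :: "nat \<Rightarrow> nat \<Rightarrow> nat \<Rightarrow> nat \<Rightarrow> bool \<Rightarrow> complex" where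
  "spoke m n k d R =
     (if even k then - \<i> else \<i>) * of_real (apothem m n k R) *
       cis (if R = (even d = even k) then real (d + 1) * pi / real n else - (real d * pi / real n))"

text \<open>
  \<open>sqrt (sin (\<pi>/n) / sin (\<pi>/m)) \<cdot> \<gamma>\<^sub>m\<^sub>,\<^sub>n\<close>: the scaling removes all square roots and matches the side
  lengths of the two surfaces.
\<close>

definition scaled_gamma :: "nat \<Rightarrow> nat \<Rightarrow> complex \<Rightarrow> complex" where
  "scaled_gamma m n z =
     Complex (((cos (pi / real m) + cos (pi / real n)) * Im z - sin (pi / real n) * Re z) / sin (pi / real m))
       (Im z)"

text \<open>
  \<open>\<gamma>\<^sub>m\<^sub>,\<^sub>n\<close> carries the edges in column \<open>d + 1\<close> to diagonals of the polygon \<open>P(d)\<close> of the dual surface;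
  this is the midpoint of the one in row \<open>r\<close>, relative to the center.
\<close>

definition diag_point :: "nat \<Rightarrow> nat \<Rightarrow> nat \<Rightarrow> nat \<Rightarrow> complex" where
  "diag_point m n d r =
     (if even d then - \<i> else \<i>) * of_real (cos (real r * pi / real m) / (2 * sin (pi / real m))) *
       (of_real (side_len n d (even (r + d))) + of_real (side_len n d (odd (r + d))) * cis (pi / real m))"

lemma sin_pi_pos: "m \<ge> 2 \<Longrightarrow> sin (pi / real m) > 0"
  by (rule sin_gt_zero) (auto simp: divide_simps)

lemma sin_nat_nonneg: "j \<le> m \<Longrightarrow> sin (real j * pi / real m) \<ge> 0"
  by (rule sin_ge_zero) (auto simp: divide_simps)

lemma sin_nat_pos: "0 < j \<Longrightarrow> j < m \<Longrightarrow> sin (real j * pi / real m) > 0"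
  by (rule sin_gt_zero) (auto simp: divide_simps)

lemma scaled_gamma_diff: "scaled_gamma m n (z - w) = scaled_gamma m n z - scaled_gamma m n w"
  by (simp add: scaled_gamma_def complex_eq_iff diff_divide_distrib add_divide_distrib algebra_simps)

text \<open>
  The offset between the centers of \<open>P(k)\<close> and of the dual \<open>P(d)\<close>, which cancels in the displacements:
  it can be read off either of the two edges of \<open>P(k)\<close> in column \<open>d + 1\<close>, and off either of the two
  edges of dual polygons in column \<open>k + 1\<close>.
\<close>

definition hub :: "nat \<Rightarrow> nat \<Rightarrow> nat \<Rightarrow> nat \<Rightarrow> complex" where
  "hub m n k d = scaled_gamma m n (spoke m n k d False) - diag_point m n d k"

lemma
  assumes "m \<ge> 2" "n \<ge> 2"
  shows hub_vertical: "scaled_gamma m n (spoke m n k d True) - diag_point m n d (k + 1) = hub m n k d"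
    and hub_horizontal:
      "hub m n k d + spoke n m d k True = hub m n k (d + 1) + spoke n m (d + 1) k False"
proof -
  define s c t u where "s = sin (pi / real m)" "c = cos (pi / real m)"
    "t = sin (pi / real n)" "u = cos (pi / real n)"
  define S C T U where "S = sin (real k * pi / real m)" "C = cos (real k * pi / real m)"
    "T = sin (real d * pi / real n)" "U = cos (real d * pi / real n)"
  note defs = s_c_t_u_def S_C_T_U_def
  have st: "s > 0" "t > 0" using assms sin_pi_pos by (auto simp: defs)
  have eq: "s * s = 1 - c * c" "t * t = 1 - u * u"
    by (simp_all add: defs algebra_simps flip: power2_eq_square)
  \<comment> \<open>\<open>algebra_simps\<close> nests products to the right, so squares of sines
    mostly occur in this form.\<close>
  have eqx: "s * (s * x) = x - c * (c * x)" "t * (t * x) = x - u * (u * x)" for x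
    unfolding mult.assoc [of s s, symmetric] mult.assoc [of t t, symmetric] eq
    by (simp_all add: left_diff_distrib)
  have step: "sin (real (k+1) * pi / real m) = S * c + C * s"
    "cos (real (k+1) * pi / real m) = C * c - S * s"
    "sin (real (d+1) * pi / real n) = T * u + U * t"
    "cos (real (d+1) * pi / real n) = U * u - T * t"
    by (simp_all add: defs add_divide_distrib distrib_right sin_add cos_add)
  have step2: "sin (real (d+1+1) * pi / real n) = (T * u + U * t) * u + (U * u - T * t) * t"
    "cos (real (d+1+1) * pi / real n) = (U * u - T * t) * u - (T * u + U * t) * t"
    using sin_add[of "real (d+1) * pi / real n" "pi / real n"]
      cos_add[of "real (d+1) * pi / real n" "pi / real n"] unfolding step
    by (simp_all add: defs add_divide_distrib distrib_right algebra_simps)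
  note unfold = complex_eq_iff hub_def spoke_def diag_point_def scaled_gamma_def apothem_def side_len_def
  note simps = step[simplified] step2[simplified]
  show "scaled_gamma m n (spoke m n k d True) - diag_point m n d (k + 1) = hub m n k d"
    unfolding unfold
    apply (cases "even k"; cases "even d")
       apply (simp_all add: simps flip: defs)
    using st apply (simp_all add: divide_simps)
       apply (simp_all add: algebra_simps eq eqx)
    done
  show "hub m n k d + spoke n m d k True = hub m n k (d + 1) + spoke n m (d + 1) k False"
    unfolding unfold
    apply (cases "even k"; cases "even d")
       apply (simp_all add: simps flip: defs)
    using st apply (simp_all add: divide_simps)
       apply (simp_all add: algebra_simps eq eqx)
    done
qed

section \<open>Directions, vertices and edge midpoints of \<open>P(k)\<close>\<close>

definition ray :: "nat \<Rightarrow> int \<Rightarrow> complex" where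
  "ray n z = cis (of_int z * pi / real n)"

lemma ray_add: "ray n (x + y) = ray n x * ray n y"
  by (simp add: ray_def cis_mult add_divide_distrib distrib_right)

lemma ray_0 [simp]: "ray n 0 = 1"
  by (simp add: ray_def)

lemma ray_minus: "ray n (- x) = cnj (ray n x)"
  by (simp add: ray_def cis_cnj)

lemma ray_turn: "n > 0 \<Longrightarrow> ray n (x + int n) = - ray n x"
  by (simp add: ray_add) (simp add: ray_def cis_pi)

lemma ray_eq_1_iff:
  assumes "n > 0"
  shows "ray n z = 1 \<longleftrightarrow> 2 * int n dvd z"
proof
  assume "ray n z = 1"
  then have "cos (of_int z * pi / real n) = 1" "sin (of_int z * pi / real n) = 0"
    by (simp_all add: ray_def complex_eq_iff)
  then obtain k :: int where "of_int z * pi / real n = of_int k * 2 * pi"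
    using cos_one_2pi_int by blast
  then have "real_of_int z = of_int (2 * int n * k)"
    using assms by (simp add: field_simps)
  then show "2 * int n dvd z" by (metis of_int_eq_iff dvd_triv_left)
next
  assume "2 * int n dvd z"
  then obtain k where "z = 2 * int n * k" by blast
  then have "of_int z * pi / real n = 2 * pi * of_int k" using assms by simp
  then show "ray n z = 1" by (simp add: ray_def)
qed

text \<open>The passage between edge indices modulo \<open>2 * n\<close>, kept as integers, and
  directions in the plane.\<close>

lemma ray_eq_iff:
  assumes "n > 0"
  shows "ray n x = ray n y \<longleftrightarrow> [x = y] (mod 2 * int n)"
proof -
  have "ray n y \<noteq> 0" by (simp add: ray_def)
  then have "ray n x = ray n y \<longleftrightarrow> ray n (x - y) = 1"
    using ray_add [of n "x - y" y] by auto
  then show ?thesis using ray_eq_1_iff [OF assms] by (simp add: cong_iff_dvd_diff)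
qed

lemma right_edge_iff: "right_edge n k e \<longleftrightarrow> (odd e \<longleftrightarrow> odd n \<or> even k)"
  by (auto simp: right_edge_def)

lemma right_edge_Suc [simp]: "right_edge n k (Suc e) \<longleftrightarrow> \<not> right_edge n k e"
  by (auto simp: right_edge_iff)

lemma even_cong: "[x = y] (mod 2 * n) \<Longrightarrow> even x \<longleftrightarrow> even (y :: int)"
  by (meson cong_dvd_modulus cong_dvd_iff dvd_triv_left cong_dvd_modulus)

lemma right_edge_shift:
  assumes "[int e = int a + z] (mod 2 * int n)"
  shows "right_edge n k e \<longleftrightarrow> (right_edge n k a \<longleftrightarrow> even z)"
  using even_cong [OF assms] by (auto simp: right_edge_iff)

lemma edge_vec_eq:
  "edge_vec m n k e = of_real (side_len m k (right_edge n k e)) * ray n (int e)"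
  by (auto simp: edge_vec_def side_len_def right_edge_def eqpoly_edge_def ray_def Let_def
      scaleR_conv_of_real)

lemma side_len_nonneg: "k < m \<Longrightarrow> side_len m k R \<ge> 0"
  by (auto simp: side_len_def intro!: sin_nat_nonneg simp del: of_nat_Suc)

text \<open>Vertex 0 is the origin and edge 0 points in direction 1, so the center lies above the
  midpoint of edge 0.\<close>

definition polygon_center :: "nat \<Rightarrow> nat \<Rightarrow> nat \<Rightarrow> complex" where
  "polygon_center m n k =
     \<i> * of_real (apothem m n k (right_edge n k 0)) + of_real (side_len m k (right_edge n k 0)) / 2"

text \<open>Relative to the center, an edge turned into direction 1 ends at the left-hand point; the
  next edge makes the angle \<pi>/n with it and starts at the right-hand point. These two real
  equations determine \<open>apothem\<close>.\<close>

lemma corner_step: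
  assumes "n \<ge> 2"
  shows "(- \<i> * of_real (apothem m n k R) + of_real (side_len m k R) / 2) =
    (- \<i> * of_real (apothem m n k (\<not> R)) - of_real (side_len m k (\<not> R)) / 2) * ray n 1"
proof -
  define s c where "s = sin (pi / real n)" "c = cos (pi / real n)"
  have s: "s > 0" using sin_pi_pos [OF assms] by (simp add: s_c_def)
  have eq: "s * s = 1 - c * c"
    by (simp_all add: s_c_def algebra_simps flip: power2_eq_square)
  have eqx: "s * (s * x) = x - c * (c * x)" for x
    unfolding mult.assoc [of s s, symmetric] eq by (simp add: left_diff_distrib)
  show ?thesis
    unfolding complex_eq_iff apothem_def using s
    apply (simp add: ray_def flip: s_c_def)
    apply (simp add: divide_simps)
    apply (simp add: algebra_simps eq eqx)
    done
qed

lemma vertex_Suc: "vertex m n k (Suc e) = vertex m n k e + edge_vec m n k e"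
  by (simp add: vertex_def)

lemma vertex_eq:
  assumes "n \<ge> 2"
  shows "vertex m n k e = polygon_center m n k +
    (- \<i> * of_real (apothem m n k (right_edge n k e)) - of_real (side_len m k (right_edge n k e)) / 2)
      * ray n (int e)"
proof (induction e)
  case 0
  show ?case by (simp add: vertex_def polygon_center_def)
next
  case (Suc e)
  have "vertex m n k (Suc e) = polygon_center m n k +
    (- \<i> * of_real (apothem m n k (right_edge n k e)) + of_real (side_len m k (right_edge n k e)) / 2)
      * ray n (int e)"
    by (simp add: vertex_Suc Suc edge_vec_eq algebra_simps)
  also have "\<dots> = polygon_center m n k +
    (- \<i> * of_real (apothem m n k (right_edge n k (Suc e))) - of_real (side_len m k (right_edge n k (Suc e))) / 2)
      * (ray n 1 * ray n (int e))"
    unfolding corner_step [OF assms] by simp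
  also have "ray n 1 * ray n (int e) = ray n (int (Suc e))"
    by (simp add: ray_add)
  finally show ?case .
qed

lemma vertex_Suc_eq:
  assumes "n \<ge> 2"
  shows "vertex m n k (Suc e) = polygon_center m n k +
    (- \<i> * of_real (apothem m n k (right_edge n k e)) + of_real (side_len m k (right_edge n k e)) / 2)
      * ray n (int e)"
  by (simp add: vertex_Suc vertex_eq [OF assms, of m k e] edge_vec_eq algebra_simps)

definition midpt :: "nat \<Rightarrow> nat \<Rightarrow> nat \<Rightarrow> nat \<Rightarrow> complex" where
  "midpt m n k e = (vertex m n k e + vertex m n k (Suc e)) / 2"

lemma midpt_eq:
  assumes "n \<ge> 2"
  shows "midpt m n k e = polygon_center m n k -
     \<i> * of_real (apothem m n k (right_edge n k e)) * ray n (int e)"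
  unfolding midpt_def vertex_eq [OF assms, of m k e] vertex_Suc_eq [OF assms]
  by (simp add: field_simps)

text \<open>
  Heights are measured orthogonally to an edge direction \<open>a\<close>; the vertices at equal distance on
  both sides of edge \<open>a\<close> have the same height, which increases with that distance.
\<close>

definition corner_height :: "nat \<Rightarrow> nat \<Rightarrow> nat \<Rightarrow> bool \<Rightarrow> nat \<Rightarrow> real" where
  "corner_height m n k R z =
     - apothem m n k (R = even z) * cos (real z * pi / real n)
     - side_len m k (R = even z) / 2 * sin (real z * pi / real n)"

text \<open>The same corner seen as the end of edge \<open>z\<close> instead of the start of the
  next one: the imaginary part of \<open>corner_step\<close>.\<close>

lemma corner_height_Suc:
  assumes "n \<ge> 2"
  shows "corner_height m n k R (Suc z) =
    - apothem m n k (R = even z) * cos (real z * pi / real n)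
    + side_len m k (R = even z) / 2 * sin (real z * pi / real n)"
proof -
  have "ray n (int (Suc z)) = ray n 1 * ray n (int z)" by (simp add: ray_add)
  then have "Im ((- \<i> * of_real (apothem m n k (R = even z)) + of_real (side_len m k (R = even z)) / 2) * ray n (int z))
     = Im ((- \<i> * of_real (apothem m n k (R = even (Suc z))) - of_real (side_len m k (R = even (Suc z))) / 2) * ray n (int (Suc z)))"
    unfolding corner_step [OF assms] by (simp add: mult.assoc)
  then show ?thesis
    by (simp add: corner_height_def ray_def)
qed

lemma corner_height_step:
  assumes "n \<ge> 2"
  shows "corner_height m n k R (Suc z) - corner_height m n k R z =
    side_len m k (R = even z) * sin (real z * pi / real n)"
  unfolding corner_height_Suc [OF assms] by (simp add: corner_height_def)

text \<open>The edge at position \<open>z\<close> makes the angle z \<pi>/n with the reference edge;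
  for \<open>z \<le> n\<close> this is in [0, \<pi>], so the edge does not descend.\<close>

lemma corner_height_mono:
  assumes "n \<ge> 2" "k < m" "x \<le> y" "y \<le> Suc n"
  shows "corner_height m n k R x \<le> corner_height m n k R y"
  using assms(3,4)
proof (induction y rule: dec_induct)
  case (step z)
  then have "0 \<le> side_len m k (R = even z) * sin (real z * pi / real n)"
    using assms by (intro mult_nonneg_nonneg side_len_nonneg sin_nat_nonneg) auto
  with corner_height_step [OF assms(1), of m k R z] step show ?case by simp
qed simp

definition height :: "nat \<Rightarrow> nat \<Rightarrow> nat \<Rightarrow> nat \<Rightarrow> complex \<Rightarrow> real" where
  "height m n a k z = Im ((z - polygon_center m n k) * ray n (- int a))"

text \<open>The polygon is symmetric about the perpendicular bisector of edge \<open>a\<close>,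
  which takes edge \<open>a - x\<close>, reversed, to edge \<open>a + x\<close>.\<close>

lemma height_vertex_in:
  assumes "n \<ge> 2" "[int e = int a - int x] (mod 2 * int n)"
  shows "height m n a k (vertex m n k e) = corner_height m n k (right_edge n k a) (Suc x)"
    "height m n a k (vertex m n k (Suc e)) = corner_height m n k (right_edge n k a) x"
proof -
  have "right_edge n k e = (right_edge n k a = even x)"
    using right_edge_shift [of e a "- int x" n k] assms by simp
  moreover have "ray n (int e) * ray n (- int a) = ray n (- int x)"
  proof -
    have "ray n (int e) = ray n (int a - int x)" using assms by (simp add: ray_eq_iff)
    then show ?thesis by (simp flip: ray_add)
  qed
  ultimately show "height m n a k (vertex m n k e) = corner_height m n k (right_edge n k a) (Suc x)"
    "height m n a k (vertex m n k (Suc e)) = corner_height m n k (right_edge n k a) x"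
    unfolding height_def vertex_Suc_eq [OF assms(1)] vertex_eq [OF assms(1), of m k e]
      corner_height_Suc [OF assms(1)]
    unfolding corner_height_def
    by (simp_all add: mult.assoc) (simp_all add: ray_def)
qed

lemma height_vertex_out:
  assumes "n \<ge> 2" "[int e = int a + int y] (mod 2 * int n)"
  shows "height m n a k (vertex m n k e) = corner_height m n k (right_edge n k a) y"
    "height m n a k (vertex m n k (Suc e)) = corner_height m n k (right_edge n k a) (Suc y)"
proof -
  have "right_edge n k e = (right_edge n k a = even y)"
    using right_edge_shift [of e a "int y" n k] assms by simp
  moreover have "ray n (int e) * ray n (- int a) = ray n (int y)"
  proof -
    have "ray n (int e) = ray n (int a + int y)" using assms by (simp add: ray_eq_iff)
    then show ?thesis by (simp flip: ray_add)
  qed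
  ultimately show "height m n a k (vertex m n k e) = corner_height m n k (right_edge n k a) y"
    "height m n a k (vertex m n k (Suc e)) = corner_height m n k (right_edge n k a) (Suc y)"
    unfolding height_def vertex_Suc_eq [OF assms(1)] vertex_eq [OF assms(1), of m k e]
      corner_height_Suc [OF assms(1)]
    unfolding corner_height_def
    by (simp_all add: mult.assoc) (simp_all add: ray_def)
qed

lemma height_move:
  "height m n a k (p + t *\<^sub>R cis \<theta>) = height m n a k p + t * sin (\<theta> - real a * pi / real n)"
  by (simp add: height_def algebra_simps ray_def cis_cnj sin_diff)

lemma height_edge_interior:
  assumes "p \<in> edge_interior m n k e"
  obtains u where "0 < u" "u < 1"
    "height m n a k p = height m n a k (vertex m n k e) +
      u * (height m n a k (vertex m n k (Suc e)) - height m n a k (vertex m n k e))"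
proof -
  from assms obtain u where u: "0 < u" "u < 1"
    "p = (1 - u) *\<^sub>R vertex m n k e + u *\<^sub>R vertex m n k (Suc e)"
    unfolding edge_interior_def in_segment by blast
  have "height m n a k p = height m n a k (vertex m n k e) +
      u * (height m n a k (vertex m n k (Suc e)) - height m n a k (vertex m n k e))"
    unfolding u(3) height_def by (simp add: algebra_simps)
  with u that show thesis by blast
qed

section \<open>Crossings of a polygon\<close>

text \<open>
  The ways to cross a polygon in a direction of \<open>\<Sigma>\<^sub>a\<close>: edge \<open>a - x\<close> faces edge \<open>a + x\<close> in the initial
  direction of the sector and edge \<open>a + x + 2\<close> in the final one.
\<close>

definition crossing :: "nat \<Rightarrow> nat \<Rightarrow> nat \<Rightarrow> nat \<Rightarrow> bool" where
  "crossing n a e f \<longleftrightarrow>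
     (\<exists>x y. x < n \<and> 0 < y \<and> y \<le> n \<and> x \<le> y \<and> y \<le> x + 2 \<and>
        [int e = int a - int x] (mod 2 * int n) \<and> [int f = int a + int y] (mod 2 * int n))"

lemma sin_nonneg_turn: "\<lbrakk>- (2 * pi) \<le> z; z \<le> - pi\<rbrakk> \<Longrightarrow> sin z \<ge> 0"
  using sin_ge_zero [of "z + 2 * pi"] by simp

lemma sin_nonpos_turn: "\<lbrakk>pi \<le> z; z \<le> 2 * pi\<rbrakk> \<Longrightarrow> sin z \<le> 0"
  using sin_ge_zero [of "z - pi"] by (simp add: sin_diff)

lemma edge_vec_cross:
  "Im (cnj (edge_vec m n k e) * cis \<theta>) =
     side_len m k (right_edge n k e) * Im (ray n (- int e) * cis \<theta>)"
  by (simp add: edge_vec_eq ray_minus algebra_simps)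

lemma Im_ray_cis: "Im (ray n z * cis \<theta>) = sin (\<theta> + of_int z * pi / real n)"
  by (simp add: ray_def cis_mult add.commute)

text \<open>If the residue of \<open>a - e\<close> were at least \<open>n\<close>, the angle from
  edge \<open>e\<close> to the direction would lie in [\<pi>, 2 \<pi>] modulo full turns, and the
  edge would not be crossed inwards.\<close>

lemma entering_index:
  assumes "n > 0" "\<theta> \<in> sector n a" "Im (ray n (- int e) * cis \<theta>) > 0"
  obtains x where "x < n" "[int e = int a - int x] (mod 2 * int n)"
proof -
  define x where "x = nat ((int a - int e) mod (2 * int n))"
  have x: "int x = (int a - int e) mod (2 * int n)" "x < 2 * n"
    using assms(1) by (simp_all add: x_def nat_less_iff)
  have cong: "[int e = int a - int x] (mod 2 * int n)"
    unfolding x(1) by (simp add: cong_def mod_diff_right_eq)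
  then have "[- int e = int x - int a] (mod 2 * int n)"
    using cong_minus_minus_iff [of "int e" "int a - int x"] by simp
  then have ray: "ray n (- int e) = ray n (int x - int a)"
    using assms(1) by (simp add: ray_eq_iff)
  have pos: "sin (\<theta> + (real x - real a) * pi / real n) > 0"
    using assms(3) unfolding ray Im_ray_cis by simp
  have "x < n"
  proof (rule ccontr)
    assume "\<not> x < n"
    then have x': "n \<le> x" "x + 1 \<le> 2 * n" using x(2) by auto
    have "pi \<le> real x * pi / real n" "real (x + 1) * pi / real n \<le> 2 * pi"
      using x' assms(1) of_nat_mono [OF x'(2), where 'a = real]
      by (simp_all add: divide_simps mult.commute del: of_nat_add)
    moreover have "\<theta> \<ge> real a * pi / real n" "\<theta> \<le> real (a + 1) * pi / real n"
      using assms(2) by (auto simp: sector_def)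
    ultimately have "sin (\<theta> + (real x - real a) * pi / real n) \<le> 0"
      by (intro sin_nonpos_turn) (simp_all add: algebra_simps add_divide_distrib diff_divide_distrib)
    with pos show False by simp
  qed
  with cong that show thesis by blast
qed

lemma exiting_index:
  assumes "n > 0" "\<theta> \<in> sector n a" "Im (ray n (- int f) * cis \<theta>) < 0"
  obtains y where "0 < y" "y \<le> n" "[int f = int a + int y] (mod 2 * int n)"
proof -
  \<comment> \<open>The residue \<open>y = z + 1\<close> is taken in \<open>1..2 * n\<close>: edge
    \<open>a\<close> itself then appears as \<open>y = 2 * n\<close> and is excluded together with
    all other \<open>y > n\<close>.\<close>
  define z where "z = nat ((int f - int a - 1) mod (2 * int n))"
  have z: "int z = (int f - int a - 1) mod (2 * int n)" "z < 2 * n"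
    using assms(1) by (simp_all add: z_def nat_less_iff)
  define y where "y = Suc z"
  have "[int a + 1 + int z = int a + 1 + (int f - int a - 1)] (mod 2 * int n)"
    unfolding z(1) by (intro cong_add cong_refl) simp
  then have cong: "[int f = int a + int y] (mod 2 * int n)"
    by (simp add: y_def cong_sym algebra_simps)
  then have "[- int f = - (int a + int y)] (mod 2 * int n)"
    by (simp only: cong_minus_minus_iff)
  then have ray: "ray n (- int f) = ray n (- (int a + int y))"
    using assms(1) by (simp add: ray_eq_iff)
  have "real_of_int (- (int a + int y)) = - (real a + real y)" by simp
  then have neg: "sin (\<theta> - (real a + real y) * pi / real n) < 0"
    using assms(3) unfolding ray Im_ray_cis by (simp only: mult_minus_left minus_divide_left) simp
  have "y \<le> n"
  proof (rule ccontr)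
    assume "\<not> y \<le> n"
    then have y': "n + 1 \<le> y" "y \<le> 2 * n" using z(2) by (auto simp: y_def)
    have "real (n + 1) * pi / real n \<le> real y * pi / real n"
      using y'(1) by (intro divide_right_mono mult_right_mono of_nat_mono) auto
    moreover have "real (n + 1) * pi / real n = pi + pi / real n" "real y * pi / real n \<le> 2 * pi"
      using y' assms(1) of_nat_mono [OF y'(2), where 'a = real] by (simp_all add: field_simps)
    moreover have "\<theta> \<ge> real a * pi / real n" "\<theta> \<le> real (a + 1) * pi / real n"
      using assms(2) by (auto simp: sector_def)
    ultimately have "sin (\<theta> - (real a + real y) * pi / real n) \<ge> 0"
      by (intro sin_nonneg_turn) (simp_all add: algebra_simps add_divide_distrib diff_divide_distrib)
    with neg show False by simp
  qed
  then show thesis using that [OF _ _ cong] by (simp add: y_def)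
qed

text \<open>Measured orthogonally to the initial direction of the sector, the trajectory never
  descends; if \<open>y < x\<close>, it would start strictly above corner \<open>x\<close> and end
  no higher than corner \<open>y + 1\<close>. Orthogonally to the final direction it never ascends,
  which gives \<open>y - 1 \<le> x + 1\<close> in the same way.\<close>

lemma crossing_if_crossed:
  assumes n: "n \<ge> 2" and k: "k < m" and \<theta>: "\<theta> \<in> sector n a" and t: "t \<ge> 0"
    and p: "p \<in> edge_interior m n k e" and q: "p + t *\<^sub>R cis \<theta> \<in> edge_interior m n k f"
    and e: "Im (cnj (edge_vec m n k e) * cis \<theta>) > 0"
    and f: "Im (cnj (edge_vec m n k f) * cis \<theta>) < 0"
  shows "crossing n a e f"
proof -
  have e': "side_len m k (right_edge n k e) > 0" "Im (ray n (- int e) * cis \<theta>) > 0"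
    using e side_len_nonneg [OF k, of "right_edge n k e"] unfolding edge_vec_cross
    by (auto simp only: zero_less_mult_iff)
  have f': "side_len m k (right_edge n k f) > 0" "Im (ray n (- int f) * cis \<theta>) < 0"
    using f side_len_nonneg [OF k, of "right_edge n k f"] unfolding edge_vec_cross
    by (auto simp only: mult_less_0_iff)
  obtain x where x: "x < n" "[int e = int a - int x] (mod 2 * int n)"
    using entering_index [OF _ \<theta> e'(2)] n by auto
  obtain y where y: "0 < y" "y \<le> n" "[int f = int a + int y] (mod 2 * int n)"
    using exiting_index [OF _ \<theta> f'(2)] n by auto
  \<comment> \<open>The same two edges counted from edge \<open>a + 1\<close>, for the heights
    orthogonal to the final direction.\<close>
  have x1: "[int e = int (a + 1) - int (x + 1)] (mod 2 * int n)" using x(2) by simp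
  have y1: "[int f = int (a + 1) + int (y - 1)] (mod 2 * int n)"
    using y by (simp add: of_nat_diff)
  have th: "\<theta> \<ge> real a * pi / real n" "\<theta> \<le> real (a + 1) * pi / real n"
    using \<theta> by (auto simp: sector_def)
  have "real (a + 1) * pi / real n \<le> real a * pi / real n + pi"
    using n by (simp add: field_simps)
  then have up: "sin (\<theta> - real a * pi / real n) \<ge> 0" "sin (\<theta> - real (a + 1) * pi / real n) \<le> 0"
    using th sin_ge_zero [of "\<theta> - real a * pi / real n"]
      sin_ge_zero [of "real (a + 1) * pi / real n - \<theta>"]
    by (simp_all add: sin_diff algebra_simps)
  have "x \<le> y"
  proof (rule ccontr)
    assume "\<not> x \<le> y"
    then have xy: "Suc y \<le> x" by simp
    let ?H = "corner_height m n k (right_edge n k a)"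
    obtain u where u: "0 < u" "u < 1" "height m n a k p = ?H (Suc x) + u * (?H x - ?H (Suc x))"
      using height_edge_interior [OF p, of a] by (metis height_vertex_in [OF n x(2)])
    obtain v where v: "0 < v" "v < 1"
      "height m n a k (p + t *\<^sub>R cis \<theta>) = ?H y + v * (?H (Suc y) - ?H y)"
      using height_edge_interior [OF q, of a] by (metis height_vertex_out [OF n y(3)])
    have R: "right_edge n k e = (right_edge n k a = even x)"
      using right_edge_shift [of e a "- int x" n k] x by simp
    have "?H (Suc x) - ?H x > 0"
      unfolding corner_height_step [OF n] using e' x(1) xy
      by (intro mult_pos_pos) (auto simp flip: R intro!: sin_nat_pos)
    then have "0 < (1 - u) * (?H (Suc x) - ?H x)" using u by simp
    then have "height m n a k p > ?H x" using u(3) by (simp add: algebra_simps)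
    moreover have "0 \<le> (1 - v) * (?H (Suc y) - ?H y)"
      using corner_height_mono [OF n k, of y "Suc y" "right_edge n k a"] v y by simp
    then have "height m n a k (p + t *\<^sub>R cis \<theta>) \<le> ?H (Suc y)"
      unfolding v(3) by (simp add: algebra_simps)
    moreover have "?H (Suc y) \<le> ?H x" using corner_height_mono [OF n k xy] x by simp
    moreover have "height m n a k (p + t *\<^sub>R cis \<theta>) \<ge> height m n a k p"
      unfolding height_move using up t by simp
    ultimately show False by simp
  qed
  moreover have "y \<le> x + 2"
  proof (rule ccontr)
    assume "\<not> y \<le> x + 2"
    then have xy: "Suc (x + 1) \<le> y - 1" by simp
    let ?H = "corner_height m n k (right_edge n k (a + 1))"
    obtain u where u: "0 < u" "u < 1"
      "height m n (a + 1) k p = ?H (Suc (x + 1)) + u * (?H (x + 1) - ?H (Suc (x + 1)))"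
      using height_edge_interior [OF p, of "a + 1"] by (metis height_vertex_in [OF n x1])
    obtain v where v: "0 < v" "v < 1"
      "height m n (a + 1) k (p + t *\<^sub>R cis \<theta>) = ?H (y - 1) + v * (?H (Suc (y - 1)) - ?H (y - 1))"
      using height_edge_interior [OF q, of "a + 1"] by (metis height_vertex_out [OF n y1])
    have R: "right_edge n k f = (right_edge n k (a + 1) = even (y - 1))"
      using right_edge_shift [OF y1, of k] by simp
    have "?H (Suc (y - 1)) - ?H (y - 1) > 0"
      unfolding corner_height_step [OF n] R [symmetric] using f'(1) y xy
      by (intro mult_pos_pos sin_nat_pos) auto
    then have "0 < v * (?H (Suc (y - 1)) - ?H (y - 1))" using v by simp
    then have "height m n (a + 1) k (p + t *\<^sub>R cis \<theta>) > ?H (y - 1)" using v(3) by simp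
    moreover have "0 \<le> u * (?H (Suc (x + 1)) - ?H (x + 1))"
      using corner_height_mono [OF n k, of "x + 1" "Suc (x + 1)" "right_edge n k (a + 1)"] u x by simp
    then have "height m n (a + 1) k p \<le> ?H (Suc (x + 1))"
      unfolding u(3) by (simp add: algebra_simps)
    moreover have "?H (Suc (x + 1)) \<le> ?H (y - 1)" using corner_height_mono [OF n k xy] y by simp
    moreover have "height m n (a + 1) k (p + t *\<^sub>R cis \<theta>) \<le> height m n (a + 1) k p"
      unfolding height_move using up t by (simp add: mult_nonneg_nonpos)
    ultimately show False by simp
  qed
  ultimately show ?thesis unfolding crossing_def using x y by blast
qed

lemma height_midpt: "height m n a k (midpt m n k e) =
    (height m n a k (vertex m n k e) + height m n a k (vertex m n k (Suc e))) / 2"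
  by (simp add: height_def midpt_def field_simps)

lemma corner_height_pair_mono:
  assumes "n \<ge> 2" "k < m" "x \<le> y" "y \<le> n"
  shows "corner_height m n k R x + corner_height m n k R (Suc x) \<le>
    corner_height m n k R y + corner_height m n k R (Suc y)"
  using assms by (intro add_mono corner_height_mono) auto

lemma height_diff: "Im ((z - w) * ray n (- int a)) = height m n a k z - height m n a k w"
  by (simp add: height_def algebra_simps)

text \<open>The closed cone over the sector, including 0: the chord between the two sides of a
  two-sided segment is 0.\<close>

definition in_cone :: "nat \<Rightarrow> nat \<Rightarrow> complex \<Rightarrow> bool" where
  "in_cone n a z \<longleftrightarrow> Im (z * ray n (- int a)) \<ge> 0 \<and> Im (z * ray n (- int (a + 1))) \<le> 0"

text \<open>Heights of midpoints are averages of corner heights, so \<open>x \<le> y\<close> and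
  \<open>y - 1 \<le> x + 1\<close> give the two half-planes. Since \<open>crossing\<close> speaks of
  indices only, the polygon is arbitrary.\<close>

lemma chord_in_cone:
  assumes n: "n \<ge> 2" and k: "k < m" and c: "crossing n a e f"
  shows "in_cone n a (midpt m n k f - midpt m n k e)"
proof -
  from c obtain x y where xy: "x < n" "0 < y" "y \<le> n" "x \<le> y" "y \<le> x + 2"
    "[int e = int a - int x] (mod 2 * int n)" "[int f = int a + int y] (mod 2 * int n)"
    unfolding crossing_def by blast
  have x1: "[int e = int (a + 1) - int (x + 1)] (mod 2 * int n)" using xy by simp
  have y1: "[int f = int (a + 1) + int (y - 1)] (mod 2 * int n)"
    using xy by (simp add: of_nat_diff)
  have y1x1: "y - 1 \<le> x + 1" "x + 1 \<le> n" using xy by auto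
  note mono = corner_height_pair_mono [OF n k]
  show ?thesis
    unfolding in_cone_def height_diff [of _ _ _ _ m k] height_midpt
      height_vertex_in [OF n xy(6)] height_vertex_out [OF n xy(7)]
      height_vertex_in [OF n x1] height_vertex_out [OF n y1]
  proof
    show "0 \<le> (corner_height m n k (right_edge n k a) y + corner_height m n k (right_edge n k a) (Suc y)) / 2 -
      (corner_height m n k (right_edge n k a) (Suc x) + corner_height m n k (right_edge n k a) x) / 2"
      using mono [of x y "right_edge n k a"] xy by simp
    show "(corner_height m n k (right_edge n k (a + 1)) (y - 1) +
       corner_height m n k (right_edge n k (a + 1)) (Suc (y - 1))) / 2 -
      (corner_height m n k (right_edge n k (a + 1)) (Suc (x + 1)) +
       corner_height m n k (right_edge n k (a + 1)) (x + 1)) / 2 \<le> 0"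
      using mono [OF y1x1, of "right_edge n k (a + 1)"] by (simp del: right_edge_Suc add_Suc_right)
  qed
qed

text \<open>Turning both indices by \<open>n\<close> puts \<open>e'\<close> at position
  \<open>n - x\<close> after edge \<open>a\<close> and \<open>f'\<close> at position
  \<open>n - y\<close> before it, so the chord is now directed from \<open>f'\<close> to
  \<open>e'\<close>. This serves a trajectory that crosses the same labeled edges from the other
  side.\<close>

lemma flipped_chord_in_cone:
  assumes n: "n \<ge> 2" and k: "k < m" and c: "crossing n a e f"
    and e': "[int e' = int e + int n] (mod 2 * int n)"
    and f': "[int f' = int f + int n] (mod 2 * int n)"
  shows "in_cone n a (midpt m n k e' - midpt m n k f')"
proof -
  from c obtain x y where xy: "x < n" "0 < y" "y \<le> n" "x \<le> y" "y \<le> x + 2"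
    "[int e = int a - int x] (mod 2 * int n)" "[int f = int a + int y] (mod 2 * int n)"
    unfolding crossing_def by blast
  have x0: "[int e' = int a + int (n - x)] (mod 2 * int n)"
    using cong_trans [OF e' cong_add [OF xy(6) cong_refl, of "int n"]] xy
    by (simp add: of_nat_diff algebra_simps)
  have y0: "[int f' = int a - int (n - y)] (mod 2 * int n)"
  proof -
    have "[int f' = int a + int y + int n] (mod 2 * int n)"
      using cong_trans [OF f' cong_add [OF xy(7) cong_refl, of "int n"]] .
    also have "[int a + int y + int n = int a - int (n - y)] (mod 2 * int n)"
      using xy by (simp add: cong_iff_dvd_diff of_nat_diff)
    finally show ?thesis .
  qed
  have x1: "[int e' = int (a + 1) + int (n - x - 1)] (mod 2 * int n)"
    using x0 xy by (simp add: of_nat_diff)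
  have y1: "[int f' = int (a + 1) - int (n - y + 1)] (mod 2 * int n)"
    using y0 xy by (simp add: of_nat_diff)
  have nyx: "n - y \<le> n - x" "n - x \<le> n" using xy by auto
  have nxy: "n - x - 1 \<le> n - y + 1" "n - y + 1 \<le> n" using xy by auto
  note mono = corner_height_pair_mono [OF n k]
  show ?thesis
    unfolding in_cone_def height_diff [of _ _ _ _ m k] height_midpt
      height_vertex_in [OF n y0] height_vertex_out [OF n x0]
      height_vertex_in [OF n y1] height_vertex_out [OF n x1]
  proof
    show "0 \<le> (corner_height m n k (right_edge n k a) (n - x) + corner_height m n k (right_edge n k a) (Suc (n - x))) / 2 -
      (corner_height m n k (right_edge n k a) (Suc (n - y)) + corner_height m n k (right_edge n k a) (n - y)) / 2"
      using mono [OF nyx, of "right_edge n k a"] by simp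
    show "(corner_height m n k (right_edge n k (a + 1)) (n - x - 1) +
       corner_height m n k (right_edge n k (a + 1)) (Suc (n - x - 1))) / 2 -
      (corner_height m n k (right_edge n k (a + 1)) (Suc (n - y + 1)) +
       corner_height m n k (right_edge n k (a + 1)) (n - y + 1)) / 2 \<le> 0"
      using mono [OF nxy, of "right_edge n k (a + 1)"] by simp
  qed
qed

section \<open>Labels and the grid\<close>

definition opposite :: "nat \<Rightarrow> nat \<Rightarrow> nat" where
  "opposite n e = (e + n) mod (2 * n)"

lemma opposite_less: "n > 0 \<Longrightarrow> opposite n e < 2 * n"
  by (simp add: opposite_def)

lemma opposite_opposite: "e < 2 * n \<Longrightarrow> opposite n (opposite n e) = e"
  by (simp add: opposite_def mod_simps add.assoc mod_add_self2 flip: mult_2)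

lemma opposite_cong: "[int (opposite n e) = int e + int n] (mod 2 * int n)"
  by (simp add: opposite_def cong_def zmod_int)

lemma even_opposite: "even (opposite n e) \<longleftrightarrow> even (e + n)"
  by (simp add: opposite_def even_mod_2_iff dvd_mod_iff)

lemma right_edge_opposite:
  "right_edge n (Suc k) (opposite n e) \<longleftrightarrow> \<not> right_edge n k e"
  by (auto simp: right_edge_iff even_opposite)

lemma glued_iff:
  assumes "n > 0"
  shows "glued m n (k, e) (k', e') \<longleftrightarrow> e < 2 * n \<and> e' = opposite n e \<and>
    (if right_edge n k e then k' = k + 1 \<and> k + 1 < m else k = k' + 1 \<and> k < m)"
proof
  assume "glued m n (k, e) (k', e')"
  then show "e < 2 * n \<and> e' = opposite n e \<and>
    (if right_edge n k e then k' = k + 1 \<and> k + 1 < m else k = k' + 1 \<and> k < m)"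
    by cases (use assms in \<open>auto simp: right_edge_opposite opposite_opposite opposite_less
        simp flip: opposite_def\<close>)
next
  assume *: "e < 2 * n \<and> e' = opposite n e \<and>
    (if right_edge n k e then k' = k + 1 \<and> k + 1 < m else k = k' + 1 \<and> k < m)"
  show "glued m n (k, e) (k', e')"
  proof (cases "right_edge n k e")
    case True
    with * show ?thesis using glued.forward [of k m e n] by (simp add: opposite_def)
  next
    case False
    with * have k: "k = Suc k'" "k < m" by auto
    have e: "opposite n e' = e" using * by (auto simp: opposite_opposite)
    have "right_edge n k' e'" "e' < 2 * n"
      using False * right_edge_opposite [of n k' e'] k(1) e opposite_less [OF assms, of e] by auto
    then have "glued m n (Suc k', opposite n e') (k', e')"
      using glued.backward [of k' m e' n] k by (simp add: opposite_def)
    then show ?thesis using k(1) e by simp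
  qed
qed

lemma glued_sym: "glued m n x y \<Longrightarrow> glued m n y x"
  by (induction rule: glued.induct) (simp_all only: glued.intros)

lemma glued_unique: "n > 0 \<Longrightarrow> glued m n x y \<Longrightarrow> glued m n x z \<Longrightarrow> y = z"
  by (cases x; cases y; cases z) (auto simp: glued_iff split: if_splits)

lemma glued_bounds: "n > 0 \<Longrightarrow> glued m n (k, e) y \<Longrightarrow> k < m \<and> e < 2 * n"
  by (cases y) (auto simp: glued_iff split: if_splits)

section \<open>Labels as pairs of glued edges\<close>

definition base_edge :: "nat \<Rightarrow> nat \<Rightarrow> nat \<Rightarrow> nat \<times> nat" where
  "base_edge n r s = (r - 1, label_index n r s)"

lemma label_index_less: "s \<ge> 1 \<Longrightarrow> s \<le> n \<Longrightarrow> label_index n r s < 2 * n"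
  by (auto simp: label_index_def)

lemma right_edge_label_index:
  assumes "s \<ge> 1" "s \<le> n"
  shows "right_edge n (r - 1) (label_index n r s)"
proof (cases "right_edge n (r - 1) s")
  case False
  have "even ((2 * n + 1 - s) mod (2 * n)) \<longleftrightarrow> odd s"
    using assms by (simp add: dvd_mod_iff)
  with False show ?thesis by (auto simp: label_index_def right_edge_iff)
qed (simp add: label_index_def)

lemma glued_base_edge:
  assumes "1 \<le> r" "r \<le> m - 1" "1 \<le> s" "s \<le> n"
  shows "glued m n (base_edge n r s) (r, opposite n (label_index n r s))"
  using assms right_edge_label_index [OF assms(3,4), of r] label_index_less [OF assms(3,4), of r]
  by (simp add: base_edge_def glued_iff)

lemma edge_label_base:
  assumes "n > 0" "edge_label m n x l"
  shows "\<exists>r s. 1 \<le> r \<and> r \<le> m - 1 \<and> 1 \<le> s \<and> s \<le> n \<and> l = (r - 1) * n + s \<and>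
    (x = base_edge n r s \<or> glued m n x (base_edge n r s))"
  using assms(2)
proof induction
  case (right r s)
  then show ?case by (auto simp: base_edge_def)
next
  case (across x l y)
  then obtain r s where rs: "1 \<le> r" "r \<le> m - 1" "1 \<le> s" "s \<le> n" "l = (r - 1) * n + s"
    "x = base_edge n r s \<or> glued m n x (base_edge n r s)" by blast
  have "y = base_edge n r s \<or> glued m n y (base_edge n r s)"
    using rs(6) glued_sym [OF across.hyps(2)] glued_unique [OF assms(1) across.hyps(2)] by blast
  with rs show ?case by blast
qed

lemma label_split_unique:
  assumes "1 \<le> r" "1 \<le> r'" "1 \<le> s" "s \<le> n" "1 \<le> s'" "s' \<le> n"
    and "(r - 1) * n + s = (r' - 1) * n + (s' :: nat)"
  shows "r = r'" "s = s'"
proof -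
  have "(r - 1) * n + (s - 1) = (r' - 1) * n + (s' - 1)" using assms by simp
  moreover have "s - 1 < n" "s' - 1 < n" using assms by auto
  moreover have "(q * n + t) div n = q" if "t < n" for q t :: nat using that by simp
  ultimately have "r - 1 = r' - 1" by metis
  then show "r = r'" "s = s'" using assms by auto
qed

lemma label_index_inj:
  assumes "1 \<le> s" "s \<le> n" "1 \<le> s'" "s' \<le> n" "label_index n r s = label_index n r s'"
  shows "s = s'"
proof -
  have "label_index n r s = (if right_edge n (r - 1) s then s else if s = 1 then 0 else 2 * n + 1 - s)"
    if "1 \<le> s" "s \<le> n" for s using that by (auto simp: label_index_def)
  with assms show ?thesis by (auto split: if_splits)
qed

lemma base_edge_inj:
  assumes "1 \<le> r" "1 \<le> r'" "1 \<le> s" "s \<le> n" "1 \<le> s'" "s' \<le> n"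
    and "base_edge n r s = base_edge n r' s'"
  shows "r = r'" "s = s'"
proof -
  show "r = r'" using assms by (auto simp: base_edge_def)
  with assms show "s = s'" by (auto simp: base_edge_def intro: label_index_inj)
qed

text \<open>Gluing pairs a right edge with a left one, and base edges are right edges.\<close>

lemma not_glued_base:
  assumes "n > 0" "1 \<le> r" "1 \<le> r'" "1 \<le> s" "s \<le> n" "1 \<le> s'" "s' \<le> n"
  shows "\<not> glued m n (base_edge n r s) (base_edge n r' s')"
proof -
  obtain q where "r = Suc q" using assms(2) by (cases r) auto
  then show ?thesis
    using assms right_edge_label_index [of s n r] right_edge_label_index [of s' n r']
    by (auto simp: base_edge_def glued_iff right_edge_opposite)
qed

lemma edge_label_unique:
  assumes n: "n > 0" and "edge_label m n x l" "edge_label m n x l'"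
  shows "l = l'"
proof -
  obtain r s where rs: "1 \<le> r" "r \<le> m - 1" "1 \<le> s" "s \<le> n" "l = (r - 1) * n + s"
    "x = base_edge n r s \<or> glued m n x (base_edge n r s)"
    using edge_label_base [OF n assms(2)] by blast
  obtain r' s' where rs': "1 \<le> r'" "r' \<le> m - 1" "1 \<le> s'" "s' \<le> n" "l' = (r' - 1) * n + s'"
    "x = base_edge n r' s' \<or> glued m n x (base_edge n r' s')"
    using edge_label_base [OF n assms(3)] by blast
  have "\<not> glued m n (base_edge n r s) (base_edge n r' s')" "\<not> glued m n (base_edge n r' s') (base_edge n r s)"
    using not_glued_base n rs rs' by simp_all
  then have "base_edge n r s = base_edge n r' s'"
    using rs(6) rs'(6) glued_unique [OF n, of m x "base_edge n r s" "base_edge n r' s'"] by auto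
  then show ?thesis using base_edge_inj [of r r' s n s'] rs rs' by simp
qed

text \<open>A label determines its base edge, and gluing is a partial involution, so only two
  polygon edges carry it. This is the whole ambiguity in recovering a path from its word.\<close>

lemma edge_label_same:
  assumes n: "n > 0" and "edge_label m n x l" "edge_label m n y l"
  shows "x = y \<or> glued m n x y"
proof -
  obtain r s where rs: "1 \<le> r" "r \<le> m - 1" "1 \<le> s" "s \<le> n" "l = (r - 1) * n + s"
    "x = base_edge n r s \<or> glued m n x (base_edge n r s)"
    using edge_label_base [OF n assms(2)] by blast
  obtain r' s' where rs': "1 \<le> r'" "r' \<le> m - 1" "1 \<le> s'" "s' \<le> n" "l = (r' - 1) * n + s'"
    "y = base_edge n r' s' \<or> glued m n y (base_edge n r' s')"
    using edge_label_base [OF n assms(3)] by blast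
  have "r = r'" "s = s'" using label_split_unique [of r r' s n s'] rs rs' by auto
  then show ?thesis
    using rs(6) rs'(6) glued_sym [of m n y] glued_sym [of m n x] glued_unique [OF n] by blast
qed

lemma edge_label_glued: "n > 0 \<Longrightarrow> edge_label m n x l \<Longrightarrow> \<exists>y. glued m n x y"
  by (drule (1) edge_label_base) (blast intro: glued_base_edge)

text \<open>Glued edges lie in consecutive polygons, never in the same one.\<close>

lemma edge_label_inj:
  assumes "n > 0" "edge_label m n (k, e) l" "edge_label m n (k, e') l"
  shows "e = e'"
  using edge_label_same [OF assms] assms(1) by (auto simp: glued_iff split: if_splits)

lemma edge_label_in_labels:
  assumes "n > 0" "edge_label m n x l"
  shows "l \<in> labels m n"
proof -
  obtain r s where rs: "1 \<le> r" "r \<le> m - 1" "1 \<le> s" "s \<le> n" "l = (r - 1) * n + s"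
    using edge_label_base [OF assms] by blast
  have "(r - 1) * n + s \<le> (r - 1) * n + n" using rs by simp
  also have "\<dots> = r * n" using rs(1) by (cases r) auto
  also have "\<dots> \<le> (m - 1) * n" using rs(2) by simp
  finally show ?thesis using rs by (simp add: labels_def mult.commute)
qed

lemma labelE:
  assumes "l \<in> labels m n"
  obtains r s where "1 \<le> r" "r \<le> m - 1" "1 \<le> s" "s \<le> n" "l = (r - 1) * n + s"
proof -
  have n: "n > 0" and l: "1 \<le> l" "l \<le> n * (m - 1)"
    using assms by (auto simp: labels_def intro: gr0I)
  then have "l - 1 < (m - 1) * n" by (simp add: mult.commute)
  then have "Suc ((l - 1) div n) \<le> m - 1"
    using n by (simp add: less_mult_imp_div_less Suc_leI)
  moreover have "Suc ((l - 1) mod n) \<le> n" using n by (simp add: Suc_leI)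
  moreover have "l = (Suc ((l - 1) div n) - 1) * n + Suc ((l - 1) mod n)"
    using l by simp
  ultimately show thesis using that [of "Suc ((l - 1) div n)" "Suc ((l - 1) mod n)"] by simp
qed

lemma label_has_edge:
  assumes "l \<in> labels m n"
  obtains x where "edge_label m n x l"
  using assms by (metis labelE edge_label.right)

lemma glued_edge_label:
  assumes n: "n > 0" and g: "glued m n x y"
  obtains l where "edge_label m n x l"
proof -
  have right: "\<exists>l. edge_label m n (k, e) l" if "right_edge n k e" "k + 1 < m" "e < 2 * n" for k e
  proof (cases "1 \<le> e \<and> e \<le> n")
    case True
    with that edge_label.right [of "k + 1" m e n] have "edge_label m n (k, e) (k * n + e)"
      by (simp add: label_index_def)
    then show ?thesis by blast
  next
    case False
    \<comment> \<open>The inverse of \<open>s \<mapsto> 1 - s\<close> modulo \<open>2 * n\<close>;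
      index 0 comes from \<open>s = 1\<close>.\<close>
    define s where "s = (if e = 0 then 1 else 2 * n + 1 - e)"
    have s: "1 \<le> s" "s \<le> n" "even s \<longleftrightarrow> odd e"
      using False that n by (auto simp: s_def)
    then have "label_index n (k + 1) s = e"
      using that False by (auto simp: label_index_def right_edge_iff s_def)
    with that s edge_label.right [of "k + 1" m s n] have "edge_label m n (k, e) (k * n + s)"
      by simp
    then show ?thesis by blast
  qed
  obtain k e k' e' where xy: "x = (k, e)" "y = (k', e')" by fastforce
  show thesis
  proof (cases "right_edge n k e")
    case True
    with right [of k e] g n that xy show ?thesis by (auto simp: glued_iff)
  next
    case False
    with g n xy have "right_edge n k' e'" "k' + 1 < m" "e' < 2 * n"
      using right_edge_opposite [of n k' e'] by (auto simp: glued_iff opposite_less opposite_opposite)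
    then obtain l where "edge_label m n (k', e') l" using right by blast
    with edge_label.across glued_sym [OF g] xy that show ?thesis by blast
  qed
qed

lemma side_len_glued:
  assumes "n > 0" "glued m n (k, e) (k', e')"
  shows "side_len m k (right_edge n k e) = side_len m k' (right_edge n k' e')"
    "side_len m k (right_edge n k e) > 0" "side_len m k (right_edge n k e) \<le> 1"
proof -
  have right: "side_len m k (right_edge n k e) = side_len m k' (right_edge n k' e') \<and>
    side_len m k (right_edge n k e) > 0" if "glued m n (k, e) (k', e')" "right_edge n k e" for k e k' e'
    using that assms(1) sin_nat_pos [of "k + 1" m]
    by (auto simp: glued_iff side_len_def right_edge_opposite)
  have "right_edge n k e \<or> right_edge n k' e'"
    using assms right_edge_opposite [of n k' e'] by (auto simp: glued_iff opposite_opposite split: if_splits)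
  then show "side_len m k (right_edge n k e) = side_len m k' (right_edge n k' e')"
    "side_len m k (right_edge n k e) > 0"
    using right [OF assms(2)] right [OF glued_sym [OF assms(2)]] by auto
  show "side_len m k (right_edge n k e) \<le> 1" by (simp add: side_len_def)
qed

lemma edge_vec_glued:
  assumes "n > 0" "glued m n (k, e) (k', e')"
  shows "edge_vec m n k' e' = - edge_vec m n k e" "edge_vec m n k e \<noteq> 0" "norm (edge_vec m n k e) \<le> 1"
proof -
  have "[int e' = int e + int n] (mod 2 * int n)"
    using assms opposite_cong by (auto simp: glued_iff)
  then have "ray n (int e') = - ray n (int e)"
    using assms(1) by (metis ray_eq_iff ray_turn)
  then show "edge_vec m n k' e' = - edge_vec m n k e"
    using side_len_glued [OF assms] by (simp add: edge_vec_eq)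
  show "edge_vec m n k e \<noteq> 0" "norm (edge_vec m n k e) \<le> 1"
    using side_len_glued [OF assms] by (auto simp: edge_vec_eq ray_def norm_mult)
qed

lemma cong_abs_less_imp_eq:
  assumes "[a = b] (mod q)" "\<bar>a - b\<bar> < (q :: int)"
  shows "a = b"
proof (rule ccontr)
  assume "a \<noteq> b"
  then have "\<bar>q\<bar> \<le> \<bar>a - b\<bar>"
    using assms(1) by (intro dvd_imp_le_int) (simp_all add: cong_iff_dvd_diff)
  with assms(2) show False by simp
qed

section \<open>Edges addressed by their column in the grid\<close>

definition side_index :: "nat \<Rightarrow> nat \<Rightarrow> nat \<Rightarrow> bool \<Rightarrow> nat" where
  "side_index n k d R =
     (if R = (even d = even k) then (if even k then d + 1 else (n + d + 1) mod (2 * n))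
      else (if even k then (2 * n - d) mod (2 * n) else n - d))"

text \<open>The index before reduction modulo \<open>2 * n\<close>, for use in congruences. Columns
  are counted from \<open>d = 0\<close> because \<open>d\<close> is also the number of a dual
  polygon.\<close>

definition side_angle :: "nat \<Rightarrow> nat \<Rightarrow> nat \<Rightarrow> bool \<Rightarrow> int" where
  "side_angle n k d R =
     (if R = (even d = even k) then int d + 1 else - int d) + (if even k then 0 else int n)"

lemma side_index_cong:
  assumes "d < n"
  shows "[int (side_index n k d R) = side_angle n k d R] (mod 2 * int n)"
proof -
  have "int ((n + d + 1) mod (2 * n)) = (int d + 1 + int n) mod (2 * int n)"
    by (simp add: zmod_int algebra_simps)
  moreover have "int ((2 * n - d) mod (2 * n)) = (2 * int n - int d) mod (2 * int n)"
    using assms by (simp add: zmod_int of_nat_diff)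
  ultimately show ?thesis
    using assms by (auto simp: side_index_def side_angle_def cong_def of_nat_diff mod_diff_left_eq)
qed

lemma side_index_less: "d < n \<Longrightarrow> n \<ge> 2 \<Longrightarrow> side_index n k d R < 2 * n"
  by (auto simp: side_index_def)

lemma right_edge_side_index:
  assumes "d < n"
  shows "right_edge n k (side_index n k d R) \<longleftrightarrow> R"
proof -
  have "even (side_index n k d R) \<longleftrightarrow> even (side_angle n k d R)"
    using even_cong [OF side_index_cong [OF assms]] by simp
  then show ?thesis by (auto simp: right_edge_iff side_angle_def)
qed

lemma midpt_side_index:
  assumes "n \<ge> 2" "d < n"
  shows "midpt m n k (side_index n k d R) = polygon_center m n k + spoke m n k d R"
proof -
  have ray: "ray n (int (side_index n k d R)) = ray n (side_angle n k d R)"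
    using side_index_cong [OF assms(2)] assms by (simp add: ray_eq_iff)
  have "ray n (int d + 1) = cis (real (d + 1) * pi / real n)" "ray n (- int d) = cis (- (real d * pi / real n))"
    by (simp_all add: ray_def add.commute)
  moreover have "ray n (int n - int d) = - ray n (- int d)"
    using ray_turn [of n "- int d"] assms by simp
  ultimately show ?thesis
    unfolding midpt_eq [OF assms(1)] ray right_edge_side_index [OF assms(2)]
    using assms by (simp add: side_angle_def spoke_def ray_turn)
qed

text \<open>In this addressing a gluing keeps the column and only changes \<open>k\<close> by
  one.\<close>

lemma opposite_side_index:
  assumes "n \<ge> 2" "d < n"
  shows "opposite n (side_index n k d True) = side_index n (Suc k) d False"
proof -
  have "[int (opposite n (side_index n k d True)) = int (side_index n k d True) + int n] (mod 2 * int n)"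
    by (rule opposite_cong)
  also have "[int (side_index n k d True) + int n = side_angle n k d True + int n] (mod 2 * int n)"
    by (intro cong_add side_index_cong assms cong_refl)
  also have "[side_angle n k d True + int n = side_angle n (Suc k) d False] (mod 2 * int n)"
    by (simp add: side_angle_def cong_iff_dvd_diff)
  also have "[side_angle n (Suc k) d False = int (side_index n (Suc k) d False)] (mod 2 * int n)"
    by (intro cong_sym [OF side_index_cong] assms)
  finally show ?thesis
    using opposite_less [of n "side_index n k d True"] side_index_less [of d n "Suc k" False] assms
    by (intro of_nat_eq_iff [where 'a = int, THEN iffD1] cong_abs_less_imp_eq) auto
qed

lemma diagram_vertex_label:
  assumes "1 \<le> r" "d < n"
  shows "diagram_vertex n r (d + 1) = (r - 1) * n + (if odd r then d + 1 else n - d)"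
  using assms by (cases r) (auto simp: diagram_vertex_def)

lemma side_index_label_index:
  assumes "1 \<le> r" "d < n"
  shows "label_index n r (if odd r then d + 1 else n - d) = side_index n (r - 1) d True"
proof -
  obtain k where r: "r = Suc k" using assms(1) by (cases r) auto
  show ?thesis
  proof (cases "even k")
    case True
    then show ?thesis using r assms by (simp add: label_index_def side_index_def right_edge_iff)
  next
    case False
    have "2 * n + 1 - (n - d) = n + d + 1" using assms by simp
    then show ?thesis using False r assms by (auto simp: label_index_def side_index_def right_edge_iff)
  qed
qed

lemma
  assumes "n \<ge> 2" "k + 1 < m" "d < n"
  shows glued_side_index: "glued m n (k, side_index n k d True) (Suc k, side_index n (Suc k) d False)"
    and edge_label_side_right: "edge_label m n (k, side_index n k d True) (diagram_vertex n (k + 1) (d + 1))"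
    and edge_label_side_left:
      "edge_label m n (Suc k, side_index n (Suc k) d False) (diagram_vertex n (k + 1) (d + 1))"
proof -
  show *: "glued m n (k, side_index n k d True) (Suc k, side_index n (Suc k) d False)"
    using assms side_index_less [of d n k True]
    by (simp add: glued_iff opposite_side_index right_edge_side_index)
  show **: "edge_label m n (k, side_index n k d True) (diagram_vertex n (k + 1) (d + 1))"
    using edge_label.right [of "k + 1" m "if odd (k + 1) then d + 1 else n - d" n] assms
      side_index_label_index [of "k + 1" d n] diagram_vertex_label [of "k + 1" d n]
    by (simp split: if_splits)
  show "edge_label m n (Suc k, side_index n (Suc k) d False) (diagram_vertex n (k + 1) (d + 1))"
    using ** * by (rule edge_label.across)
qed

lemma label_diagramE:
  assumes "l \<in> labels m n"
  obtains r d where "1 \<le> r" "r \<le> m - 1" "d < n" "l = diagram_vertex n r (d + 1)"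
proof -
  obtain r s where rs: "1 \<le> r" "r \<le> m - 1" "1 \<le> s" "s \<le> n" "l = (r - 1) * n + s"
    using assms by (rule labelE)
  define d where "d = (if odd r then s - 1 else n - s)"
  have d: "d < n" using rs by (auto simp: d_def)
  have "l = diagram_vertex n r (d + 1)"
    unfolding diagram_vertex_label [OF rs(1) d] using rs by (auto simp: d_def)
  with rs d that show thesis by blast
qed

lemma diagram_vertex_inj:
  assumes "1 \<le> r" "1 \<le> r'" "d < n" "d' < n"
    and "diagram_vertex n r (d + 1) = diagram_vertex n r' (d' + 1)"
  shows "r = r'" "d = d'"
proof -
  let ?s = "\<lambda>r d. if odd r then d + 1 else n - d"
  have s: "1 \<le> ?s r d" "?s r d \<le> n" "1 \<le> ?s r' d'" "?s r' d' \<le> n" using assms by auto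
  have eq: "(r - 1) * n + ?s r d = (r' - 1) * n + ?s r' d'"
    using assms(5) unfolding diagram_vertex_label [OF assms(1,3)] diagram_vertex_label [OF assms(2,4)] .
  show "r = r'" using label_split_unique(1) [OF assms(1,2) s eq] .
  moreover have "?s r d = ?s r' d'" using label_split_unique(2) [OF assms(1,2) s eq] .
  ultimately show "d = d'" using assms by (auto split: if_splits)
qed

section \<open>Words read along broken lines, and paths in the grid\<close>

definition reading :: "nat \<Rightarrow> nat \<Rightarrow> (int \<Rightarrow> nat) \<Rightarrow> (int \<Rightarrow> nat) \<Rightarrow> (int \<Rightarrow> nat) \<Rightarrow> (int \<Rightarrow> nat) \<Rightarrow> (int \<Rightarrow> complex) \<Rightarrow> bool" where
  "reading m n u k e f X \<longleftrightarrow>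
     (\<forall>j. edge_label m n (k j, e j) (u j) \<and> glued m n (k j, f j) (k (j + 1), e (j + 1)) \<and>
        X (j + 1) - X j = midpt m n (k j) (f j) - midpt m n (k j) (e j))"

text \<open>
  \<open>X\<close> is the broken line through the midpoints of the crossed edges, developed in the plane.
\<close>

definition heads :: "(int \<Rightarrow> complex) \<Rightarrow> real \<Rightarrow> bool" where
  "heads X \<theta> \<longleftrightarrow>
     (\<exists>T B. filterlim T at_top at_top \<and> (\<forall>j. norm (X j - T j *\<^sub>R cis \<theta>) \<le> B))"

text \<open>An edge of \<open>P(k)\<close> lies in row \<open>k + 1\<close> or \<open>k\<close>,
  according as it is right or left.\<close>

definition grid_row :: "nat \<Rightarrow> nat \<Rightarrow> nat" where
  "grid_row k d = (if odd d then k + 1 else k)"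

text \<open>
  A path in \<open>T\<^sub>0\<close>: at time \<open>j\<close> the polygon \<open>P(k j)\<close> is entered through the edge in column \<open>d j + 1\<close>, which
  is a right edge exactly if the column is even. The column \<open>d j + 1\<close> corresponds to the polygon
  \<open>P(d j)\<close> of the dual surface, and \<open>P(k j)\<close> to the column \<open>k j + 1\<close> of the dual grid.
\<close>

definition grid_path ::
  "nat \<Rightarrow> nat \<Rightarrow> (int \<Rightarrow> nat) \<Rightarrow> (int \<Rightarrow> nat) \<Rightarrow> (int \<Rightarrow> nat) \<Rightarrow> (int \<Rightarrow> complex) \<Rightarrow> bool" where
  "grid_path m n u k d X \<longleftrightarrow>
     (\<forall>j. d j < n \<and> 1 \<le> grid_row (k j) (d j) \<and> grid_row (k j) (d j) \<le> m - 1 \<and>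
        u j = diagram_vertex n (grid_row (k j) (d j)) (d j + 1) \<and>
        d (j + 1) \<le> d j + 1 \<and> d j \<le> d (j + 1) + 1 \<and>
        (if even (d (j + 1)) then k (j + 1) = k j + 1 else k j = k (j + 1) + 1) \<and>
        X (j + 1) - X j =
          spoke m n (k j) (d (j + 1)) (even (d (j + 1))) - spoke m n (k j) (d j) (odd (d j)))"

text \<open>For even \<open>k\<close> the two edges are at positions \<open>x = d\<close> and
  \<open>y = d' + 1\<close>, for odd \<open>k\<close> at \<open>x = n - 1 - d\<close> and
  \<open>y = n - d'\<close>. Either way \<open>x \<le> y \<le> x + 2\<close> says that the columns
  differ by at most one.\<close>

lemma crossing_0_side_index:
  assumes "d < n" "d' < n" "crossing n 0 (side_index n k d (odd d)) (side_index n k d' (even d'))"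
  shows "d' \<le> d + 1" "d \<le> d' + 1"
proof -
  obtain x y where xy: "x < n" "0 < y" "y \<le> n" "x \<le> y" "y \<le> x + 2"
    "[int (side_index n k d (odd d)) = - int x] (mod 2 * int n)"
    "[int (side_index n k d' (even d')) = int y] (mod 2 * int n)"
    using assms(3) unfolding crossing_def by auto
  have "[side_angle n k d (odd d) = - int x] (mod 2 * int n)"
    using cong_trans [OF cong_sym [OF side_index_cong [OF assms(1)]] xy(6)] .
  then have x: "int x = (if even k then int d else int n - 1 - int d)"
  proof (cases "even k")
    case True
    then have "side_angle n k d (odd d) = - int d" by (auto simp: side_angle_def)
    with \<open>[side_angle n k d (odd d) = - int x] (mod 2 * int n)\<close>
    have "- int d = - int x" using xy(1) assms by (intro cong_abs_less_imp_eq) auto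
    then show ?thesis using True by simp
  next
    case False
    then have "side_angle n k d (odd d) = int d + 1 + int n" by (auto simp: side_angle_def)
    with \<open>[side_angle n k d (odd d) = - int x] (mod 2 * int n)\<close>
    have "[int d + 1 + int n = - int x] (mod 2 * int n)" by simp
    \<comment> \<open>These representatives differ by a full turn, which is subtracted before they
      are compared.\<close>
    then have "[int d + 1 + int n - 2 * int n = - int x - 0] (mod 2 * int n)"
      by (rule cong_diff) (simp add: cong_def)
    then have "int d + 1 + int n - 2 * int n = - int x"
      using xy(1) assms by (intro cong_abs_less_imp_eq) auto
    then show ?thesis using False by simp
  qed
  have "[side_angle n k d' (even d') = int y] (mod 2 * int n)"
    using cong_trans [OF cong_sym [OF side_index_cong [OF assms(2)]] xy(7)] .
  moreover have "side_angle n k d' (even d') = (if even k then int d' + 1 else int n - int d')"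
    by (auto simp: side_angle_def)
  ultimately have "(if even k then int d' + 1 else int n - int d') = int y"
    using xy(2,3) assms by (intro cong_abs_less_imp_eq) auto
  with x xy(4,5) show "d' \<le> d + 1" "d \<le> d' + 1" by (auto split: if_splits)
qed

text \<open>Of the two edges of \<open>P(k)\<close> in a column, this one is at a position in
  \<open>1..n\<close> after edge 0, so it can be left but not entered. Hence a label and its polygon
  determine the column parity in \<open>grid_path_if_reading\<close>.\<close>

lemma not_crossing_0_side_index:
  assumes "d < n"
  shows "\<not> crossing n 0 (side_index n k d (even d)) f"
proof
  assume "crossing n 0 (side_index n k d (even d)) f"
  then obtain x where x: "x < n" "[int (side_index n k d (even d)) = - int x] (mod 2 * int n)"
    unfolding crossing_def by auto
  have "[side_angle n k d (even d) = - int x] (mod 2 * int n)"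
    using cong_trans [OF cong_sym [OF side_index_cong [OF assms]] x(2)] .
  moreover have "side_angle n k d (even d) = (if even k then int d + 1 else int n - int d)"
    by (auto simp: side_angle_def)
  ultimately have "(if even k then int d + 1 else int n - int d) = - int x"
    using x(1) assms by (intro cong_abs_less_imp_eq) auto
  then show False using assms by (auto split: if_splits)
qed

lemma edge_label_diagram_cases:
  assumes n: "n \<ge> 2" and l: "edge_label m n (k, e) l"
  obtains r d where "1 \<le> r" "r \<le> m - 1" "d < n" "l = diagram_vertex n r (d + 1)"
    "(\<exists>R. e = side_index n k d R \<and> r = (if R then k + 1 else k))"
proof -
  obtain r d where rd: "1 \<le> r" "r \<le> m - 1" "d < n" "l = diagram_vertex n r (d + 1)"
    using edge_label_in_labels [OF _ l] n by (auto elim: label_diagramE)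
  obtain q where q: "r = q + 1" using rd(1) by (metis le_add_diff_inverse2)
  have n0: "n > 0" and qm: "q + 1 < m" using n rd q by auto
  have "edge_label m n (q, side_index n q d True) l" using edge_label_side_right [OF n qm rd(3)] rd q by simp
  then have "(k, e) = (q, side_index n q d True) \<or> glued m n (q, side_index n q d True) (k, e)"
    using edge_label_same [OF n0 _ l] by metis
  then have "(k, e) = (q, side_index n q d True) \<or> (k, e) = (Suc q, side_index n (Suc q) d False)"
    using glued_unique [OF n0 glued_side_index [OF n qm rd(3)]] by blast
  then have "\<exists>R. e = side_index n k d R \<and> r = (if R then k + 1 else k)"
    using q by auto
  with rd that show thesis by blast
qed

lemma grid_path_if_reading:
  assumes n: "n \<ge> 2" and r: "reading m n u k e f X" and c: "\<And>j. crossing n 0 (e j) (f j)"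
  shows "\<exists>d. grid_path m n u k d X"
proof -
  have n0: "n > 0" using n by simp
  have r': "edge_label m n (k j, e j) (u j)" "glued m n (k j, f j) (k (j + 1), e (j + 1))"
    "X (j + 1) - X j = midpt m n (k j) (f j) - midpt m n (k j) (e j)" for j
    using r by (auto simp: reading_def)
  define P where "P j d \<longleftrightarrow> d < n \<and> 1 \<le> grid_row (k j) d \<and> grid_row (k j) d \<le> m - 1 \<and>
    u j = diagram_vertex n (grid_row (k j) d) (d + 1) \<and> e j = side_index n (k j) d (odd d)" for j d
  have "\<exists>d. P j d" for j
  proof -
    obtain r d where *: "1 \<le> r" "r \<le> m - 1" "d < n" "u j = diagram_vertex n r (d + 1)"
      and "\<exists>R. e j = side_index n (k j) d R \<and> r = (if R then k j + 1 else k j)"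
      by (rule edge_label_diagram_cases [OF n r'(1) [of j]])
    then obtain R where R: "e j = side_index n (k j) d R" "r = (if R then k j + 1 else k j)"
      by blast
    have "R = odd d"
    proof (rule ccontr)
      assume "R \<noteq> odd d"
      then have eq: "R = even d" by (cases R; cases "odd d") simp_all
      have "crossing n 0 (side_index n (k j) d (even d)) (f j)"
        using c [of j] unfolding R(1) eq .
      then show False using not_crossing_0_side_index [OF *(3)] by blast
    qed
    then have "e j = side_index n (k j) d (odd d)" "r = grid_row (k j) d"
      using R by (simp_all add: grid_row_def)
    with * show ?thesis unfolding P_def by blast
  qed
  then obtain d where "\<forall>j. P j (d j)" using choice [of P] by blast
  then have d: "\<And>j. d j < n" "\<And>j. 1 \<le> grid_row (k j) (d j)" "\<And>j. grid_row (k j) (d j) \<le> m - 1"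
    "\<And>j. u j = diagram_vertex n (grid_row (k j) (d j)) (d j + 1)"
    "\<And>j. e j = side_index n (k j) (d j) (odd (d j))"
    unfolding P_def by simp_all
  \<comment> \<open>The exit edge is the glued partner of the next entered edge, whose column and
    kind therefore decide it and the change of polygon.\<close>
  have k_f: "(if even (d (j + 1)) then k (j + 1) = k j + 1 else k j = k (j + 1) + 1) \<and>
    f j = side_index n (k j) (d (j + 1)) (even (d (j + 1)))" for j
  proof -
    let ?d = "d (j + 1)" and ?k = "k (j + 1)"
    have g: "glued m n (?k, side_index n ?k ?d (odd ?d)) (k j, f j)"
      using glued_sym [OF r'(2)] d(5) by metis
    show ?thesis
    proof (cases "even ?d")
      case True
      then obtain q where q: "?k = Suc q" using d(2) [of "j + 1"] by (cases ?k) (auto simp: grid_row_def)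
      then have "q + 1 < m" using True d(2) [of "j + 1"] d(3) [of "j + 1"] by (auto simp: grid_row_def)
      from glued_sym [OF glued_side_index [OF n this d(1) [of "j + 1"]]]
      have "glued m n (?k, side_index n ?k ?d (odd ?d)) (q, side_index n q ?d True)"
        using q True by simp
      from glued_unique [OF n0 g this] show ?thesis using q True by simp
    next
      case False
      then have "?k + 1 < m" using d(2) [of "j + 1"] d(3) [of "j + 1"] by (auto simp: grid_row_def)
      from glued_side_index [OF n this d(1) [of "j + 1"]]
      have "glued m n (?k, side_index n ?k ?d (odd ?d)) (Suc ?k, side_index n (Suc ?k) ?d False)"
        using False by simp
      from glued_unique [OF n0 g this] show ?thesis using False by simp
    qed
  qed
  have "d (j + 1) \<le> d j + 1 \<and> d j \<le> d (j + 1) + 1" for j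
    using crossing_0_side_index [OF d(1) [of j] d(1) [of "j + 1"], of "k j"] c [of j] d(5) [of j] k_f [of j]
    by simp
  moreover have "X (j + 1) - X j =
          spoke m n (k j) (d (j + 1)) (even (d (j + 1))) - spoke m n (k j) (d j) (odd (d j))" for j
    using r'(3) [of j] d(5) [of j] k_f [of j] midpt_side_index [OF n d(1)] by simp
  ultimately have "grid_path m n u k d X"
    unfolding grid_path_def using d k_f by blast
  then show ?thesis by blast
qed

section \<open>Derivation\<close>

lemma scaled_gamma_linear: "linear (scaled_gamma m n)"
  by (rule linearI)
    (simp_all add: scaled_gamma_def complex_eq_iff add_divide_distrib diff_divide_distrib algebra_simps)

text \<open>\<open>scaled_gamma\<close> keeps the imaginary part sin \<theta>, and after a turn by -
  \<pi>/m the imaginary part of the image is sin (\<pi>/n - \<theta>). Both are nonnegative on the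
  sector, which puts the image direction in [\<pi>/m, \<pi>].\<close>

lemma scaled_gamma_cis:
  assumes m: "m \<ge> 2" and n: "n \<ge> 2" and \<theta>: "\<theta> \<in> sector n 0"
  obtains \<rho> where "\<rho> > 0" "scaled_gamma m n (cis \<theta>) = \<rho> *\<^sub>R cis (dir_action (gamma_matrix m n) \<theta>)"
    "pi / real m \<le> dir_action (gamma_matrix m n) \<theta>" "dir_action (gamma_matrix m n) \<theta> \<le> pi"
proof -
  define s t where "s = sin (pi / real m)" "t = sin (pi / real n)"
  have st: "s > 0" "t > 0" using sin_pi_pos m n by (auto simp: s_t_def)
  define v where "v = gamma_matrix m n *v vector [cos \<theta>, sin \<theta>]"
  define z where "z = Complex (v $ 1) (v $ 2)"
  define l where "l = sqrt (t / s)"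
  have l: "l > 0" "l * l = t / s" "l / sqrt (s * t) = 1 / s" "l * sqrt (s / t) = 1"
    using st by (simp_all add: l_def real_sqrt_divide real_sqrt_mult field_simps)
  have v1: "v $ 1 = - l * cos \<theta> + (cos (pi / real m) + cos (pi / real n)) / sqrt (s * t) * sin \<theta>"
    and v2: "v $ 2 = sqrt (s / t) * sin \<theta>"
    by (simp_all add: v_def gamma_matrix_def Let_def matrix_vector_mult_def sum_2 l_def s_t_def)
  have "l * v $ 1 = - (l * l) * cos \<theta> + (cos (pi / real m) + cos (pi / real n)) * (l / sqrt (s * t)) * sin \<theta>"
    unfolding v1 by (simp add: algebra_simps add_divide_distrib)
  also have "\<dots> = Re (scaled_gamma m n (cis \<theta>))"
    unfolding l using st by (simp add: scaled_gamma_def field_simps flip: s_t_def)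
  finally have Re: "Re (scaled_gamma m n (cis \<theta>)) = l * v $ 1" ..
  have "l * v $ 2 = (l * sqrt (s / t)) * sin \<theta>" unfolding v2 by simp
  then have Im: "Im (scaled_gamma m n (cis \<theta>)) = l * v $ 2" unfolding l by (simp add: scaled_gamma_def)
  have Gz: "scaled_gamma m n (cis \<theta>) = l *\<^sub>R z" by (simp add: complex_eq_iff Re Im z_def)
  define \<phi> where "\<phi> = dir_action (gamma_matrix m n) \<theta>"
  have arg: "\<phi> = Arg2pi z" by (simp add: \<phi>_def dir_action_def z_def v_def Let_def)
  have \<theta>': "0 \<le> \<theta>" "\<theta> \<le> pi / real n" using \<theta> by (auto simp: sector_def)
  have pn: "pi / real n \<le> pi" "pi / real n > 0" and pm: "pi / real m > 0" "pi / real m < pi"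
    using m n by (simp_all add: field_simps)
  have s1: "sin \<theta> \<ge> 0" "sin (pi / real n - \<theta>) \<ge> 0"
    using \<theta>' pn by (auto intro!: sin_ge_zero)
  have turn: "Im (scaled_gamma m n (cis \<theta>) * cis (- pi / real m)) = sin (pi / real n - \<theta>)"
    using st by (simp add: scaled_gamma_def s_t_def sin_diff field_simps)
  have z0: "z \<noteq> 0"
  proof
    assume "z = 0"
    then have "scaled_gamma m n (cis \<theta>) = 0" using Gz by simp
    then have "sin \<theta> = 0" and "sin (pi / real n - \<theta>) = 0"
      using turn by (simp add: scaled_gamma_def complex_eq_iff, metis mult_zero_left zero_complex.sel(2))
    then have "t * cos \<theta> = 0" by (simp add: sin_diff s_t_def)
    then show False using st \<open>sin \<theta> = 0\<close> sin_cos_squared_add [of \<theta>] by simp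
  qed
  have zc: "z = norm z *\<^sub>R cis \<phi>"
    using Arg2pi [of z] by (simp add: arg is_Arg_def scaleR_conv_of_real cis_conv_exp mult.commute)
  have G: "scaled_gamma m n (cis \<theta>) = (l * norm z) *\<^sub>R cis \<phi>"
    unfolding Gz by (subst zc) simp
  have pos: "l * norm z > 0" using l z0 by simp
  have "sin \<theta> = (l * norm z) * sin \<phi>" using arg_cong [OF G, of Im] by (simp add: scaled_gamma_def)
  then have "sin \<phi> \<ge> 0" using s1 pos by (simp add: zero_le_mult_iff)
  moreover have "0 \<le> \<phi>" "\<phi> < 2 * pi" using Arg2pi [of z] by (auto simp: arg)
  ultimately have up: "\<phi> \<le> pi"
    using sin_gt_zero [of "\<phi> - pi"] by (cases "\<phi> \<le> pi") (simp_all add: sin_diff)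
  have "sin (pi / real n - \<theta>) = (l * norm z) * sin (\<phi> - pi / real m)"
    using turn unfolding G by (simp add: sin_diff algebra_simps)
  then have "sin (\<phi> - pi / real m) \<ge> 0" using s1 pos by (simp add: zero_le_mult_iff)
  then have "pi / real m \<le> \<phi>"
  proof (rule contrapos_pp)
    assume "\<not> pi / real m \<le> \<phi>"
    then have "sin (pi / real m - \<phi>) > 0"
      using pm \<open>0 \<le> \<phi>\<close> by (intro sin_gt_zero) linarith+
    then show "\<not> 0 \<le> sin (\<phi> - pi / real m)"
      using sin_minus [of "pi / real m - \<phi>"] by simp
  qed
  with that [OF pos G [unfolded \<phi>_def]] up show thesis by (simp add: \<phi>_def)
qed

lemma norm_spoke_le:
  assumes "n \<ge> 2"
  shows "norm (spoke m n k d R) \<le> 1 / sin (pi / real n)"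
proof -
  have le: "\<bar>side_len m k R'\<bar> \<le> 1" for R' by (simp add: side_len_def)
  have "\<bar>side_len m k R * cos (pi / real n)\<bar> \<le> 1 * 1"
    unfolding abs_mult by (intro mult_mono le) auto
  then have "\<bar>side_len m k R * cos (pi / real n) + side_len m k (\<not> R)\<bar> \<le> 2"
    using le [of "\<not> R"] by linarith
  then have "\<bar>apothem m n k R\<bar> \<le> 1 / sin (pi / real n)"
    using sin_pi_pos [OF assms] by (simp add: apothem_def abs_mult field_simps)
  then show ?thesis by (simp add: spoke_def norm_mult)
qed

lemma norm_diag_point_le:
  assumes "m \<ge> 2"
  shows "norm (diag_point m n d r) \<le> 1 / sin (pi / real m)"
proof -
  have le: "\<bar>side_len n d R\<bar> \<le> 1" for R by (simp add: side_len_def)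
  have "norm (of_real (side_len n d (even (r + d))) + of_real (side_len n d (odd (r + d))) * cis (pi / real m)) \<le> 2"
    using norm_triangle_ineq [of "of_real (side_len n d (even (r + d)))"
        "of_real (side_len n d (odd (r + d))) * cis (pi / real m)"]
      le [of "even (r + d)"] le [of "odd (r + d)"] by (simp add: norm_mult)
  moreover have "\<bar>cos (real r * pi / real m) / (2 * sin (pi / real m))\<bar> \<le> 1 / (2 * sin (pi / real m))"
    using sin_pi_pos [OF assms] by (simp add: abs_mult divide_right_mono)
  ultimately have "\<bar>cos (real r * pi / real m) / (2 * sin (pi / real m))\<bar> *
     norm (of_real (side_len n d (even (r + d))) + of_real (side_len n d (odd (r + d))) * cis (pi / real m))
     \<le> 1 / (2 * sin (pi / real m)) * 2"
    using sin_pi_pos [OF assms] by (intro mult_mono) auto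
  moreover have "norm (diag_point m n d r) = \<bar>cos (real r * pi / real m) / (2 * sin (pi / real m))\<bar> *
     norm (of_real (side_len n d (even (r + d))) + of_real (side_len n d (odd (r + d))) * cis (pi / real m))"
    unfolding diag_point_def norm_mult norm_of_real by (cases "even d") simp_all
  ultimately show ?thesis by simp
qed

text \<open>In uniform terms, an arrow label is a vertex of the dual grid: its row belongs to the
  edges between the dual polygons \<open>P(min a b)\<close> and \<open>P(min a b + 1)\<close>, and
  its column is \<open>k + 1\<close> when the arrow crosses \<open>P(k)\<close>, see
  \<open>grid_path_arrow\<close>.\<close>

lemma arrow_label_diagramD:
  assumes "arrow_label m n x y l"
  shows "\<exists>r a b. 1 \<le> r \<and> a < n \<and> b < n \<and> a \<noteq> b \<and>
    x = diagram_vertex n r (a + 1) \<and> y = diagram_vertex n r (b + 1) \<and>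
    l = diagram_vertex m (min a b + 1) (if odd a then r else r + 1)"
  using assms
proof cases
  case (odd_left r c)
  then obtain b where "c = Suc b" by (cases c) auto
  with odd_left show ?thesis
    by (intro exI [of _ r] exI [of _ "Suc b"] exI [of _ b]) (simp add: diagram_vertex_def)
next
  case (odd_right r c)
  then obtain a where "c = Suc a" by (cases c) auto
  with odd_right show ?thesis
    by (intro exI [of _ r] exI [of _ a] exI [of _ "Suc a"]) (simp add: diagram_vertex_def)
next
  case (even_right r c)
  then obtain a where c: "c = Suc a" by (cases c) auto
  have "r \<le> m + a * m" using even_right by simp
  with even_right c show ?thesis
    by (intro exI [of _ r] exI [of _ a] exI [of _ "Suc a"]) (simp add: diagram_vertex_def)
next
  case (even_left r c)
  then obtain b where "c = Suc b" by (cases c) auto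
  with even_left show ?thesis
    by (intro exI [of _ r] exI [of _ "Suc b"] exI [of _ b]) (simp add: diagram_vertex_def)
qed

lemma arrow_label_diagramI:
  assumes "1 \<le> r" "r \<le> m - 1" "a < n" "b < n" "a \<noteq> b" "a \<le> b + 1" "b \<le> a + 1"
  shows "\<exists>l. arrow_label m n (diagram_vertex n r (a + 1)) (diagram_vertex n r (b + 1)) l"
proof (cases "a < b")
  case True
  then have "b = a + 1" using assms by simp
  with assms arrow_label.odd_right [of r m "a + 1" n] arrow_label.even_right [of r m "a + 1" n]
  show ?thesis by (cases "odd (a + 1)") auto
next
  case False
  then have "a = b + 1" using assms by simp
  with assms arrow_label.odd_left [of r m "b + 1" n] arrow_label.even_left [of r m "b + 1" n]
  show ?thesis by (cases "odd (b + 1)") auto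
qed

lemma grid_path_arrow:
  assumes n: "n \<ge> 2" and g: "grid_path m n u k d X"
  shows "(\<exists>l. arrow_label m n (u j) (u (j + 1)) l) \<longleftrightarrow> d (j + 1) \<noteq> d j"
    and "arrow_label m n (u j) (u (j + 1)) l \<Longrightarrow>
      l = diagram_vertex m (min (d j) (d (j + 1)) + 1) (k j + 1)"
proof -
  let ?r = "\<lambda>j. grid_row (k j) (d j)"
  have g': "d j < n" "1 \<le> ?r j" "?r j \<le> m - 1" "u j = diagram_vertex n (?r j) (d j + 1)"
    "d (j + 1) \<le> d j + 1" "d j \<le> d (j + 1) + 1"
    "if even (d (j + 1)) then k (j + 1) = k j + 1 else k j = k (j + 1) + 1" for j
    using g unfolding grid_path_def by blast+
  have *: "d j \<noteq> d (j + 1) \<and> l = diagram_vertex m (min (d j) (d (j + 1)) + 1) (k j + 1)"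
    if arr: "arrow_label m n (u j) (u (j + 1)) l" for l
  proof -
    obtain r a b where r: "1 \<le> r" "a < n" "b < n" "a \<noteq> b"
      "u j = diagram_vertex n r (a + 1)" "u (j + 1) = diagram_vertex n r (b + 1)"
      "l = diagram_vertex m (min a b + 1) (if odd a then r else r + 1)"
      using arrow_label_diagramD [OF arr] by blast
    note eq = trans [OF sym [OF g'(4) [of j]] r(5)] trans [OF sym [OF g'(4) [of "j + 1"]] r(6)]
    have e: "?r j = r" "d j = a" "?r (j + 1) = r" "d (j + 1) = b"
      using diagram_vertex_inj [OF g'(2) r(1) g'(1) r(2) eq(1)]
        diagram_vertex_inj [OF g'(2) r(1) g'(1) r(3) eq(2)] .
    have "(if odd a then r else r + 1) = k j + 1"
      unfolding e(1,2) [symmetric] grid_row_def by simp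
    from r(4) r(7) [unfolded this] show ?thesis unfolding e by blast
  qed
  show "(\<exists>l. arrow_label m n (u j) (u (j + 1)) l) \<longleftrightarrow> d (j + 1) \<noteq> d j"
  proof
    assume neq: "d (j + 1) \<noteq> d j"
    then have "d (j + 1) = d j + 1 \<or> d j = d (j + 1) + 1"
      using g'(5,6) [of j] by linarith
    then have "odd (d j) \<longleftrightarrow> even (d (j + 1))" by presburger
    \<comment> \<open>The change of parity of \<open>d\<close> compensates the change of
      \<open>k\<close> in \<open>grid_row\<close>.\<close>
    then have row: "?r (j + 1) = ?r j"
      using g'(7) [of j] by (cases "even (d (j + 1))") (simp_all add: grid_row_def)
    show "\<exists>l. arrow_label m n (u j) (u (j + 1)) l"
      using arrow_label_diagramI [OF g'(2,3,1,1) neq [symmetric] g'(6,5)]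
      unfolding g'(4) row .
  next
    assume "\<exists>l. arrow_label m n (u j) (u (j + 1)) l"
    then show "d (j + 1) \<noteq> d j" using * by metis
  qed
  show "arrow_label m n (u j) (u (j + 1)) l \<Longrightarrow>
      l = diagram_vertex m (min (d j) (d (j + 1)) + 1) (k j + 1)"
    using * by blast
qed

lemma strict_mono_int_ge:
  fixes h :: "int \<Rightarrow> int"
  assumes "strict_mono h" "0 \<le> i"
  shows "h 0 + i \<le> h i"
  using assms(2)
proof (induction i rule: int_ge_induct)
  case (step i)
  have "h i < h (i + 1)" using assms(1) by (simp add: strict_mono_def)
  with step show ?case by simp
qed simp

lemma filterlim_strict_mono_int:
  fixes h :: "int \<Rightarrow> int"
  assumes "strict_mono h"
  shows "filterlim h at_top at_top"
  unfolding filterlim_at_top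
proof
  fix z
  show "eventually (\<lambda>i. z \<le> h i) at_top"
    using eventually_ge_at_top [of "max 0 (z - h 0)"]
  proof eventually_elim
    case (elim i)
    then show ?case using strict_mono_int_ge [OF assms, of i] by simp
  qed
qed

lemma derived_reading:
  assumes m: "m \<ge> 2" and n: "n \<ge> 2" and \<theta>: "\<theta> \<in> sector n 0"
    and g: "grid_path m n w k d X" and X: "heads X \<theta>" and der: "is_derivative m n w u"
  shows "\<exists>k' e f X'. reading n m u k' e f X' \<and> heads X' (dir_action (gamma_matrix m n) \<theta>)"
proof -
  have g': "d j < n" "1 \<le> grid_row (k j) (d j)" "grid_row (k j) (d j) \<le> m - 1"
    "d (j + 1) \<le> d j + 1" "d j \<le> d (j + 1) + 1"
    "if even (d (j + 1)) then k (j + 1) = k j + 1 else k j = k (j + 1) + 1"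
    "X (j + 1) - X j =
      spoke m n (k j) (d (j + 1)) (even (d (j + 1))) - spoke m n (k j) (d j) (odd (d j))" for j
    using g unfolding grid_path_def by blast+
  obtain h :: "int \<Rightarrow> int" where h: "strict_mono h"
    and rh: "range h = {j. \<exists>l. arrow_label m n (w j) (w (j + 1)) l}"
    and uh: "\<And>i. arrow_label m n (w (h i)) (w (h i + 1)) (u i)"
    using der unfolding is_derivative_def by blast
  have u: "u i = diagram_vertex m (min (d (h i)) (d (h i + 1)) + 1) (k (h i) + 1)" for i
    using grid_path_arrow(2) [OF n g uh] .
  have turn: "d (j + 1) \<noteq> d j \<longleftrightarrow> j \<in> range h" for j
    unfolding rh using grid_path_arrow(1) [OF n g, of j] by simp
  have km: "k j < m" for j
    using g'(2,3) [of j] m by (auto simp: grid_row_def split: if_splits)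

  define y where "y j = diag_point m n (d j) (grid_row (k j) (d j))" for j
  \<comment> \<open>The image of \<open>X j\<close> is the midpoint of a diagonal of the dual
    polygon \<open>P(d j)\<close>; subtracting its position relative to the center leaves the
    developed center of that polygon.\<close>
  define Y where "Y j = scaled_gamma m n (X j) - y j" for j
  have out: "scaled_gamma m n (spoke m n (k j) (d (j + 1)) (even (d (j + 1)))) = hub m n (k j) (d (j + 1)) + y (j + 1)" for j
    using g'(6) [of j] hub_vertical [OF m n, of "k j" "d (j + 1)"]
    by (cases "even (d (j + 1))") (simp_all add: y_def grid_row_def hub_def algebra_simps)
  have into: "scaled_gamma m n (spoke m n (k j) (d j) (odd (d j))) = hub m n (k j) (d j) + y j" for j
    using hub_vertical [OF m n, of "k j" "d j"]
    by (cases "odd (d j)") (simp_all add: y_def grid_row_def hub_def algebra_simps)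
  have Y_step: "Y (j + 1) - Y j = hub m n (k j) (d (j + 1)) - hub m n (k j) (d j)" for j
  proof -
    have "scaled_gamma m n (X (j + 1)) - scaled_gamma m n (X j) =
      (hub m n (k j) (d (j + 1)) + y (j + 1)) - (hub m n (k j) (d j) + y j)"
      unfolding scaled_gamma_diff [symmetric] g'(7) unfolding scaled_gamma_diff out into ..
    then show ?thesis by (simp add: Y_def algebra_simps)
  qed

  \<comment> \<open>Arrow \<open>h i\<close> leads from the dual polygon \<open>P(d (h i))\<close>,
    left through side \<open>f i\<close>, to \<open>P(d (h i + 1))\<close>, entered through side
    \<open>e i\<close>; both sides lie in column \<open>k (h i) + 1\<close> of the dual
    grid.\<close>
  define e where "e i = side_index m (d (h i + 1)) (k (h i)) (d (h i + 1) < d (h i))" for i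
  define f where "f i = side_index m (d (h i)) (k (h i)) (d (h i) < d (h i + 1))" for i
  define Min where "Min i = spoke n m (d (h i + 1)) (k (h i)) (d (h i + 1) < d (h i))" for i
  define Mout where "Mout i = spoke n m (d (h i)) (k (h i)) (d (h i) < d (h i + 1))" for i
  have sides: "glued n m (d (h i), f i) (d (h i + 1), e i) \<and> edge_label n m (d (h i + 1), e i) (u i) \<and>
    Y (h i + 1) - Y (h i) = Mout i - Min i" for i
  proof (cases "d (h i) < d (h i + 1)")
    case True
    with g'(4) [of "h i"] have eq: "d (h i + 1) = Suc (d (h i))" by simp
    have lt: "d (h i) + 1 < n" using g'(1) [of "h i + 1"] eq by simp
    show ?thesis
      using glued_side_index [OF m lt km [of "h i"]] edge_label_side_left [OF m lt km [of "h i"]]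
        hub_horizontal [OF m n, of "k (h i)" "d (h i)"]
      unfolding u e_def f_def Min_def Mout_def Y_step eq by (simp add: algebra_simps)
  next
    case False
    moreover have "d (h i + 1) \<noteq> d (h i)" using turn by blast
    ultimately have eq: "d (h i) = Suc (d (h i + 1))" using g'(5) [of "h i"] by simp
    have lt: "d (h i + 1) + 1 < n" using g'(1) [of "h i"] eq by simp
    show ?thesis
      using glued_sym [OF glued_side_index [OF m lt km [of "h i"]]] edge_label_side_right [OF m lt km [of "h i"]]
        hub_horizontal [OF m n, of "k (h i)" "d (h i + 1)"]
      unfolding u e_def f_def Min_def Mout_def Y_step eq by (simp add: algebra_simps)
  qed
  have run: "d j = d (h i + 1) \<and> Y j = Y (h i + 1)" if "h i + 1 \<le> j" "j \<le> h (i + 1)" for i j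
    using that
  proof (induction j rule: int_ge_induct)
    case (step j)
    have "j \<notin> range h"
    proof
      assume "j \<in> range h"
      then obtain i' where "j = h i'" by blast
      then have "h i < h i'" "h i' < h (i + 1)" using step by auto
      then have "i < i'" "i' < i + 1" using strict_mono_less [OF h] by auto
      then show False by simp
    qed
    then have "d (j + 1) = d j" using turn by blast
    with Y_step [of j] step show ?case by simp
  qed simp
  have next_h: "h i + 1 \<le> h (i + 1)" for i
    using strict_mono_less [OF h, of i "i + 1"] by simp
  have next_d: "d (h (i + 1)) = d (h i + 1)" and next_Y: "Y (h (i + 1)) = Y (h i + 1)" for i
    using run [OF next_h, of i] by auto
  \<comment> \<open>From the center of a dual polygon to the midpoint of the side through which
    arrow \<open>h i\<close> leaves it.\<close>
  define X' where "X' i = Y (h i) + Mout i" for i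
  have "X' (i + 1) - X' i = midpt n m (d (h i + 1)) (f (i + 1)) - midpt n m (d (h i + 1)) (e i)" for i
  proof -
    have "midpt n m (d (h i + 1)) (f (i + 1)) = polygon_center n m (d (h i + 1)) + Mout (i + 1)"
      unfolding f_def Mout_def next_d by (rule midpt_side_index [OF m km])
    moreover have "midpt n m (d (h i + 1)) (e i) = polygon_center n m (d (h i + 1)) + Min i"
      unfolding e_def Min_def by (rule midpt_side_index [OF m km])
    moreover have "X' (i + 1) - X' i = Mout (i + 1) - Min i"
    proof -
      have "Y (h i + 1) - Y (h i) = Mout i - Min i" using sides by blast
      then have "Y (h i + 1) = Mout i - Min i + Y (h i)" by (simp only: diff_eq_eq)
      then show ?thesis unfolding X'_def next_Y by simp
    qed
    ultimately show ?thesis by simp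
  qed
  moreover have "glued n m (d (h i + 1), f (i + 1)) (d (h (i + 1) + 1), e (i + 1))" for i
    using sides [of "i + 1"] by (simp add: next_d)
  \<comment> \<open>\<open>f\<close> is shifted because the polygon entered at arrow
    \<open>h i\<close> is left at the next labeled arrow, \<open>h (i + 1)\<close>.\<close>
  ultimately have "reading n m u (\<lambda>i. d (h i + 1)) e (\<lambda>i. f (i + 1)) X'"
    unfolding reading_def using sides by simp
  moreover have "heads X' (dir_action (gamma_matrix m n) \<theta>)"
  proof -
    obtain \<rho> where \<rho>: "\<rho> > 0" "scaled_gamma m n (cis \<theta>) = \<rho> *\<^sub>R cis (dir_action (gamma_matrix m n) \<theta>)"
      using scaled_gamma_cis [OF m n \<theta>] by blast
    obtain T B where T: "filterlim T at_top at_top" and B: "\<And>j. norm (X j - T j *\<^sub>R cis \<theta>) \<le> B"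
      using X unfolding heads_def by blast
    obtain C where C: "C > 0" "\<And>z. norm (scaled_gamma m n z) \<le> C * norm z"
      using linear_bounded_pos [OF scaled_gamma_linear] by blast
    let ?s = "1 / sin (pi / real m)"
    have "norm (X' i - (T (h i) * \<rho>) *\<^sub>R cis (dir_action (gamma_matrix m n) \<theta>)) \<le> C * B + 2 * ?s" for i
    proof -
      have "(T (h i) * \<rho>) *\<^sub>R cis (dir_action (gamma_matrix m n) \<theta>) = scaled_gamma m n (T (h i) *\<^sub>R cis \<theta>)"
        using linear_cmul [OF scaled_gamma_linear] \<rho> by simp
      then have eq: "X' i - (T (h i) * \<rho>) *\<^sub>R cis (dir_action (gamma_matrix m n) \<theta>) =
        scaled_gamma m n (X (h i) - T (h i) *\<^sub>R cis \<theta>) - y (h i) + Mout i"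
        by (simp add: X'_def Y_def scaled_gamma_diff)
      have "norm (scaled_gamma m n (X (h i) - T (h i) *\<^sub>R cis \<theta>)) \<le> C * norm (X (h i) - T (h i) *\<^sub>R cis \<theta>)"
        by (rule C)
      also have "\<dots> \<le> C * B" using B C(1) by (intro mult_left_mono) auto
      finally have "norm (scaled_gamma m n (X (h i) - T (h i) *\<^sub>R cis \<theta>)) \<le> C * B" .
      moreover have "norm (y (h i)) \<le> ?s" unfolding y_def by (rule norm_diag_point_le [OF m])
      moreover have "norm (Mout i) \<le> ?s" unfolding Mout_def by (rule norm_spoke_le [OF m])
      ultimately show ?thesis
        unfolding eq using norm_triangle_ineq [of "scaled_gamma m n (X (h i) - T (h i) *\<^sub>R cis \<theta>) - y (h i)" "Mout i"]
          norm_triangle_ineq4 [of "scaled_gamma m n (X (h i) - T (h i) *\<^sub>R cis \<theta>)" "y (h i)"] by linarith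
    qed
    moreover have "filterlim (\<lambda>i. T (h i) * \<rho>) at_top at_top"
      using filterlim_tendsto_pos_mult_at_top [OF tendsto_const \<rho>(1)
          filterlim_compose [OF T filterlim_strict_mono_int [OF h]]]
      by (simp add: mult.commute)
    ultimately show ?thesis unfolding heads_def by blast
  qed
  ultimately show ?thesis by blast
qed

section \<open>Trajectories and admissible sectors\<close>

lemma trajectory_reading:
  assumes n: "n \<ge> 2" and t: "linear_trajectory m n \<theta> k e f p \<tau>"
    and l: "\<And>j. edge_label m n (k j, e j) (w j)"
  shows "\<exists>X. reading m n w k e f X \<and> heads X \<theta>"
proof -
  have n0: "n > 0" using n by simp
  \<comment> \<open>\<open>\<tau> j *\<^sub>R cis \<theta>\<close> is the developed crossing point,
    from which its offset to the midpoint of the edge is subtracted.\<close>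
  define X where "X j = \<tau> j *\<^sub>R cis \<theta> - (p j - midpt m n (k j) (e j))" for j
  have g: "glued m n (k j, f j) (k (j + 1), e (j + 1))" for j
    using t by (simp add: linear_trajectory_def Let_def)
  have p: "p (j + 1) = p j + (\<tau> (j + 1) - \<tau> j) *\<^sub>R cis \<theta> - vertex m n (k j) (f j)
      + vertex m n (k (j + 1)) (Suc (e (j + 1)))" for j
    using t by (simp add: linear_trajectory_def Let_def)
  have "X (j + 1) - X j = midpt m n (k j) (f j) - midpt m n (k j) (e j)" for j
  proof -
    have "midpt m n (k j) (f j) = vertex m n (k j) (f j) + edge_vec m n (k j) (f j) / 2"
      by (simp add: midpt_def vertex_Suc field_simps)
    moreover have "midpt m n (k (j + 1)) (e (j + 1)) =
        vertex m n (k (j + 1)) (Suc (e (j + 1))) - edge_vec m n (k (j + 1)) (e (j + 1)) / 2"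
      by (simp add: midpt_def vertex_Suc field_simps)
    ultimately show ?thesis
      unfolding X_def p edge_vec_glued(1) [OF n0 g] by (simp add: algebra_simps)
  qed
  then have "reading m n w k e f X" using l g by (simp add: reading_def)
  moreover have "norm (X j - \<tau> j *\<^sub>R cis \<theta>) \<le> 1" for j
  proof -
    have "p j \<in> edge_interior m n (k j) (e j)" using t by (simp add: linear_trajectory_def)
    then obtain v where v: "0 < v" "v < 1"
      "p j = (1 - v) *\<^sub>R vertex m n (k j) (e j) + v *\<^sub>R vertex m n (k j) (Suc (e j))"
      unfolding edge_interior_def in_segment by blast
    have "X j - \<tau> j *\<^sub>R cis \<theta> = (1 / 2 - v) *\<^sub>R edge_vec m n (k j) (e j)"
      by (simp add: X_def v(3) midpt_def vertex_Suc algebra_simps scaleR_conv_of_real add_divide_distrib)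
    moreover have "norm (edge_vec m n (k j) (e j)) \<le> 1"
      using edge_vec_glued(3) [OF n0 glued_sym [OF g [of "j - 1"]]] by simp
    then have "\<bar>1 / 2 - v\<bar> * norm (edge_vec m n (k j) (e j)) \<le> 1 * 1"
      using v by (intro mult_mono) auto
    ultimately show ?thesis by simp
  qed
  moreover have "filterlim \<tau> at_top at_top" using t by (simp add: linear_trajectory_def)
  ultimately show ?thesis unfolding heads_def by blast
qed

lemma trajectory_crossing:
  assumes "n \<ge> 2" "linear_trajectory m n \<theta> k e f p \<tau>" "\<theta> \<in> sector n a"
  shows "crossing n a (e j) (f j)"
  using assms(2)
  by (intro crossing_if_crossed [OF assms(1) _ assms(3), of "k j" m "\<tau> (j + 1) - \<tau> j" "p j"])
    (simp_all add: linear_trajectory_def Let_def)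

text \<open>Otherwise \<open>Im (X j * c)\<close> would be unbounded below as \<open>T\<close> tends
  to infinity, although it never decreases.\<close>

lemma heads_Im_nonneg:
  assumes X: "heads X \<theta>" and c: "\<And>j. Im ((X (j + 1) - X j) * c) \<ge> 0"
  shows "Im (cis \<theta> * c) \<ge> 0"
proof (rule ccontr)
  define q where "q = Im (cis \<theta> * c)"
  assume "\<not> Im (cis \<theta> * c) \<ge> 0"
  then have q: "q < 0" by (simp add: q_def)
  obtain T B where T: "filterlim T at_top at_top" and B: "\<And>j. norm (X j - T j *\<^sub>R cis \<theta>) \<le> B"
    using X unfolding heads_def by blast
  \<comment> \<open>For \<open>T j \<ge> Z\<close> the bound \<open>B\<close> forces
    \<open>Im (X j * c)\<close> to be at least 1 below \<open>Im (X 0 * c)\<close>.\<close>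
  define Z where "Z = (Im (X 0 * c) - B * norm c - 1) / q"
  have "eventually (\<lambda>j. Z \<le> T j \<and> 0 \<le> j) at_top"
    using T by (intro eventually_conj eventually_ge_at_top) (simp add: filterlim_at_top)
  then obtain j where j: "Z \<le> T j" "0 \<le> j"
    using eventually_happens' [OF trivial_limit_at_top_linorder] by blast
  have "Im (X 0 * c) \<le> Im (X j * c)"
    using j(2)
  proof (induction j rule: int_ge_induct)
    case (step j)
    then show ?case using c [of j] by (simp add: algebra_simps)
  qed simp
  moreover have "Im (X j * c) \<le> T j * q + B * norm c"
  proof -
    have "Im (X j * c) = T j * q + Im ((X j - T j *\<^sub>R cis \<theta>) * c)"
      by (simp add: q_def algebra_simps)
    moreover have "Im ((X j - T j *\<^sub>R cis \<theta>) * c) \<le> norm ((X j - T j *\<^sub>R cis \<theta>) * c)"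
      using abs_Im_le_cmod abs_le_D1 by blast
    moreover have "norm ((X j - T j *\<^sub>R cis \<theta>) * c) \<le> B * norm c"
      unfolding norm_mult using B by (intro mult_right_mono) auto
    ultimately show ?thesis by linarith
  qed
  moreover have "T j * q \<le> Z * q" using j(1) q by (intro mult_right_mono_neg) auto
  moreover have "Z * q = Im (X 0 * c) - B * norm c - 1" using q by (simp add: Z_def)
  ultimately show False by linarith
qed

lemma heads_in_cone:
  assumes X: "heads X \<theta>" and c: "\<And>j. in_cone n a (X (j + 1) - X j)"
  shows "in_cone n a (cis \<theta>)"
proof -
  have "Im ((X (j + 1) - X j) * - ray n (- int (a + 1))) \<ge> 0" for j
    using c [of j] unfolding in_cone_def by simp
  from heads_Im_nonneg [OF X this] heads_Im_nonneg [OF X, of "ray n (- int a)"] c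
  show ?thesis by (simp add: in_cone_def)
qed

lemma heads_in_opposite_cone:
  assumes X: "heads X \<theta>" and c: "\<And>j. in_cone n a (X j - X (j + 1))"
  shows "in_cone n a (- cis \<theta>)"
proof -
  have "Im ((X (j + 1) - X j) * ray n (- int (a + 1))) \<ge> 0"
    "Im ((X (j + 1) - X j) * - ray n (- int a)) \<ge> 0" for j
    using c [of j] unfolding in_cone_def by (simp_all add: algebra_simps)
  from heads_Im_nonneg [OF X this(1)] heads_Im_nonneg [OF X this(2)]
  show ?thesis by (simp add: in_cone_def)
qed

text \<open>All angles compared lie in [\<pi>/n, \<pi>], an interval shorter than \<pi>, so the sign
  of the sine of a difference is the sign of the difference.\<close>

lemma
  assumes n: "n \<ge> 2" and a: "1 \<le> a" "a \<le> n - 1" and \<theta>: "pi / real n \<le> \<theta>" "\<theta> \<le> pi"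
  shows sector_if_in_cone: "in_cone n a (cis \<theta>) \<Longrightarrow> \<theta> \<in> sector n a"
    and not_in_opposite_cone: "\<not> in_cone n a (- cis \<theta>)"
proof -
  define A where "A = real a * pi / real n"
  define \<phi> where "\<phi> = pi / real n"
  have A: "\<phi> \<le> A" "A + \<phi> \<le> pi" "\<phi> > 0" and eq: "real (a + 1) * pi / real n = A + \<phi>"
  proof -
    have "real (a + 1) * pi \<le> real n * pi" using a n by (intro mult_right_mono of_nat_mono) auto
    then show "\<phi> \<le> A" "A + \<phi> \<le> pi" "\<phi> > 0" "real (a + 1) * pi / real n = A + \<phi>"
      using a n by (simp_all add: A_def \<phi>_def field_simps)
  qed
  have "Im (cis \<theta> * ray n (- int c)) = sin (\<theta> - real c * pi / real n)" for c
    unfolding mult.commute [of "cis \<theta>"] Im_ray_cis by simp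
  from this [of a] this [of "a + 1"]
  have Im: "Im (cis \<theta> * ray n (- int a)) = sin (\<theta> - A)"
    "Im (cis \<theta> * ray n (- int (a + 1))) = sin (\<theta> - (A + \<phi>))"
    unfolding eq A_def .
  have pos: "A \<le> \<theta>" if "sin (\<theta> - A) \<ge> 0"
  proof (rule ccontr)
    assume "\<not> A \<le> \<theta>"
    then have "sin (A - \<theta>) > 0" using A \<theta> by (intro sin_gt_zero) (auto simp: \<phi>_def)
    with that sin_minus [of "A - \<theta>"] show False by simp
  qed
  have neg: "\<theta> \<le> A + \<phi>" if "sin (\<theta> - (A + \<phi>)) \<le> 0"
  proof (rule ccontr)
    assume "\<not> \<theta> \<le> A + \<phi>"
    then have "sin (\<theta> - (A + \<phi>)) > 0" using A \<theta> by (intro sin_gt_zero) (auto simp: \<phi>_def)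
    with that show False by simp
  qed
  show "\<theta> \<in> sector n a" if "in_cone n a (cis \<theta>)"
    using that pos neg unfolding in_cone_def Im sector_def eq by (simp flip: A_def)
  show "\<not> in_cone n a (- cis \<theta>)"
  proof
    assume "in_cone n a (- cis \<theta>)"
    then have *: "sin (\<theta> - A) \<le> 0" "sin (\<theta> - (A + \<phi>)) \<ge> 0"
      unfolding in_cone_def mult_minus_left uminus_complex.sel Im by simp_all
    have "\<theta> \<le> A"
    proof (rule ccontr)
      assume "\<not> \<theta> \<le> A"
      then have "sin (\<theta> - A) > 0" using A \<theta> by (intro sin_gt_zero) (auto simp: \<phi>_def)
      with * show False by simp
    qed
    moreover have "A + \<phi> \<le> \<theta>"
    proof (rule ccontr)
      assume "\<not> A + \<phi> \<le> \<theta>"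
      then have "sin (A + \<phi> - \<theta>) > 0" using A \<theta> by (intro sin_gt_zero) (auto simp: \<phi>_def)
      with * sin_minus [of "A + \<phi> - \<theta>"] show False by simp
    qed
    ultimately show False using A by simp
  qed
qed

section \<open>Recovering the path of an admissible word\<close>

definition entering :: "nat \<Rightarrow> nat \<Rightarrow> nat \<Rightarrow> bool" where
  "entering n a e \<longleftrightarrow> (\<exists>x<n. [int e = int a - int x] (mod 2 * int n))"

lemma crossing_entering: "crossing n a e f \<Longrightarrow> entering n a e"
  unfolding crossing_def entering_def by blast

lemma crossing_opposite_entering:
  assumes "crossing n a e f"
  shows "entering n a (opposite n f)"
proof -
  obtain y where y: "0 < y" "y \<le> n" "[int f = int a + int y] (mod 2 * int n)"
    using assms unfolding crossing_def by blast
  have "[int (opposite n f) = int a + int y + int n] (mod 2 * int n)"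
    using cong_trans [OF opposite_cong cong_add [OF y(3) cong_refl]] .
  also have "[int a + int y + int n = int a - int (n - y)] (mod 2 * int n)"
    using y by (simp add: cong_iff_dvd_diff of_nat_diff)
  finally show ?thesis unfolding entering_def using y by (intro exI [of _ "n - y"]) auto
qed

text \<open>The indices that can be entered form half a turn, and \<open>opposite\<close> takes it
  to the other half.\<close>

lemma not_entering_opposite:
  assumes "entering n a e"
  shows "\<not> entering n a (opposite n e)"
proof
  assume "entering n a (opposite n e)"
  then obtain x' where x': "x' < n" "[int (opposite n e) = int a - int x'] (mod 2 * int n)"
    unfolding entering_def by blast
  obtain x where x: "x < n" "[int e = int a - int x] (mod 2 * int n)"
    using assms unfolding entering_def by blast
  have "[int a - int x + int n = int a - int x'] (mod 2 * int n)"
    using cong_trans [OF cong_sym [OF cong_trans [OF opposite_cong cong_add [OF x(2) cong_refl]]] x'(2)] .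
  then have "int a - int x + int n = int a - int x'"
    using x(1) x'(1) by (intro cong_abs_less_imp_eq) auto
  with x(1) show False by simp
qed

lemma transition_crossing:
  assumes n: "n \<ge> 2" and "transition m n a x y"
  shows "\<exists>k e f k' e'. edge_label m n (k, e) x \<and> crossing n a e f \<and>
    glued m n (k, f) (k', e') \<and> edge_label m n (k', e') y"
proof -
  obtain \<theta> u j where *: "\<theta> \<in> sector n a" "cutting_sequence m n \<theta> u" "u j = x" "u (j + 1) = y"
    using assms(2) unfolding transition_def by blast
  then obtain k e f p \<tau> where t: "linear_trajectory m n \<theta> k e f p \<tau>"
    and l: "\<And>j. edge_label m n (k j, e j) (u j)"
    unfolding cutting_sequence_def by blast
  have "glued m n (k j, f j) (k (j + 1), e (j + 1))"
    using t by (simp add: linear_trajectory_def Let_def)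
  with trajectory_crossing [OF n t *(1), of j] l [of j] l [of "j + 1"] *(3,4) show ?thesis by blast
qed

text \<open>A word determines its trajectory up to crossing all edges from the other side, and a
  trajectory flipped in this way heads into the opposite of the cone of directions.\<close>

lemma admissible_reading:
  assumes n: "n \<ge> 2" and a: "1 \<le> a" "a \<le> n - 1" and \<theta>: "pi / real n \<le> \<theta>" "\<theta> \<le> pi"
    and r: "reading m n u k e f X" and X: "heads X \<theta>" and adm: "admissible m n a u"
  shows "crossing n a (e j) (f j)" "\<theta> \<in> sector n a"
proof -
  have n0: "n > 0" using n by simp
  have r': "edge_label m n (k j, e j) (u j)" "glued m n (k j, f j) (k (j + 1), e (j + 1))"
    "X (j + 1) - X j = midpt m n (k j) (f j) - midpt m n (k j) (e j)" for j
    using r by (auto simp: reading_def)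
  define P where "P j q \<longleftrightarrow> (case q of (c, v, v') \<Rightarrow> edge_label m n (c, v) (u j) \<and> crossing n a v v' \<and>
    (\<exists>k' e'. glued m n (c, v') (k', e') \<and> edge_label m n (k', e') (u (j + 1))))" for j q
  have "\<exists>q. P j q" for j
    using transition_crossing [OF n, of m a "u j" "u (j + 1)"] adm unfolding P_def admissible_def by fast
  then obtain q where q: "\<forall>j. P j (q j)" using choice [of P] by blast
  define c where "c j = fst (q j)" for j
  define v where "v j = fst (snd (q j))" for j
  define v' where "v' j = snd (snd (q j))" for j
  have P: "P j (c j, v j, v' j)" for j using q by (simp add: c_def v_def v'_def)
  have lab: "edge_label m n (c j, v j) (u j)" and cr: "crossing n a (v j) (v' j)" for j
    using P [of j] by (auto simp: P_def)
  \<comment> \<open>The witnesses of successive arrows come from unrelated trajectories. They fit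
    together because only one of two glued sides can be entered in directions of the sector.\<close>
  have gl: "glued m n (c j, v' j) (c (j + 1), v (j + 1))" for j
  proof -
    obtain k' e' where *: "glued m n (c j, v' j) (k', e')" "edge_label m n (k', e') (u (j + 1))"
      using P [of j] by (auto simp: P_def)
    have "\<not> glued m n (c (j + 1), v (j + 1)) (k', e')"
    proof
      assume "glued m n (c (j + 1), v (j + 1)) (k', e')"
      then have "e' = opposite n (v (j + 1))" using n0 by (simp add: glued_iff)
      moreover have "e' = opposite n (v' j)" using *(1) n0 by (simp add: glued_iff)
      ultimately show False
        using crossing_opposite_entering [OF cr [of j]] crossing_entering [OF cr [of "j + 1"]]
          not_entering_opposite by metis
    qed
    with edge_label_same [OF n0 lab [of "j + 1"] *(2)] *(1) show ?thesis by simp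
  qed
  have labf: "edge_label m n (k j, f j) (u (j + 1))" "edge_label m n (c j, v' j) (u (j + 1))" for j
    using edge_label.across [OF r'(1) glued_sym [OF r'(2)], of j]
      edge_label.across [OF lab glued_sym [OF gl], of j] by auto
  \<comment> \<open>Agreement at one position propagates both ways, so the reading agrees with the
    witnesses everywhere or nowhere.\<close>
  define same where "same j \<longleftrightarrow> (k j, e j) = (c j, v j)" for j
  have same_f: "f j = v' j" if "same j" for j
    using edge_label_inj [OF n0, of m "k j" "f j" "u (j + 1)" "v' j"] labf [of j] that
    by (simp add: same_def)
  have up: "same (j + 1)" if "same j" for j
  proof -
    have "(k j, f j) = (c j, v' j)" using same_f [OF that] that by (simp add: same_def)
    with glued_unique [OF n0 r'(2) [of j]] gl [of j] show ?thesis unfolding same_def by simp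
  qed
  have down: "same j" if "same (j + 1)" for j
  proof -
    have "(k j, f j) = (c j, v' j)"
      using glued_unique [OF n0 glued_sym [OF r'(2) [of j]]] glued_sym [OF gl [of j]] that
      unfolding same_def by simp
    then show ?thesis
      using edge_label_inj [OF n0, of m "k j" "e j" "u j" "v j"] r'(1) [of j] lab [of j]
      by (simp add: same_def)
  qed
  have "\<exists>j. same j"
  proof (rule ccontr)
    assume none: "\<nexists>j. same j"
    have opp: "glued m n (c j, v j) (k j, e j)" for j
      using edge_label_same [OF n0 lab [of j] r'(1) [of j]] none by (metis same_def)
    have "glued m n (c j, v' j) (k j, f j)" for j
    proof -
      have "\<not> glued m n (c j, v' j) (k (j + 1), e (j + 1))"
        using glued_unique [OF n0 gl [of j]] none by (metis same_def)
      then have "(c j, v' j) = (k (j + 1), e (j + 1))"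
        using edge_label_same [OF n0 labf(2) [of j] r'(1) [of "j + 1"]] by simp
      with glued_sym [OF r'(2) [of j]] show ?thesis by simp
    qed
    then have f: "f j = opposite n (v' j)" and e: "e j = opposite n (v j)" for j
      using opp [of j] n0 by (simp_all add: glued_iff)
    have "in_cone n a (X j - X (j + 1))" for j
    proof -
      have "k j < m" using glued_bounds [OF n0 r'(2)] by simp
      from flipped_chord_in_cone [OF n this cr [of j] opposite_cong opposite_cong]
      have "in_cone n a (midpt m n (k j) (e j) - midpt m n (k j) (f j))" by (simp add: e f)
      moreover have "X j - X (j + 1) = midpt m n (k j) (e j) - midpt m n (k j) (f j)"
        using r'(3) [of j] by (simp add: algebra_simps)
      ultimately show ?thesis by simp
    qed
    from heads_in_opposite_cone [OF X this] not_in_opposite_cone [OF n a \<theta>] show False by simp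
  qed
  then obtain i where "same i" ..
  then have same: "same j" for j
    by (induction j rule: int_induct [of _ i]) (use up down [of "_ - 1"] in auto)
  then show *: "crossing n a (e j) (f j)" for j
    using cr [of j] same_f [of j] by (simp add: same_def)
  have "in_cone n a (X (j + 1) - X j)" for j
    unfolding r'(3) using glued_bounds [OF n0 r'(2)] by (intro chord_in_cone [OF n _ *]) simp
  from heads_in_cone [OF X this] show "\<theta> \<in> sector n a" by (rule sector_if_in_cone [OF n a \<theta>])
qed

section \<open>Normalization\<close>

lemma phi_add: "phi n a (z + w) = phi n a z + phi n a w"
  and phi_diff: "phi n a (z - w) = phi n a z - phi n a w"
  and phi_scaleR: "phi n a (r *\<^sub>R z) = r *\<^sub>R phi n a z"
  and norm_phi: "norm (phi n a z) = norm z"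
  by (simp_all add: phi_def line_reflection_def algebra_simps norm_mult)

lemma phi_ray:
  assumes "n > 0"
  shows "phi n a (ray n z) = ray n (int a + 1 - z)"
proof -
  have "2 * (real (a + 1) * pi / (2 * real n)) = of_int (int a + 1) * pi / real n"
    using assms by (simp add: field_simps)
  then have "phi n a (ray n z) = ray n (int a + 1) * ray n (- z)"
    unfolding phi_def line_reflection_def ray_minus by (simp only: ray_def)
  then show ?thesis by (simp flip: ray_add)
qed

lemma reflection_less:
  assumes "reflection_automorphism m n a \<sigma> c \<epsilon>" "k < m"
  shows "\<sigma> k < m"
  using assms by (auto simp: reflection_automorphism_def)

lemma reflection_glued:
  assumes "reflection_automorphism m n a \<sigma> c \<epsilon>" "glued m n (k, e) (k', e')"
  shows "glued m n (\<sigma> k, \<epsilon> (k, e)) (\<sigma> k', \<epsilon> (k', e'))"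
  using assms by (simp add: reflection_automorphism_def)

lemma reflection_vertex:
  assumes n: "n > 0" and R: "reflection_automorphism m n a \<sigma> c \<epsilon>" and g: "glued m n (k, e) y"
  shows "\<epsilon> (k, e) < 2 * n"
    "vertex m n (\<sigma> k) (\<epsilon> (k, e)) = phi n a (vertex m n k (Suc e)) + c k"
    "vertex m n (\<sigma> k) (Suc (\<epsilon> (k, e))) = phi n a (vertex m n k e) + c k"
proof -
  obtain k' e' where "y = (k', e')" by fastforce
  then have "edge_vec m n k e \<noteq> 0" using edge_vec_glued(2) [OF n] g by blast
  moreover have "k < m" "e < 2 * n" using glued_bounds [OF n g] by auto
  ultimately show "\<epsilon> (k, e) < 2 * n"
    "vertex m n (\<sigma> k) (\<epsilon> (k, e)) = phi n a (vertex m n k (Suc e)) + c k"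
    "vertex m n (\<sigma> k) (Suc (\<epsilon> (k, e))) = phi n a (vertex m n k e) + c k"
    using R by (auto simp: reflection_automorphism_def)
qed

lemma reflection_midpt:
  assumes n: "n > 0" and R: "reflection_automorphism m n a \<sigma> c \<epsilon>" and g: "glued m n (k, e) y"
  shows "midpt m n (\<sigma> k) (\<epsilon> (k, e)) = phi n a (midpt m n k e) + c k"
proof -
  have half: "midpt m n k e = (1 / 2) *\<^sub>R (vertex m n k e + vertex m n k (Suc e))" for k e
    by (simp add: midpt_def scaleR_conv_of_real)
  show ?thesis
    unfolding half phi_scaleR phi_add reflection_vertex(2,3) [OF n R g]
    by (simp add: scaleR_conv_of_real field_simps)
qed

text \<open>The reflection sends direction \<open>e\<close> to \<open>a + 1 - e\<close>, and it
  reverses the orientation of the boundary, whence the additional \<open>n\<close>. A glued edge has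
  positive length, so its direction can be read off its edge vector.\<close>

lemma reflection_index:
  assumes n: "n > 0" and R: "reflection_automorphism m n a \<sigma> c \<epsilon>" and g: "glued m n (k, e) y"
  shows "[int (\<epsilon> (k, e)) = int a + 1 + int n - int e] (mod 2 * int n)"
proof -
  let ?l = "side_len m k (right_edge n k e)"
  let ?l' = "side_len m (\<sigma> k) (right_edge n (\<sigma> k) (\<epsilon> (k, e)))"
  obtain k' e' where y: "y = (k', e')" by fastforce
  have pos: "?l > 0" using side_len_glued(2) [OF n g [unfolded y]] .
  have "k < m" using glued_bounds [OF n g] by simp
  then have nonneg: "?l' \<ge> 0" using reflection_less [OF R] by (intro side_len_nonneg)
  have "edge_vec m n (\<sigma> k) (\<epsilon> (k, e)) = - phi n a (edge_vec m n k e)"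
    using vertex_Suc [of m n "\<sigma> k" "\<epsilon> (k, e)"] vertex_Suc [of m n k e]
    unfolding reflection_vertex(2,3) [OF n R g] by (simp add: phi_add eq_neg_iff_add_eq_0 algebra_simps)
  also have "\<dots> = ?l *\<^sub>R ray n (int a + 1 - int e + int n)"
    unfolding edge_vec_eq ray_turn [OF n] scaleR_conv_of_real [symmetric] phi_scaleR phi_ray [OF n]
    by simp
  finally have eq: "?l' *\<^sub>R ray n (int (\<epsilon> (k, e))) = ?l *\<^sub>R ray n (int a + 1 - int e + int n)"
    by (simp add: edge_vec_eq scaleR_conv_of_real)
  have "?l' = ?l"
    using arg_cong [OF eq, of norm] pos nonneg by (simp add: ray_def)
  then have "ray n (int (\<epsilon> (k, e))) = ray n (int a + 1 - int e + int n)"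
    using eq pos by simp
  then show ?thesis using n by (simp add: ray_eq_iff algebra_simps)
qed

text \<open>The positions become \<open>n - 1 - x\<close> and \<open>n + 1 - y\<close>, which
  exchanges the inequalities \<open>x \<le> y\<close> and \<open>y \<le> x + 2\<close>.\<close>

lemma reflection_crossing:
  assumes n: "n > 0" and R: "reflection_automorphism m n a \<sigma> c \<epsilon>"
    and g: "glued m n (k, e) y" "glued m n (k, f) y'" and cr: "crossing n a e f"
  shows "crossing n 0 (\<epsilon> (k, e)) (\<epsilon> (k, f))"
proof -
  obtain x y where xy: "x < n" "0 < y" "y \<le> n" "x \<le> y" "y \<le> x + 2"
    "[int e = int a - int x] (mod 2 * int n)" "[int f = int a + int y] (mod 2 * int n)"
    using cr unfolding crossing_def by blast
  have "[int (\<epsilon> (k, e)) = int a + 1 + int n - (int a - int x)] (mod 2 * int n)"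
    by (rule cong_trans [OF reflection_index [OF n R g(1)] cong_diff [OF cong_refl xy(6)]])
  also have "[int a + 1 + int n - (int a - int x) = int 0 - int (n - 1 - x)] (mod 2 * int n)"
    using xy by (simp add: cong_iff_dvd_diff of_nat_diff)
  finally have e: "[int (\<epsilon> (k, e)) = int 0 - int (n - 1 - x)] (mod 2 * int n)" .
  have "[int (\<epsilon> (k, f)) = int a + 1 + int n - (int a + int y)] (mod 2 * int n)"
    by (rule cong_trans [OF reflection_index [OF n R g(2)] cong_diff [OF cong_refl xy(7)]])
  also have "int a + 1 + int n - (int a + int y) = int 0 + int (n + 1 - y)"
    using xy by (simp add: of_nat_diff)
  finally have f: "[int (\<epsilon> (k, f)) = int 0 + int (n + 1 - y)] (mod 2 * int n)" .
  show ?thesis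
    unfolding crossing_def
    by (rule exI [of _ "n - 1 - x"], rule exI [of _ "n + 1 - y"]) (use xy e f in auto)
qed

lemma reflected_grid_path:
  assumes n: "n \<ge> 2" and g: "induced_permutation m n a g" and r: "reading m n u k e f X"
    and X: "heads X \<theta>" and cr: "\<And>j. crossing n a (e j) (f j)"
  shows "\<exists>k' d X'. grid_path m n (g \<circ> u) k' d X' \<and> heads X' (phi_dir n a \<theta>)"
proof -
  have n0: "n > 0" using n by simp
  obtain \<sigma> c \<epsilon> where R: "reflection_automorphism m n a \<sigma> c \<epsilon>"
    and lab: "\<And>k e l. edge_label m n (k, e) l \<Longrightarrow> edge_label m n (\<sigma> k, \<epsilon> (k, e)) (g l)"
    using g unfolding induced_permutation_def by blast
  have r': "edge_label m n (k j, e j) (u j)" "glued m n (k j, f j) (k (j + 1), e (j + 1))"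
    "X (j + 1) - X j = midpt m n (k j) (f j) - midpt m n (k j) (e j)" for j
    using r by (auto simp: reading_def)
  have ge: "\<exists>y. glued m n (k j, e j) y" for j using edge_label_glued [OF n0 r'(1)] .
  have cr': "crossing n 0 (\<epsilon> (k j, e j)) (\<epsilon> (k j, f j))" for j
    using ge [of j] reflection_crossing [OF n0 R _ r'(2) cr] by blast
  have mid: "midpt m n (\<sigma> (k j)) (\<epsilon> (k j, e j)) = phi n a (midpt m n (k j) (e j)) + c (k j)" for j
    using ge [of j] reflection_midpt [OF n0 R] by blast
  have "phi n a (X (j + 1)) - phi n a (X j) =
      midpt m n (\<sigma> (k j)) (\<epsilon> (k j, f j)) - midpt m n (\<sigma> (k j)) (\<epsilon> (k j, e j))" for j
    unfolding mid reflection_midpt [OF n0 R r'(2)] phi_diff [symmetric] r'(3)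
    by (simp add: phi_diff)
  then have "reading m n (g \<circ> u) (\<lambda>j. \<sigma> (k j)) (\<lambda>j. \<epsilon> (k j, e j)) (\<lambda>j. \<epsilon> (k j, f j)) (\<lambda>j. phi n a (X j))"
    unfolding reading_def using lab [OF r'(1)] reflection_glued [OF R r'(2)] by simp
  from grid_path_if_reading [OF n this cr']
  obtain d where "grid_path m n (g \<circ> u) (\<lambda>j. \<sigma> (k j)) d (\<lambda>j. phi n a (X j))" ..
  moreover have "heads (\<lambda>j. phi n a (X j)) (phi_dir n a \<theta>)"
  proof -
    obtain T B where T: "filterlim T at_top at_top" and B: "\<And>j. norm (X j - T j *\<^sub>R cis \<theta>) \<le> B"
      using X unfolding heads_def by blast
    have "norm (phi n a (X j) - T j *\<^sub>R cis (phi_dir n a \<theta>)) \<le> B" for j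
      using B [of j] n0
      by (simp add: norm_phi flip: phi_cis phi_scaleR phi_diff)
    with T show ?thesis unfolding heads_def by blast
  qed
  ultimately show ?thesis by blast
qed

text \<open>A map of polygon edges that respects gluings descends to labels; it is injective by
  \<open>reflection_index\<close>. Existence justifies the choice in \<open>sector_perm\<close>, and
  any choice will do, since \<open>reflected_grid_path\<close> accepts every induced
  permutation.\<close>

lemma induced_permutation_exists:
  assumes n: "n > 0" and R: "reflection_automorphism m n a \<sigma> c \<epsilon>"
  shows "\<exists>g. induced_permutation m n a g"
proof -
  define r where "r x = (\<sigma> (fst x), \<epsilon> x)" for x :: "nat \<times> nat"
  have rg: "glued m n (r x) (r y)" if "glued m n x y" for x y
    using reflection_glued [OF R, of "fst x" "snd x" "fst y" "snd y"] that by (simp add: r_def)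
  have r_inj: "x = x'" if "glued m n x y" "glued m n x' y'" "r x = r x'" for x y x' y'
  proof -
    obtain k e where x: "x = (k, e)" by fastforce
    obtain k' e' where x': "x' = (k', e')" by fastforce
    have b: "k < m" "e < 2 * n" "k' < m" "e' < 2 * n"
      using glued_bounds [OF n] that(1,2) by (auto simp: x x')
    have "\<sigma> k = \<sigma> k'" using that(3) by (simp add: r_def x x')
    moreover have "\<sigma> = (\<lambda>k. k) \<or> \<sigma> = (\<lambda>k. m - 1 - k)"
      using R unfolding reflection_automorphism_def by blast
    ultimately have "k = k'" using b by auto
    moreover have "e = e'"
    proof -
      have "\<epsilon> (k', e') = \<epsilon> (k, e)" using that(3) by (simp add: r_def x x')
      from reflection_index [OF n R that(2) [unfolded x'], unfolded this]
      have "[int a + 1 + int n - int e = int a + 1 + int n - int e'] (mod 2 * int n)"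
        by (rule cong_trans [OF cong_sym [OF reflection_index [OF n R that(1) [unfolded x]]]])
      then have "[int e' = int e] (mod 2 * int n)"
        by (simp add: cong_iff_dvd_diff)
      then have "int e' = int e" using b by (intro cong_abs_less_imp_eq) auto
      then show ?thesis by simp
    qed
    ultimately show ?thesis by (simp add: x x')
  qed
  have ex: "\<exists>l'. edge_label m n (r x) l'" if x: "edge_label m n x l" for x l
  proof -
    obtain y where "glued m n x y" using edge_label_glued [OF n x] by blast
    then obtain l' where "edge_label m n (r x) l'" by (rule glued_edge_label [OF n rg])
    then show ?thesis by blast
  qed
  define Q where "Q l l' \<longleftrightarrow> (\<exists>x. edge_label m n x l \<and> edge_label m n (r x) l')" for l l'
  define g where "g l = (if l \<in> labels m n then SOME l'. Q l l' else l)" for l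
  have g: "edge_label m n (r x) (g l)" if x: "edge_label m n x l" for x l
  proof -
    have "\<exists>l'. Q l l'" using ex [OF x] x unfolding Q_def by blast
    then have "Q l (SOME l'. Q l l')" by (rule someI_ex)
    then have "Q l (g l)" unfolding g_def using edge_label_in_labels [OF n x] by (simp only: if_True)
    then obtain x' where x': "edge_label m n x' l" "edge_label m n (r x') (g l)"
      unfolding Q_def by blast
    have "x = x' \<or> glued m n x' x" using edge_label_same [OF n x'(1) x] by blast
    then show ?thesis using x'(2) edge_label.across [OF x'(2) rg [of x' x]] by auto
  qed
  have g_in: "g l \<in> labels m n" if l: "l \<in> labels m n" for l
  proof -
    obtain x where "edge_label m n x l" using label_has_edge [OF l] .
    then show ?thesis by (rule edge_label_in_labels [OF n g])
  qed
  have inj: "inj_on g (labels m n)"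
  proof
    fix l l' assume l: "l \<in> labels m n" "l' \<in> labels m n" and eq: "g l = g l'"
    obtain x where x: "edge_label m n x l" using label_has_edge [OF l(1)] .
    obtain x' where x': "edge_label m n x' l'" using label_has_edge [OF l(2)] .
    obtain y where y: "glued m n x y" using edge_label_glued [OF n x] by blast
    obtain y' where y': "glued m n x' y'" using edge_label_glued [OF n x'] by blast
    have "r x = r x' \<or> glued m n (r x) (r x')"
      using edge_label_same [OF n g [OF x], of "r x'"] g [OF x'] eq by simp
    then show "l = l'"
    proof
      assume "r x = r x'"
      then have "x = x'" by (rule r_inj [OF y y'])
      then show ?thesis using edge_label_unique [OF n x, of l'] x' by simp
    next
      assume "glued m n (r x) (r x')"
      then have "r y = r x'" using glued_unique [OF n rg [OF y]] by simp
      then have "y = x'" by (rule r_inj [OF glued_sym [OF y] y'])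
      then show ?thesis using edge_label_unique [OF n edge_label.across [OF x y], of l'] x' by simp
    qed
  qed
  have "g ` labels m n = labels m n"
    by (rule endo_inj_surj [OF _ _ inj]) (auto simp: g_in, simp add: labels_def)
  with inj have "bij_betw g (labels m n) (labels m n)" by (simp add: bij_betw_def)
  then have "g permutes labels m n"
    by (rule bij_imp_permutes) (simp add: g_def)
  moreover have "\<forall>k e l. edge_label m n (k, e) l \<longrightarrow> edge_label m n (\<sigma> k, \<epsilon> (k, e)) (g l)"
  proof (intro allI impI)
    fix k e l assume "edge_label m n (k, e) l"
    from g [OF this] show "edge_label m n (\<sigma> k, \<epsilon> (k, e)) (g l)" by (simp add: r_def)
  qed
  ultimately have "induced_permutation m n a g"
    unfolding induced_permutation_def
    by (intro conjI exI [of _ \<sigma>] exI [of _ c] exI [of _ \<epsilon>] R)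
  then show ?thesis by blast
qed

lemma sector_perm_induced:
  assumes "n > 0" "reflections_realized m n" "a < 2 * n"
  shows "induced_permutation m n a (sector_perm m n a)"
proof -
  obtain \<sigma> c \<epsilon> where "reflection_automorphism m n a \<sigma> c \<epsilon>"
    using assms(2,3) unfolding reflections_realized_def by blast
  from someI_ex [OF induced_permutation_exists [OF assms(1) this]]
  show ?thesis unfolding sector_perm_def .
qed

text \<open>Half a step of the Farey map; used for \<open>m n\<close> and then for
  \<open>n m\<close>, it accounts for one pair \<open>(a k, b k)\<close>.\<close>

lemma renormalization_step:
  assumes m: "m \<ge> 2" and n: "n \<ge> 2" and R: "reflections_realized n m" and \<theta>: "\<theta> \<in> sector n 0"
    and w: "\<exists>k d X. grid_path m n w k d X \<and> heads X \<theta>"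
    and der: "is_derivative m n w u" and adm: "admissible n m a u" and a: "a \<in> {1..m - 1}"
  shows "dir_action (gamma_matrix m n) \<theta> \<in> sector m a"
    and "\<exists>k d X. grid_path n m (sector_perm n m a \<circ> u) k d X \<and>
      heads X (phi_dir m a (dir_action (gamma_matrix m n) \<theta>))"
proof -
  let ?\<theta> = "dir_action (gamma_matrix m n) \<theta>"
  obtain k e f X where r: "reading n m u k e f X" and X: "heads X ?\<theta>"
    using derived_reading [OF m n \<theta> _ _ der] w by blast
  have a': "1 \<le> a" "a \<le> m - 1" using a by auto
  have b: "pi / real m \<le> ?\<theta>" "?\<theta> \<le> pi" using scaled_gamma_cis [OF m n \<theta>] by blast+
  have cr: "crossing m a (e j) (f j)" for j
    by (rule admissible_reading(1) [OF m a' b r X adm])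
  show "?\<theta> \<in> sector m a"
    by (rule admissible_reading(2) [OF m a' b r X adm])
  have "a < 2 * m" using a' m by linarith
  then have "induced_permutation n m a (sector_perm n m a)"
    using m by (intro sector_perm_induced R) auto
  from reflected_grid_path [OF m this r X cr]
  show "\<exists>k d X. grid_path n m (sector_perm n m a \<circ> u) k d X \<and> heads X (phi_dir m a ?\<theta>)" .
qed

section \<open>The continued fraction\<close>

lemma phi_dir_in_sector: "n > 0 \<Longrightarrow> \<theta> \<in> sector n a \<Longrightarrow> phi_dir n a \<theta> \<in> sector n 0"
  using phi_dir_sector by blast

text \<open>For \<open>j \<ge> 1\<close> the value at cos (\<pi>/m) of the Chebyshev polynomial of
  the second kind of degree \<open>j - 1\<close>. These are the matrix entries of the inverse
  branches.\<close>

definition sin_ratio :: "nat \<Rightarrow> nat \<Rightarrow> real" where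
  "sin_ratio m j = sin (real j * pi / real m) / sin (pi / real m)"

lemma sin_ratio_nonneg: "m \<ge> 2 \<Longrightarrow> j \<le> m \<Longrightarrow> sin_ratio m j \<ge> 0"
  unfolding sin_ratio_def using sin_pi_pos [of m] by (intro divide_nonneg_pos sin_nat_nonneg)

lemma sin_ratio_ge_1:
  assumes "m \<ge> 2" "1 \<le> j" "j \<le> m - 1"
  shows "sin_ratio m j \<ge> 1"
proof -
  define \<psi> where "\<psi> = pi / real m"
  have "real 1 * \<psi> \<le> real j * \<psi>" "real (j + 1) * \<psi> \<le> real m * \<psi>"
    using assms by (intro mult_right_mono of_nat_mono; simp add: \<psi>_def)+
  then have j: "\<psi> \<le> real j * \<psi>" "real j * \<psi> \<le> pi - \<psi>" and \<psi>: "0 < \<psi>" "\<psi> \<le> pi / 2"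
    using assms by (simp_all add: \<psi>_def field_simps)
  have "sin \<psi> \<le> sin (real j * \<psi>)"
  proof (cases "real j * \<psi> \<le> pi / 2")
    case True
    then show ?thesis using j \<psi> by (intro sin_monotone_2pi_le) auto
  next
    case False
    then have "sin \<psi> \<le> sin (pi - real j * \<psi>)" using j \<psi> by (intro sin_monotone_2pi_le) auto
    then show ?thesis by simp
  qed
  then show ?thesis using sin_pi_pos [OF assms(1)] by (simp add: sin_ratio_def \<psi>_def)
qed

text \<open>Interpolation in the plane spanned by sine and cosine: as functions of \<open>y\<close>,
  both sides agree at \<open>y = 0\<close> and at \<open>y = \<psi>\<close>.\<close>

lemma sin_three_term:
  "sin \<psi> * sin (A - y) = sin A * sin (\<psi> - y) + sin (A - \<psi>) * sin (y :: real)"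
proof -
  have "(cos \<psi>)\<^sup>2 = 1 - (sin \<psi>)\<^sup>2" by (simp add: cos_squared_eq)
  then show ?thesis by (simp add: sin_diff algebra_simps)
qed

text \<open>The determinant of the matrix in \<open>half_branch\<close>; it comes from the product
  formula for sin (x + \<psi>) sin (x - \<psi>).\<close>

lemma sin_ratio_det:
  assumes "m \<ge> 2" "1 \<le> j"
  shows "sin_ratio m j * sin_ratio m j - sin_ratio m (j - 1) * sin_ratio m (j + 1) = 1"
proof -
  define \<psi> where "\<psi> = pi / real m"
  have "sin (x + \<psi>) * sin (x - \<psi>) = sin x * sin x - sin \<psi> * sin \<psi>" for x
  proof -
    have "sin (x + \<psi>) * sin (x - \<psi>) = (sin x)\<^sup>2 * (cos \<psi>)\<^sup>2 - (cos x)\<^sup>2 * (sin \<psi>)\<^sup>2"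
      by (simp add: sin_add sin_diff algebra_simps power2_eq_square)
    also have "\<dots> = (sin x)\<^sup>2 - (sin \<psi>)\<^sup>2"
      by (simp add: cos_squared_eq algebra_simps)
    finally show ?thesis by (simp add: power2_eq_square)
  qed
  from this [of "real j * \<psi>"]
  have "sin (real j * \<psi>) * sin (real j * \<psi>) - sin (real (j - 1) * \<psi>) * sin (real (j + 1) * \<psi>) = sin \<psi> * sin \<psi>"
    using assms(2) by (simp add: of_nat_diff algebra_simps)
  moreover have "sin \<psi> > 0" using sin_pi_pos [OF assms(1)] by (simp add: \<psi>_def)
  moreover have "sin_ratio m i = sin (real i * \<psi>) / sin \<psi>" for i by (simp add: sin_ratio_def \<psi>_def)
  ultimately show ?thesis by (simp add: diff_divide_distrib [symmetric])
qed

text \<open>\<open>sin x\<close> and \<open>sin (pi / real n - x)\<close> are the imaginary parts of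
  \<open>scaled_gamma m n (cis x)\<close> and of its turn by - \<pi>/m. Hence they are proportional
  to the sines of (j + 1) \<pi>/m - y and j \<pi>/m - y, which \<open>sin_three_term\<close> expands
  in the coordinates of \<open>y\<close>.\<close>

lemma half_branch:
  assumes m: "m \<ge> 2" and n: "n \<ge> 2" and j: "1 \<le> j" and x: "x \<in> sector n 0"
  defines "y \<equiv> phi_dir m j (dir_action (gamma_matrix m n) x)"
  shows "\<exists>\<rho>\<ge>0. sin (pi / real n - x) =
      \<rho> * (sin_ratio m j * sin (pi / real m - y) + sin_ratio m (j - 1) * sin y) \<and>
    sin x = \<rho> * (sin_ratio m (j + 1) * sin (pi / real m - y) + sin_ratio m j * sin y)"
proof -
  define \<psi> where "\<psi> = pi / real m"
  have s: "sin \<psi> > 0" "sin (pi / real n) > 0" using sin_pi_pos m n by (auto simp: \<psi>_def)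
  obtain \<rho> where \<rho>: "\<rho> > 0" "scaled_gamma m n (cis x) = \<rho> *\<^sub>R cis (dir_action (gamma_matrix m n) x)"
    using scaled_gamma_cis [OF m n x] by blast
  have dir: "dir_action (gamma_matrix m n) x = real (j + 1) * \<psi> - y"
    by (simp add: y_def phi_dir_def \<psi>_def)
  have "sin x = \<rho> * sin (real (j + 1) * \<psi> - y)"
    using arg_cong [OF \<rho>(2), of Im] unfolding dir by (simp add: scaled_gamma_def)
  moreover have "sin (pi / real n - x) = \<rho> * sin (real j * \<psi> - y)"
  proof -
    have "sin (pi / real n - x) = Im (scaled_gamma m n (cis x) * cis (- \<psi>))"
      using s by (simp add: scaled_gamma_def \<psi>_def sin_diff field_simps)
    also have "\<dots> = \<rho> * sin (real (j + 1) * \<psi> - y - \<psi>)"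
      unfolding \<rho>(2) dir by (simp add: cis_mult)
    finally show ?thesis by (simp add: algebra_simps)
  qed
  moreover have three: "sin (real (i + 1) * \<psi> - y) = sin_ratio m (i + 1) * sin (\<psi> - y) + sin_ratio m i * sin y" for i
  proof -
    have "sin \<psi> * sin (real (i + 1) * \<psi> - y) = sin (real (i + 1) * \<psi>) * sin (\<psi> - y) + sin (real i * \<psi>) * sin y"
      using sin_three_term [of \<psi> "real (i + 1) * \<psi>" y] by (simp add: algebra_simps)
    moreover have ratio: "sin_ratio m l = sin (real l * \<psi>) / sin \<psi>" for l
      by (simp add: sin_ratio_def \<psi>_def)
    ultimately show ?thesis unfolding ratio using s by (simp add: field_simps)
  qed
  moreover have "sin (real j * \<psi> - y) = sin_ratio m j * sin (\<psi> - y) + sin_ratio m (j - 1) * sin y"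
    using three [of "j - 1"] j by simp
  ultimately show ?thesis using \<rho>(1) unfolding \<psi>_def [symmetric] by (intro exI [of _ \<rho>]) simp
qed

text \<open>The matrix has rows \<open>p q\<close> and \<open>r s\<close>. The identity, with column
  sums 1 and 1, is the case \<open>N = 0\<close>, whence the constant 2.\<close>

definition expanding :: "nat \<Rightarrow> real \<Rightarrow> real \<Rightarrow> real \<Rightarrow> real \<Rightarrow> bool" where
  "expanding N p q r s \<longleftrightarrow> p \<ge> 0 \<and> q \<ge> 0 \<and> r \<ge> 0 \<and> s \<ge> 0 \<and> p * s - q * r = 1 \<and>
     p + r \<ge> 1 \<and> q + s \<ge> 1 \<and> real N + 2 \<le> (p + r) + (q + s)"

text \<open>The matrix is multiplied on the right by that of a half branch. For
  \<open>m \<ge> 3\<close> one of \<open>j - 1\<close> and \<open>j + 1\<close> lies in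
  \<open>{1..m - 1}\<close>, so an off-diagonal entry is at least 1 and the column sums gain at
  least 1 in total; for \<open>m = 2\<close> the factor is the identity.\<close>

lemma expanding_step:
  assumes m: "m \<ge> 2" and j: "j \<in> {1..m - 1}" and e: "expanding N p q r s"
  defines "u \<equiv> sin_ratio m"
  shows "expanding (if m \<ge> 3 then N + 1 else N)
    (p * u j + q * u (j + 1)) (p * u (j - 1) + q * u j) (r * u j + s * u (j + 1)) (r * u (j - 1) + s * u j)"
proof -
  have e': "p \<ge> 0" "q \<ge> 0" "r \<ge> 0" "s \<ge> 0" "p * s - q * r = 1"
     "p + r \<ge> 1" "q + s \<ge> 1" "real N + 2 \<le> (p + r) + (q + s)"
    using e by (simp_all add: expanding_def)
  define L M where "L = p + r" and "M = q + s"
  have LM: "L \<ge> 1" "M \<ge> 1" "real N + 2 \<le> L + M" using e' by (simp_all add: L_def M_def)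
  have u: "u (j - 1) \<ge> 0" "u j \<ge> 1" "u (j + 1) \<ge> 0"
    using m j by (auto simp: u_def intro!: sin_ratio_nonneg sin_ratio_ge_1)
  have det: "u j * u j - u (j - 1) * u (j + 1) = 1"
    using sin_ratio_det [OF m] j by (simp add: u_def)
  have "(p * u j + q * u (j + 1)) * (r * u (j - 1) + s * u j) -
      (p * u (j - 1) + q * u j) * (r * u j + s * u (j + 1)) =
    (p * s - q * r) * (u j * u j - u (j - 1) * u (j + 1))"
    by (simp add: algebra_simps)
  then have det': "(p * u j + q * u (j + 1)) * (r * u (j - 1) + s * u j) -
      (p * u (j - 1) + q * u j) * (r * u j + s * u (j + 1)) = 1"
    using e' det by simp
  have LL: "L \<le> L * u j" "M \<le> M * u j" "0 \<le> M * u (j + 1)" "0 \<le> L * u (j - 1)"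
    using u LM by simp_all
  have grow: "M * u (j + 1) \<ge> 1 \<or> L * u (j - 1) \<ge> 1" if "m \<ge> 3"
  proof (cases "j \<le> m - 2")
    case True
    then have "u (j + 1) \<ge> 1" using m that j unfolding u_def by (intro sin_ratio_ge_1) auto
    then have "1 * 1 \<le> M * u (j + 1)" using LM by (intro mult_mono) auto
    then show ?thesis by simp
  next
    case False
    then have "u (j - 1) \<ge> 1" using m that j unfolding u_def by (intro sin_ratio_ge_1) auto
    then have "1 * 1 \<le> L * u (j - 1)" using LM by (intro mult_mono) auto
    then show ?thesis by simp
  qed
  have sums: "(p * u j + q * u (j + 1)) + (r * u j + s * u (j + 1)) = L * u j + M * u (j + 1)"
    "(p * u (j - 1) + q * u j) + (r * u (j - 1) + s * u j) = L * u (j - 1) + M * u j"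
    by (simp_all add: L_def M_def algebra_simps)
  have "1 \<le> L * u j + M * u (j + 1)" "1 \<le> L * u (j - 1) + M * u j"
    using LL LM by linarith+
  moreover have "real (if m \<ge> 3 then N + 1 else N) + 2 \<le>
      L * u j + M * u (j + 1) + (L * u (j - 1) + M * u j)"
  proof (cases "m \<ge> 3")
    case True
    then have "real (if m \<ge> 3 then N + 1 else N) = real N + 1" by simp
    then show ?thesis using grow [OF True] LL LM by linarith
  next
    case False
    then have "real (if m \<ge> 3 then N + 1 else N) = real N" by simp
    then show ?thesis using LL LM by linarith
  qed
  ultimately show ?thesis
    unfolding expanding_def sums det' using e'(1-4) u by simp
qed

lemma expanding_mono: "expanding N p q r s \<Longrightarrow> N' \<le> N \<Longrightarrow> expanding N' p q r s"
  by (auto simp: expanding_def)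

lemma branch_preimage_subset: "branch_preimage m n i j S \<subseteq> sector n 0"
  by (auto simp: branch_preimage_def branch_domain_def)

text \<open>Since \<open>m * n \<ge> 6\<close>, one of \<open>m\<close> and \<open>n\<close> is at
  least 3, so one of the two half branches gains 1. The factor \<open>\<rho>\<close> is carried
  along because the matrices act on coordinates only up to a multiple.\<close>

lemma branch_cone_map:
  assumes m: "m \<ge> 2" and n: "n \<ge> 2" and mn: "m * n \<ge> 6"
    and i: "i \<in> {1..m - 1}" and j: "j \<in> {1..n - 1}" and e: "expanding N p q r s"
  shows "\<exists>p' q' r' s'. expanding (N + 1) p' q' r' s' \<and>
    (\<forall>S x \<rho>. x \<in> branch_preimage m n i j S \<longrightarrow> \<rho> \<ge> 0 \<longrightarrow>
      (\<exists>y\<in>S. \<exists>\<rho>'\<ge>0.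
        \<rho> * (p * sin (pi / real n - x) + q * sin x) = \<rho>' * (p' * sin (pi / real n - y) + q' * sin y) \<and>
        \<rho> * (r * sin (pi / real n - x) + s * sin x) = \<rho>' * (r' * sin (pi / real n - y) + s' * sin y)))"
proof -
  let ?u = "sin_ratio m" and ?v = "sin_ratio n"
  obtain p1 q1 r1 s1 where d1: "p1 = p * ?u i + q * ?u (i + 1)" "q1 = p * ?u (i - 1) + q * ?u i"
    "r1 = r * ?u i + s * ?u (i + 1)" "s1 = r * ?u (i - 1) + s * ?u i" by blast
  obtain p' q' r' s' where d': "p' = p1 * ?v j + q1 * ?v (j + 1)" "q' = p1 * ?v (j - 1) + q1 * ?v j"
    "r' = r1 * ?v j + s1 * ?v (j + 1)" "s' = r1 * ?v (j - 1) + s1 * ?v j" by blast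
  have "m \<ge> 3 \<or> n \<ge> 3"
  proof (rule ccontr)
    assume "\<not> (m \<ge> 3 \<or> n \<ge> 3)"
    then have "m * n \<le> 2 * 2" by (intro mult_le_mono) auto
    with mn show False by simp
  qed
  moreover have "expanding (if n \<ge> 3 then (if m \<ge> 3 then N + 1 else N) + 1 else (if m \<ge> 3 then N + 1 else N)) p' q' r' s'"
    using expanding_step [OF n j expanding_step [OF m i e]] unfolding d' d1 .
  ultimately have e': "expanding (N + 1) p' q' r' s'"
    by (elim expanding_mono) auto
  have "\<exists>y\<in>S. \<exists>\<rho>'\<ge>0.
        \<rho> * (p * sin (pi / real n - x) + q * sin x) = \<rho>' * (p' * sin (pi / real n - y) + q' * sin y) \<and>
        \<rho> * (r * sin (pi / real n - x) + s * sin x) = \<rho>' * (r' * sin (pi / real n - y) + s' * sin y)"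
    if x: "x \<in> branch_preimage m n i j S" and \<rho>: "\<rho> \<ge> 0" for S x \<rho>
  proof -
    have xS: "x \<in> sector n 0" "dir_action (gamma_matrix m n) x \<in> sector m i" "farey_branch m n i j x \<in> S"
      using x by (auto simp: branch_preimage_def branch_domain_def)
    define z where "z = phi_dir m i (dir_action (gamma_matrix m n) x)"
    define y where "y = phi_dir n j (dir_action (gamma_matrix n m) z)"
    have y: "y \<in> S" using xS(3) by (simp add: farey_branch_def y_def z_def)
    have z: "z \<in> sector m 0" unfolding z_def using m xS by (intro phi_dir_in_sector) auto
    obtain \<rho>1 where \<rho>1: "\<rho>1 \<ge> 0"
      "sin (pi / real n - x) = \<rho>1 * (?u i * sin (pi / real m - z) + ?u (i - 1) * sin z)"
      "sin x = \<rho>1 * (?u (i + 1) * sin (pi / real m - z) + ?u i * sin z)"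
      using half_branch [OF m n _ xS(1), of i] i unfolding z_def by auto
    obtain \<rho>2 where \<rho>2: "\<rho>2 \<ge> 0"
      "sin (pi / real m - z) = \<rho>2 * (?v j * sin (pi / real n - y) + ?v (j - 1) * sin y)"
      "sin z = \<rho>2 * (?v (j + 1) * sin (pi / real n - y) + ?v j * sin y)"
      using half_branch [OF n m _ z, of j] j unfolding y_def by auto
    show ?thesis
    proof (intro bexI [OF _ y] exI [of _ "\<rho> * \<rho>1 * \<rho>2"] conjI)
      show "0 \<le> \<rho> * \<rho>1 * \<rho>2" using \<rho> \<rho>1 \<rho>2 by simp
      show "\<rho> * (p * sin (pi / real n - x) + q * sin x) =
        \<rho> * \<rho>1 * \<rho>2 * (p' * sin (pi / real n - y) + q' * sin y)"
        unfolding \<rho>1 \<rho>2 d' d1 by (simp add: algebra_simps)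
      show "\<rho> * (r * sin (pi / real n - x) + s * sin x) =
        \<rho> * \<rho>1 * \<rho>2 * (r' * sin (pi / real n - y) + s' * sin y)"
        unfolding \<rho>1 \<rho>2 d' d1 by (simp add: algebra_simps)
    qed
  qed
  with e' show ?thesis by blast
qed

text \<open>The first branch is outermost, hence reverse induction with arbitrary \<open>S\<close>:
  appending a branch multiplies the matrix on the right and replaces \<open>S\<close> by its
  preimage.\<close>

lemma cylinder_cone_map:
  assumes m: "m \<ge> 2" and n: "n \<ge> 2" and mn: "m * n \<ge> 6"
    and ab: "\<forall>j\<in>set js. a j \<in> {1..m - 1} \<and> b j \<in> {1..n - 1}"
  shows "\<exists>p q r s. expanding (length js) p q r s \<and>
    (\<forall>S x. x \<in> foldr (\<lambda>j. branch_preimage m n (a j) (b j)) js S \<longrightarrow>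
      (\<exists>y\<in>S. \<exists>\<rho>\<ge>0. sin (pi / real n - x) = \<rho> * (p * sin (pi / real n - y) + q * sin y) \<and>
        sin x = \<rho> * (r * sin (pi / real n - y) + s * sin y)))"
  using ab
proof (induction js rule: rev_induct)
  case Nil
  show ?case
    by (rule exI [of _ 1], rule exI [of _ 0], rule exI [of _ 0], rule exI [of _ 1])
      (auto simp: expanding_def intro!: exI [of _ 1])
next
  case (snoc j js)
  let ?F = "foldr (\<lambda>j. branch_preimage m n (a j) (b j))"
  obtain p q r s where e: "expanding (length js) p q r s"
    and F: "\<And>S x. x \<in> ?F js S \<Longrightarrow>
      (\<exists>y\<in>S. \<exists>\<rho>\<ge>0. sin (pi / real n - x) = \<rho> * (p * sin (pi / real n - y) + q * sin y) \<and>
        sin x = \<rho> * (r * sin (pi / real n - y) + s * sin y))"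
    using snoc by auto
  obtain p' q' r' s' where e': "expanding (length js + 1) p' q' r' s'"
    and G: "\<And>S x \<rho>. x \<in> branch_preimage m n (a j) (b j) S \<Longrightarrow> \<rho> \<ge> 0 \<Longrightarrow>
      (\<exists>y\<in>S. \<exists>\<rho>'\<ge>0.
        \<rho> * (p * sin (pi / real n - x) + q * sin x) = \<rho>' * (p' * sin (pi / real n - y) + q' * sin y) \<and>
        \<rho> * (r * sin (pi / real n - x) + s * sin x) = \<rho>' * (r' * sin (pi / real n - y) + s' * sin y))"
    using branch_cone_map [OF m n mn _ _ e, of "a j" "b j"] snoc.prems by auto
  have "\<exists>y\<in>S. \<exists>\<rho>\<ge>0. sin (pi / real n - x) = \<rho> * (p' * sin (pi / real n - y) + q' * sin y) \<and>
        sin x = \<rho> * (r' * sin (pi / real n - y) + s' * sin y)" if x: "x \<in> ?F (js @ [j]) S" for S x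
  proof -
    have "x \<in> ?F js (branch_preimage m n (a j) (b j) S)" using x by simp
    from F [OF this] obtain z \<rho> where z: "z \<in> branch_preimage m n (a j) (b j) S" "\<rho> \<ge> 0"
      "sin (pi / real n - x) = \<rho> * (p * sin (pi / real n - z) + q * sin z)"
      "sin x = \<rho> * (r * sin (pi / real n - z) + s * sin z)" by blast
    from G [OF z(1,2)] show ?thesis unfolding z(3,4) .
  qed
  with e' show ?case by (intro exI [of _ p'] exI [of _ q'] exI [of _ r'] exI [of _ s']) simp
qed

lemma cf_cylinder_subset: "cf_cylinder m n a b k \<subseteq> sector n 0"
  by (cases k) (simp_all add: cf_cylinder_def branch_preimage_subset upt_conv_Cons del: upt_Suc)

text \<open>In the cone coordinates \<open>(sin (\<pi>/n - x), sin x)\<close> the inverse branches act by nonnegative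
  matrices of determinant 1 whose column sums grow, so the image cones shrink to a ray.\<close>

lemma cf_cylinder_unique:
  assumes m: "m \<ge> 2" and n: "n \<ge> 2" and mn: "m * n \<ge> 6"
    and ab: "\<forall>k\<ge>1. a k \<in> {1..m - 1} \<and> b k \<in> {1..n - 1}"
    and x: "\<And>k. k \<ge> 1 \<Longrightarrow> x \<in> cf_cylinder m n a b k" and x': "\<And>k. k \<ge> 1 \<Longrightarrow> x' \<in> cf_cylinder m n a b k"
  shows "x = x'"
proof -
  define \<phi> where "\<phi> = pi / real n"
  have \<phi>: "sin \<phi> > 0" "\<phi> < pi" using sin_pi_pos [OF n] n by (simp_all add: \<phi>_def field_simps)
  have bound: "\<bar>sin \<phi> * sin (x' - x)\<bar> \<le> 4 / real (k + 1)" if k: "k \<ge> 1" for k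
  proof -
    obtain p q r s where e: "expanding k p q r s"
      and F: "\<And>z. z \<in> cf_cylinder m n a b k \<Longrightarrow>
      (\<exists>y\<in>sector n 0. \<exists>\<rho>\<ge>0. sin (\<phi> - z) = \<rho> * (p * sin (\<phi> - y) + q * sin y) \<and>
        sin z = \<rho> * (r * sin (\<phi> - y) + s * sin y))"
    proof -
      have "\<forall>j\<in>set [1..<k + 1]. a j \<in> {1..m - 1} \<and> b j \<in> {1..n - 1}"
      proof
        fix j assume "j \<in> set [1..<k + 1]"
        then have "j \<ge> 1" by auto
        then show "a j \<in> {1..m - 1} \<and> b j \<in> {1..n - 1}" using ab by blast
      qed
      from cylinder_cone_map [OF m n mn this] obtain p q r s where
        e: "expanding (length [1..<k + 1]) p q r s" and
        F: "\<forall>S z. z \<in> foldr (\<lambda>j. branch_preimage m n (a j) (b j)) [1..<k + 1] S \<longrightarrow>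
          (\<exists>y\<in>S. \<exists>\<rho>\<ge>0. sin (\<phi> - z) = \<rho> * (p * sin (\<phi> - y) + q * sin y) \<and>
            sin z = \<rho> * (r * sin (\<phi> - y) + s * sin y))"
        unfolding \<phi>_def by blast
      have "expanding k p q r s" using e unfolding length_upt by simp
      then show thesis
        by (rule that) (use F [rule_format, of _ "sector n 0"] in \<open>simp only: cf_cylinder_def\<close>)
    qed
    have e': "p * s - q * r = 1" "p + r \<ge> 1" "q + s \<ge> 1" "real k + 2 \<le> (p + r) + (q + s)"
      using e by (simp_all add: expanding_def)
    have coords: "\<exists>\<alpha> \<beta>. 0 \<le> \<alpha> \<and> 0 \<le> \<beta> \<and> sin (\<phi> - z) = p * \<alpha> + q * \<beta> \<and> sin z = r * \<alpha> + s * \<beta> \<and>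
        \<alpha> \<le> 2 / (p + r) \<and> \<beta> \<le> 2 / (q + s)" if z: "z \<in> cf_cylinder m n a b k" for z
    proof -
      obtain y \<rho> where y: "y \<in> sector n 0" "\<rho> \<ge> 0" "sin (\<phi> - z) = \<rho> * (p * sin (\<phi> - y) + q * sin y)"
        "sin z = \<rho> * (r * sin (\<phi> - y) + s * sin y)"
        using F [OF z] by blast
      have "0 \<le> y" "y \<le> \<phi>" using y(1) by (auto simp: sector_def \<phi>_def)
      then have s0: "0 \<le> sin y" "0 \<le> sin (\<phi> - y)" using \<phi> by (auto intro!: sin_ge_zero)
      define \<alpha> \<beta> where "\<alpha> = \<rho> * sin (\<phi> - y)" and "\<beta> = \<rho> * sin y"
      have nn: "0 \<le> \<alpha>" "0 \<le> \<beta>" using s0 y(2) by (simp_all add: \<alpha>_def \<beta>_def)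
      have eq: "sin (\<phi> - z) = p * \<alpha> + q * \<beta>" "sin z = r * \<alpha> + s * \<beta>"
        unfolding y(3,4) by (simp_all add: \<alpha>_def \<beta>_def algebra_simps)
      \<comment> \<open>Adding the two coordinates of \<open>z\<close> weights
        \<open>\<alpha>\<close> and \<open>\<beta>\<close> with the column sums, and two sines add
        up to at most 2.\<close>
      have "\<alpha> * (p + r) + \<beta> * (q + s) = sin (\<phi> - z) + sin z"
        unfolding eq by (simp add: algebra_simps)
      also have "\<dots> \<le> 2" using sin_le_one [of "\<phi> - z"] sin_le_one [of z] by linarith
      finally have "\<alpha> * (p + r) + \<beta> * (q + s) \<le> 2" .
      moreover have "0 \<le> \<alpha> * (p + r)" "0 \<le> \<beta> * (q + s)" using nn e' by simp_all
      ultimately have "\<alpha> \<le> 2 / (p + r)" "\<beta> \<le> 2 / (q + s)"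
        using e' by (simp_all add: pos_le_divide_eq)
      with nn eq show ?thesis by blast
    qed
    obtain \<alpha> \<beta> where 1: "0 \<le> \<alpha>" "0 \<le> \<beta>" "sin (\<phi> - x) = p * \<alpha> + q * \<beta>" "sin x = r * \<alpha> + s * \<beta>"
        "\<alpha> \<le> 2 / (p + r)" "\<beta> \<le> 2 / (q + s)" using coords [OF x [OF k]] by blast
    obtain \<alpha>' \<beta>' where 2: "0 \<le> \<alpha>'" "0 \<le> \<beta>'" "sin (\<phi> - x') = p * \<alpha>' + q * \<beta>'" "sin x' = r * \<alpha>' + s * \<beta>'"
        "\<alpha>' \<le> 2 / (p + r)" "\<beta>' \<le> 2 / (q + s)" using coords [OF x' [OF k]] by blast
    \<comment> \<open>The determinant of the coordinate vectors of \<open>x\<close> and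
      \<open>x'\<close>; as the cylinder matrix has determinant 1, it can be computed from the
      coefficients.\<close>
    have "sin \<phi> * sin (x' - x) = sin (\<phi> - x) * sin x' - sin (\<phi> - x') * sin x"
      by (simp add: sin_diff algebra_simps)
    also have "\<dots> = (p * s - q * r) * (\<alpha> * \<beta>' - \<alpha>' * \<beta>)"
      unfolding 1(3,4) 2(3,4) by (simp add: algebra_simps)
    finally have eq: "sin \<phi> * sin (x' - x) = \<alpha> * \<beta>' - \<alpha>' * \<beta>" by (simp add: e')
    define c where "c = 2 / (p + r) * (2 / (q + s))"
    have "\<alpha> * \<beta>' \<le> c" "\<alpha>' * \<beta> \<le> c"
      unfolding c_def using 1 2 e' by (intro mult_mono; simp)+
    moreover have "0 \<le> \<alpha> * \<beta>'" "0 \<le> \<alpha>' * \<beta>" using 1 2 by simp_all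
    ultimately have "\<bar>sin \<phi> * sin (x' - x)\<bar> \<le> c" unfolding eq by linarith
    also have "c \<le> 4 / real (k + 1)"
    proof -
      \<comment> \<open>The product of two numbers that are at least 1 is at least their sum minus
        1, here at least \<open>k + 1\<close>.\<close>
      have "0 \<le> (p + r - 1) * (q + s - 1)" using e' by simp
      then have "real (k + 1) \<le> (p + r) * (q + s)" using e' by (simp add: algebra_simps)
      then have "4 / ((p + r) * (q + s)) \<le> 4 / real (k + 1)" by (intro divide_left_mono) auto
      then show ?thesis by (simp add: c_def)
    qed
    finally show ?thesis .
  qed
  have "sin \<phi> * sin (x' - x) = 0"
  proof (rule ccontr)
    assume "sin \<phi> * sin (x' - x) \<noteq> 0"
    then have pos: "\<bar>sin \<phi> * sin (x' - x)\<bar> > 0" by simp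
    obtain k :: nat where k: "4 / \<bar>sin \<phi> * sin (x' - x)\<bar> < real k" using reals_Archimedean2 by blast
    then have "4 < real k * \<bar>sin \<phi> * sin (x' - x)\<bar>" using pos by (simp add: pos_divide_less_eq)
    moreover have "k \<ge> 1" using k pos by (cases k) (auto simp: divide_less_0_iff not_less)
    from bound [OF this] have "\<bar>sin \<phi> * sin (x' - x)\<bar> * real (k + 1) \<le> 4"
      by (simp add: pos_le_divide_eq del: of_nat_add)
    ultimately show False using pos by (simp add: algebra_simps)
  qed
  then have "sin (x' - x) = 0" using \<phi> by simp
  moreover have "x \<in> sector n 0" "x' \<in> sector n 0"
    using x [of 1] x' [of 1] cf_cylinder_subset by blast+
  then have "\<bar>x' - x\<bar> < pi" using \<phi>(2) by (auto simp: sector_def \<phi>_def)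
  ultimately have "x' - x = 0" using sin_eq_0_pi [of "x' - x"] by auto
  then show ?thesis by simp
qed

lemma cf_cylinder_orbit:
  assumes "\<And>i. x i \<in> branch_domain m n (a (i + 1)) (b (i + 1))"
    and "\<And>i. x (i + 1) = farey_branch m n (a (i + 1)) (b (i + 1)) (x i)"
    and "x k \<in> sector n 0"
  shows "x 0 \<in> cf_cylinder m n a b k"
proof -
  have "x 0 \<in> foldr (\<lambda>j. branch_preimage m n (a j) (b j)) [1..<k + 1] S" if "x k \<in> S" for S
    using that
  proof (induction k arbitrary: S)
    case (Suc k)
    have "x k \<in> branch_preimage m n (a (k + 1)) (b (k + 1)) S"
      using Suc.prems assms(1,2) [of k] by (simp add: branch_preimage_def)
    from Suc.IH [OF this] show ?case by simp
  qed simp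
  with assms(3) show ?thesis by (simp add: cf_cylinder_def)
qed

theorem proposition8p6:
  fixes m n b0 :: nat and \<theta> :: real and w :: "int \<Rightarrow> nat" and a b :: "nat \<Rightarrow> nat"
  assumes "m \<ge> 2" and "n \<ge> 2" and "m * n \<ge> 6"
    and "reflections_realized m n" and "reflections_realized n m"
    and "\<theta> \<in> {0..2 * pi}"
    and "cutting_sequence m n \<theta> w" and "\<not> periodic_word w"
    and "b0 \<le> 2 * n - 1" and "\<theta> \<in> sector n b0"
    and "admissible_sectors m n b0 w a b"
  shows "\<theta> = cf_value m n b0 a b"
proof -
  note m = \<open>m \<ge> 2\<close> and n = \<open>n \<ge> 2\<close>
  obtain W where ab: "\<forall>k\<ge>1. a k \<in> {1..m - 1} \<and> b k \<in> {1..n - 1}"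
    and W1: "is_derivative m n (sector_perm m n b0 \<circ> w) (W 1)"
    and W: "\<forall>k\<ge>1. admissible n m (a k) (W (2 * k - 1)) \<and>
               is_derivative n m (sector_perm n m (a k) \<circ> W (2 * k - 1)) (W (2 * k)) \<and>
               admissible m n (b k) (W (2 * k)) \<and>
               is_derivative m n (sector_perm m n (b k) \<circ> W (2 * k)) (W (2 * k + 1))"
    using \<open>admissible_sectors m n b0 w a b\<close> unfolding admissible_sectors_def by blast
  define v where "v k = (if k = 0 then sector_perm m n b0 \<circ> w else sector_perm m n (b k) \<circ> W (2 * k))" for k
  \<comment> \<open>The orbit follows the branches named by \<open>a\<close> and \<open>b\<close>:
    at a common end of two sectors the recorded one decides.\<close>
  define x where "x = rec_nat (phi_dir n b0 \<theta>) (\<lambda>k. farey_branch m n (a (k + 1)) (b (k + 1)))"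
  have x0: "x 0 = phi_dir n b0 \<theta>" and x_step: "x (k + 1) = farey_branch m n (a (k + 1)) (b (k + 1)) (x k)" for k
    by (simp_all add: x_def)
  define I where "I k \<longleftrightarrow> x k \<in> sector n 0 \<and> (\<exists>K d X. grid_path m n (v k) K d X \<and> heads X (x k))" for k
  have "I 0"
  proof -
    obtain k e f p \<tau> where t: "linear_trajectory m n \<theta> k e f p \<tau>"
      and l: "\<And>j. edge_label m n (k j, e j) (w j)"
      using \<open>cutting_sequence m n \<theta> w\<close> unfolding cutting_sequence_def by blast
    obtain X where X: "reading m n w k e f X" "heads X \<theta>"
      using trajectory_reading [OF n t l] by blast
    have "induced_permutation m n b0 (sector_perm m n b0)"
      using n \<open>b0 \<le> 2 * n - 1\<close> by (intro sector_perm_induced \<open>reflections_realized m n\<close>) auto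
    from reflected_grid_path [OF n this X trajectory_crossing [OF n t \<open>\<theta> \<in> sector n b0\<close>]]
    show ?thesis
      using phi_dir_in_sector [of n \<theta> b0] n \<open>\<theta> \<in> sector n b0\<close> by (simp add: I_def x0 v_def)
  qed
  have step: "x k \<in> branch_domain m n (a (k + 1)) (b (k + 1)) \<and> I (k + 1)" if "I k" for k
  proof -
    let ?a = "a (k + 1)" and ?b = "b (k + 1)"
    have a': "?a \<in> {1..m - 1}" and b': "?b \<in> {1..n - 1}" using ab by simp_all
    have "2 * (k + 1) - 1 = 2 * k + 1" by simp
    then have Wk: "admissible n m ?a (W (2 * k + 1))"
      "is_derivative n m (sector_perm n m ?a \<circ> W (2 * k + 1)) (W (2 * (k + 1)))"
      "admissible m n ?b (W (2 * (k + 1)))"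
      using W [rule_format, of "k + 1"] by simp_all
    have xk: "x k \<in> sector n 0" and path: "\<exists>K d X. grid_path m n (v k) K d X \<and> heads X (x k)"
      using that by (auto simp: I_def)
    have der: "is_derivative m n (v k) (W (2 * k + 1))"
    proof (cases "k = 0")
      case True
      then show ?thesis using W1 by (simp add: v_def)
    next
      case False
      then show ?thesis using W [rule_format, of k] by (simp add: v_def)
    qed
    note S1 = renormalization_step [OF m n \<open>reflections_realized n m\<close> xk path der Wk(1) a']
    define z where "z = phi_dir m ?a (dir_action (gamma_matrix m n) (x k))"
    have z: "z \<in> sector m 0" unfolding z_def using m by (intro phi_dir_in_sector S1) auto
    note S2 = renormalization_step [OF n m \<open>reflections_realized m n\<close> z S1(2) [folded z_def] Wk(2,3) b']
    have xs: "x (k + 1) = phi_dir n ?b (dir_action (gamma_matrix n m) z)"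
      by (simp only: x_step farey_branch_def z_def)
    have "x k \<in> branch_domain m n ?a ?b"
      using xk S1(1) S2(1) by (simp add: branch_domain_def z_def)
    moreover have "x (k + 1) \<in> sector n 0"
      unfolding xs using n by (intro phi_dir_in_sector S2) auto
    moreover have "\<exists>K d X. grid_path m n (v (k + 1)) K d X \<and> heads X (x (k + 1))"
      using S2(2) unfolding xs v_def by simp
    ultimately show ?thesis by (simp add: I_def)
  qed
  have I: "I k" for k
  proof (induction k)
    case (Suc k)
    then show ?case using step [of k] by simp
  qed fact
  have dom: "x k \<in> branch_domain m n (a (k + 1)) (b (k + 1))" for k
    using step [OF I] by blast
  have sec: "x k \<in> sector n 0" for k using I [of k] by (simp add: I_def)
  have cyl: "x 0 \<in> cf_cylinder m n a b k" for k
    by (rule cf_cylinder_orbit [where x = x, OF dom x_step sec])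
  \<comment> \<open>The orbit puts \<open>x 0\<close> into every cylinder and the cone estimate
    excludes any other point, so \<open>the_elem\<close> returns \<open>x 0\<close>.\<close>
  have "y = x 0" if "y \<in> (\<Inter>k\<in>{1..}. cf_cylinder m n a b k)" for y
    by (rule cf_cylinder_unique [OF m n \<open>m * n \<ge> 6\<close> ab _ cyl]) (use that in simp)
  then have "(\<Inter>k\<in>{1..}. cf_cylinder m n a b k) = {x 0}"
    using cyl by blast
  then have "cf_tail m n a b = phi_dir n b0 \<theta>" by (simp add: cf_tail_def x0)
  moreover have "inj_on (phi_dir n b0) (sector n b0)" by (auto simp: inj_on_def phi_dir_def)
  ultimately show ?thesis
    using \<open>\<theta> \<in> sector n b0\<close> by (simp add: cf_value_def)
qed

end
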